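(* Let $\Omega\subset\mathbb R^n$ be a bounded Lipschitz domain decomposed into Lipschitz subdomains $K\in\mathcal T_h$, let $0\le k\le n$ and $f\in L^2\Lambda^k(\Omega)$. Consider the problem: find $\sigma\in W^{k-1}$, $u\in W^k$, $\bar p\in\overline{\mathfrak H}^k$, $\hat u^{\mathrm{nor}}\in\widehat W^{k-1,\mathrm{nor}}$, $\hat\rho^{\mathrm{nor}}\in\widehat W^{k,\mathrm{nor}}$, $p\in\mathfrak H^k$, $\bar u\in\overline{\mathfrak H}^k$, $\hat\sigma^{\mathrm{tan}}\in\widehat V^{k-1,\mathrm{tan}}$, $\hat u^{\mathrm{tan}}\in\widehat V^{k,\mathrm{tan}}$ such that (a) $(\sigma,\tau)_{\mathcal T_h}-(u,\mathrm d\tau)_{\mathcal T_h}+\langle\hat u^{\mathrm{nor}},\tau^{\mathrm{tan}}\rangle_{\partial\mathcal T_h}=0$ for all $\tau\in W^{k-1}$; (b) $(\mathrm d\sigma,v)_{\mathcal T_h}+(\mathrm du,\mathrm dv)_{\mathcal T_h}+(\bar p+p,v)_{\mathcal T_h}-\langle\hat\rho^{\mathrm{nor}},v^{\mathrm{tan}}\rangle_{\partial\mathcal T_h}=(f,v)_{\mathcal T_h}$ for all $v\in W^k$; (c) $(\bar u-u,\bar q)_{\mathcal T_h}=0$ for all $\bar q\in\overline{\mathfrak H}^k$; (d) $\langle\hat\sigma^{\mathrm{tan}}-\sigma^{\mathrm{tan}},\hat v^{\mathrm{nor}}\rangle_{\partial\mathcal T_h}=0$ for all $\hat v^{\mathrm{nor}}\in\widehat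 W^{k-1,\mathrm{nor}}$; (e) $\langle\hat u^{\mathrm{tan}}-u^{\mathrm{tan}},\hat\eta^{\mathrm{nor}}\rangle_{\partial\mathcal T_h}=0$ for all $\hat\eta^{\mathrm{nor}}\in\widehat W^{k,\mathrm{nor}}$; (f) $(u,q)_{\mathcal T_h}=0$ for all $q\in\mathfrak H^k$; (g) $(\bar p,\bar v)_{\mathcal T_h}=0$ for all $\bar v\in\overline{\mathfrak H}^k$; (h) $\langle\hat u^{\mathrm{nor}},\hat\tau^{\mathrm{tan}}\rangle_{\partial\mathcal T_h}=0$ for all $\hat\tau^{\mathrm{tan}}\in\widehat V^{k-1,\mathrm{tan}}$; (i) $\langle\hat\rho^{\mathrm{nor}},\hat v^{\mathrm{tan}}\rangle_{\partial\mathcal T_h}=0$ for all $\hat v^{\mathrm{tan}}\in\widehat V^{k,\mathrm{tan}}$. The following are equivalent: 1. $(\sigma,u,\bar p,\hat u^{\mathrm{nor}},\hat\rho^{\mathrm{nor}},p,\bar u,\hat\sigma^{\mathrm{tan}},\hat u^{\mathrm{tan}})$ is a solution to (a)--(i). 2. $(\sigma,u,p)\in H\Lambda^{k-1}(\Omega)\times H\Lambda^k(\Omega)\times\mathfrak H^k$ is a solution of the mixed Hodge–Laplace problem $$(\sigma,\tau)_\Omega-(u,\mathrm d\tau)_\Omega=0\ \ \forall\tau\in H\Lambda^{k-1}(\Omega),$$ $$(\mathrm d\sigma,v)_\Omega+(\mathrm du,\mathrm dv)_\Omega+(p,v)_\Omega=(f,v)_\Omega\ \ \forall v\in H\Lambda^k(\Omega),$$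 $$(u,q)_\Omega=0\ \ \forall q\in\mathfrak H^k,$$ and furthermore $\bar p=0$, $\hat u^{\mathrm{nor}}=u^{\mathrm{nor}}$, $\hat\rho^{\mathrm{nor}}=(\mathrm du)^{\mathrm{nor}}$, $\bar u$ is the $L^2$-orthogonal projection of $u$ onto $\overline{\mathfrak H}^k$, $\hat\sigma^{\mathrm{tan}}=\sigma^{\mathrm{tan}}$, and $\hat u^{\mathrm{tan}}=u^{\mathrm{tan}}$.
   Context: Function spaces. $L^2\Lambda^k(\Omega)$ is the space of $L^2$ differential $k$-forms with inner product $(v,w)_\Omega=\int_\Omega v\wedge\star w$; $\mathrm d$ is the (distributional) exterior derivative and $\delta=(-1)^k\star^{-1}\mathrm d\star$ the codifferential on $k$-forms. $H\Lambda^k(\Omega)=\{v\in L^2\Lambda^k:\mathrm dv\in L^2\}$ and $H^*\Lambda^k(\Omega)=\{v\in L^2\Lambda^k:\delta v\in L^2\}$, with graph norms; $\mathring H\Lambda^k(\Omega)$, $\mathring H^*\Lambda^k(\Omega)$ are the closures of the smooth compactly supported $k$-forms. Spaces of forms of degree outside $\{0,\dots,n\}$ are zero. The same notation is used on any Lipschitz subdomain $K$. Traces. On a Lipschitz domain $K$, the tangential trace $v^{\mathrm{tan}}$ of $v\in H\Lambda^j(K)$ is (identified with) its class in $H\Lambda^j(K)/\mathring H\Lambda^j(K)$, and the normal trace $\eta^{\mathrm{nor}}$ of $\eta\in H^*\Lambda^{j+1}(K)$ is its class in $H^*\Lambda^{j+1}(K)/\mathring H^*\Lambda^{j+1}(K)$;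 the pairing is $\langle v^{\mathrm{tan}},\eta^{\mathrm{nor}}\rangle_{\partial K}=(\mathrm dv,\eta)_K-(v,\delta\eta)_K$ (written in either order). For smooth forms $v^{\mathrm{tan}}=\operatorname{tr}v$ and $\eta^{\mathrm{nor}}=\hat\star^{-1}\operatorname{tr}\star\eta$ with $\operatorname{tr}$ the pullback to $\partial K$ and $\hat\star$ the Hodge star of $\partial K$. Decomposition. $\mathcal T_h$ is a finite decomposition of $\Omega$ into non-overlapping Lipschitz subdomains. $H\Lambda^k(\mathcal T_h)=\prod_KH\Lambda^k(K)$, $H^*\Lambda^k(\mathcal T_h)=\prod_KH^*\Lambda^k(K)$; $\mathrm d$, $\delta$ and traces of broken forms are taken subdomain by subdomain; $(\cdot,\cdot)_{\mathcal T_h}=\sum_K(\cdot,\cdot)_K$, $\langle\cdot,\cdot\rangle_{\partial\mathcal T_h}=\sum_K\langle\cdot,\cdot\rangle_{\partial K}$. Forms on $\Omega$ are viewed as broken forms by restriction. Spaces in the problem. $W^j=H\Lambda^j(\mathcal T_h)$; $\overline{\mathfrak H}^k=\prod_K\mathring{\mathfrak H}^k(K)$ with $\mathring{\mathfrak H}^k(K)=\{v\in\mathring H\Lambda^k(K):\mathrm dv=0,\ v\perp_{L^2}\mathrm d\mathring H\Lambda^{k-1}(K)\}$; $\widehat W^{j,\mathrm{nor}}=\{\eta^{\mathrm{nor}}:\eta\in H^*\Lambda^{j+1}(\mathcal T_h)\}$; $\widehat V^{j,\mathrm{tan}}=\{v^{\mathrm{tan}}:v\in H\Lambda^j(\Omega)\}$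 (traces on $\partial\mathcal T_h=\bigsqcup_K\partial K$); $\mathfrak H^k=\{v\in H\Lambda^k(\Omega):\mathrm dv=0,\ v\perp_{L^2}\mathrm dH\Lambda^{k-1}(\Omega)\}$. *)

theory Defs
  imports "HOL-Analysis.Analysis"
begin

section \<open>Exterior algebra of the Euclidean space\<close>

text \<open>
  An element of the exterior algebra of \<^typ>\<open>real^'n\<close> is given by its coefficients in the basis
  \<open>dx\<^sub>I = dx\<^sub>i\<^sub>1 \<and> \<dots> \<and> dx\<^sub>i\<^sub>k\<close>, \<open>I = {i\<^sub>1 < \<dots> < i\<^sub>k}\<close>; the linear order of the index type \<^typ>\<open>'n\<close>
  also fixes the orientation. Degrees are integers, so that forms of negative degree or of degree
  larger than \<open>n\<close> vanish without special treatment.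
\<close>

type_synonym 'n alt = "real ^ ('n set)"
type_synonym 'n form = "real ^ 'n \<Rightarrow> 'n alt"
type_synonym 'n region = "(real ^ 'n) set"

definition alt_deg :: "int \<Rightarrow> 'n::finite alt set" where
  "alt_deg j = {a. \<forall>I. a $ I \<noteq> 0 \<longrightarrow> int (card I) = j}"

text \<open>\<open>dx\<^sub>I \<and> dx\<^sub>J = shuffle_sign I J \<cdot> dx\<^sub>I\<^sub>\<union>\<^sub>J\<close> for disjoint \<open>I\<close>, \<open>J\<close>.\<close>

definition shuffle_sign :: "'n::{finite,linorder} set \<Rightarrow> 'n set \<Rightarrow> real" where
  "shuffle_sign I J = (-1) ^ card {(i, j). i \<in> I \<and> j \<in> J \<and> j < i}"

definition wedge :: "'n::{finite,linorder} alt \<Rightarrow> 'n alt \<Rightarrow> 'n alt" where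
  "wedge a b = (\<chi> J. \<Sum>I\<in>Pow J. shuffle_sign I (J - I) * a $ I * b $ (J - I))"

text \<open>The Hodge star: \<open>\<star>dx\<^sub>I = shuffle_sign I (-I) \<cdot> dx\<^sub>-\<^sub>I\<close>, so that \<open>dx\<^sub>I \<and> \<star>dx\<^sub>I\<close> is the volume form.\<close>

definition hodge :: "'n::{finite,linorder} alt \<Rightarrow> 'n alt" where
  "hodge a = (\<chi> J. shuffle_sign (- J) J * a $ (- J))"

text \<open>The integral of an \<open>n\<close>-form is the integral of its coefficient of the volume form.\<close>

definition form_integral :: "'n region \<Rightarrow> 'n::finite form \<Rightarrow> real" where
  "form_integral U \<omega> = integral\<^sup>L (lebesgue_on U) (\<lambda>x. \<omega> x $ UNIV)"


section \<open>Smooth compactly supported forms\<close>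

definition partial_deriv :: "'n::finite \<Rightarrow> (real ^ 'n \<Rightarrow> 'b::real_normed_vector) \<Rightarrow> real ^ 'n \<Rightarrow> 'b" where
  "partial_deriv i \<phi> x = frechet_derivative \<phi> (at x) (axis i 1)"

primrec C_k :: "nat \<Rightarrow> (real ^ 'n::finite \<Rightarrow> 'b::real_normed_vector) \<Rightarrow> bool" where
  "C_k 0 \<phi> \<longleftrightarrow> continuous_on UNIV \<phi>"
| "C_k (Suc m) \<phi> \<longleftrightarrow> (\<forall>x. \<phi> differentiable (at x)) \<and> (\<forall>i. C_k m (partial_deriv i \<phi>))"

text \<open>Smooth forms of degree \<open>j\<close> with compact support in \<open>U\<close>, extended by zero to the whole space.\<close>

definition test_forms :: "'n region \<Rightarrow> int \<Rightarrow> 'n::finite form set" where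
  "test_forms U j = {\<phi>. (\<forall>m. C_k m \<phi>) \<and> (\<forall>x. \<phi> x \<in> alt_deg j) \<and>
     compact (closure {x. \<phi> x \<noteq> 0}) \<and> closure {x. \<phi> x \<noteq> 0} \<subseteq> U}"

definition smooth_d :: "'n::{finite,linorder} form \<Rightarrow> 'n form" where
  "smooth_d \<phi> x = (\<Sum>i\<in>UNIV. wedge (axis {i} 1) (partial_deriv i \<phi> x))"


section \<open>Sobolev spaces of differential forms\<close>

text \<open>
  Square integrable forms are represented by functions, and only their values on \<open>U\<close> up to null
  sets matter: all spaces below are closed under equality almost everywhere on \<open>U\<close>.
\<close>

definition L2_forms :: "'n region \<Rightarrow> int \<Rightarrow> 'n::finite form set" where
  "L2_forms U j = {v. v \<in> borel_measurable (lebesgue_on U) \<and>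
     integrable (lebesgue_on U) (\<lambda>x. (norm (v x))\<^sup>2) \<and> (AE x in lebesgue_on U. v x \<in> alt_deg j)}"

definition L2_inner :: "'n region \<Rightarrow> 'n::{finite,linorder} form \<Rightarrow> 'n form \<Rightarrow> real" where
  "L2_inner U v w = form_integral U (\<lambda>x. wedge (v x) (hodge (w x)))"

text \<open>
  The distributional exterior derivative of a \<open>j\<close>-form \<open>v\<close>: the sign is the one for which
  \<open>\<integral> dv \<and> \<phi> + (-1)\<^sup>j \<integral> v \<and> d\<phi> = \<integral> d(v \<and> \<phi>) = 0\<close> holds for smooth \<open>v\<close>.
\<close>

definition has_weak_d :: "'n region \<Rightarrow> int \<Rightarrow> 'n::{finite,linorder} form \<Rightarrow> 'n form \<Rightarrow> bool" where
  "has_weak_d U j v w \<longleftrightarrow> (\<forall>\<phi>\<in>test_forms U (int CARD('n) - j - 1).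
     form_integral U (\<lambda>x. wedge (w x) (\<phi> x)) =
     (-1) powi (j + 1) * form_integral U (\<lambda>x. wedge (v x) (smooth_d \<phi> x)))"

definition H_d :: "'n region \<Rightarrow> int \<Rightarrow> 'n::{finite,linorder} form set" where
  "H_d U j = {v \<in> L2_forms U j. \<exists>w\<in>L2_forms U (j + 1). has_weak_d U j v w}"

text \<open>For \<open>v \<in> H_d U j\<close> this is determined up to null sets.\<close>

definition ext_d :: "'n region \<Rightarrow> int \<Rightarrow> 'n::{finite,linorder} form \<Rightarrow> 'n form" where
  "ext_d U j v = (SOME w. w \<in> L2_forms U (j + 1) \<and> has_weak_d U j v w)"

text \<open>The codifferential \<open>\<delta> = (-1)\<^sup>j \<star>\<^sup>-\<^sup>1 d \<star>\<close> on \<open>j\<close>-forms; \<open>\<delta>v\<close> is in \<open>L\<^sup>2\<close> iff \<open>d \<star>v\<close> is.\<close>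

definition codiff :: "'n region \<Rightarrow> int \<Rightarrow> 'n::{finite,linorder} form \<Rightarrow> 'n form" where
  "codiff U j v = (\<lambda>x. (-1) powi j *\<^sub>R inv hodge (ext_d U (int CARD('n) - j) (\<lambda>y. hodge (v y)) x))"

definition H_delta :: "'n region \<Rightarrow> int \<Rightarrow> 'n::{finite,linorder} form set" where
  "H_delta U j = {v \<in> L2_forms U j. (\<lambda>x. hodge (v x)) \<in> H_d U (int CARD('n) - j)}"

definition norm_d :: "'n region \<Rightarrow> int \<Rightarrow> 'n::{finite,linorder} form \<Rightarrow> real" where
  "norm_d U j v = sqrt (L2_inner U v v + L2_inner U (ext_d U j v) (ext_d U j v))"

definition norm_delta :: "'n region \<Rightarrow> int \<Rightarrow> 'n::{finite,linorder} form \<Rightarrow> real" where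
  "norm_delta U j v = sqrt (L2_inner U v v + L2_inner U (codiff U j v) (codiff U j v))"

definition H_d0 :: "'n region \<Rightarrow> int \<Rightarrow> 'n::{finite,linorder} form set" where
  "H_d0 U j = {v \<in> H_d U j. \<forall>\<epsilon>>0. \<exists>\<phi>\<in>test_forms U j. norm_d U j (\<lambda>x. v x - \<phi> x) < \<epsilon>}"

definition H_delta0 :: "'n region \<Rightarrow> int \<Rightarrow> 'n::{finite,linorder} form set" where
  "H_delta0 U j = {v \<in> H_delta U j. \<forall>\<epsilon>>0. \<exists>\<phi>\<in>test_forms U j. norm_delta U j (\<lambda>x. v x - \<phi> x) < \<epsilon>}"

definition harmonic :: "'n region \<Rightarrow> int \<Rightarrow> 'n::{finite,linorder} form set" where
  "harmonic U k = {v \<in> H_d U k. (AE x in lebesgue_on U. ext_d U k v x = 0) \<and>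
     (\<forall>w\<in>H_d U (k - 1). L2_inner U v (ext_d U (k - 1) w) = 0)}"

definition harmonic0 :: "'n region \<Rightarrow> int \<Rightarrow> 'n::{finite,linorder} form set" where
  "harmonic0 U k = {v \<in> H_d0 U k. (AE x in lebesgue_on U. ext_d U k v x = 0) \<and>
     (\<forall>w\<in>H_d0 U (k - 1). L2_inner U v (ext_d U (k - 1) w) = 0)}"


section \<open>Traces\<close>

text \<open>Traces are the cosets in \<open>H_d U j / H_d0 U j\<close> and \<open>H_delta U j / H_delta0 U j\<close>.\<close>

definition tan_trace :: "'n region \<Rightarrow> int \<Rightarrow> 'n::{finite,linorder} form \<Rightarrow> 'n form set" where
  "tan_trace U j v = {w \<in> H_d U j. (\<lambda>x. w x - v x) \<in> H_d0 U j}"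

definition nor_trace :: "'n region \<Rightarrow> int \<Rightarrow> 'n::{finite,linorder} form \<Rightarrow> 'n form set" where
  "nor_trace U j \<eta> = {\<zeta> \<in> H_delta U j. (\<lambda>x. \<zeta> x - \<eta> x) \<in> H_delta0 U j}"

text \<open>
  The pairing of a tangential trace of degree \<open>j\<close> with a normal trace of a \<open>(j + 1)\<close>-form;
  the value does not depend on the representatives.
\<close>

definition trace_pair ::
    "'n region \<Rightarrow> int \<Rightarrow> 'n::{finite,linorder} form set \<Rightarrow> 'n form set \<Rightarrow> real" where
  "trace_pair U j V E = (let v = (SOME v. v \<in> V); \<eta> = (SOME \<eta>. \<eta> \<in> E) in
     L2_inner U (ext_d U j v) \<eta> - L2_inner U v (codiff U (j + 1) \<eta>))"


section \<open>Lipschitz domains and decompositions\<close>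

text \<open>
  Near each boundary point the domain is, in the direction of some unit vector \<open>e\<close>, the region
  above the graph of a Lipschitz function on the hyperplane orthogonal to \<open>e\<close>.
\<close>

definition lipschitz_domain :: "'n::finite region \<Rightarrow> bool" where
  "lipschitz_domain U \<longleftrightarrow> open U \<and> connected U \<and> U \<noteq> {} \<and>
     (\<forall>p\<in>frontier U. \<exists>N e L g. open N \<and> p \<in> N \<and> norm e = 1 \<and>
        L-lipschitz_on {y. y \<bullet> e = 0} (g :: real ^ 'n \<Rightarrow> real) \<and>
        U \<inter> N = {x \<in> N. g (x - (x \<bullet> e) *\<^sub>R e) < x \<bullet> e})"

definition lipschitz_decomposition :: "'n::finite region \<Rightarrow> 'n region set \<Rightarrow> bool" where
  "lipschitz_decomposition \<Omega> T \<longleftrightarrow> finite T \<and> (\<forall>K\<in>T. lipschitz_domain K \<and> K \<subseteq> \<Omega>) \<and>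
     pairwise disjnt T \<and> closure \<Omega> = (\<Union>K\<in>T. closure K)"


section \<open>Broken forms and broken traces\<close>

text \<open>
  The elements of a decomposition \<open>T\<close> are disjoint, so a family \<open>(v\<^sub>K)\<^sub>K\<^sub>\<in>\<^sub>T\<close> of forms is encoded as a
  single function, whose values on \<open>K\<close> are those of \<open>v\<^sub>K\<close>. Restriction of a form on \<open>\<Omega>\<close> to a broken
  form is then the identity. Broken traces are families of cosets, extensional on \<open>T\<close>.
\<close>

definition broken_H_d :: "'n region set \<Rightarrow> int \<Rightarrow> 'n::{finite,linorder} form set" where
  "broken_H_d T j = {v. \<forall>K\<in>T. v \<in> H_d K j}"

definition broken_H_delta :: "'n region set \<Rightarrow> int \<Rightarrow> 'n::{finite,linorder} form set" where
  "broken_H_delta T j = {\<eta>. \<forall>K\<in>T. \<eta> \<in> H_delta K j}"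

definition broken_harmonic0 :: "'n region set \<Rightarrow> int \<Rightarrow> 'n::{finite,linorder} form set" where
  "broken_harmonic0 T k = {v. \<forall>K\<in>T. v \<in> harmonic0 K k}"

definition broken_d :: "'n region set \<Rightarrow> int \<Rightarrow> 'n::{finite,linorder} form \<Rightarrow> 'n form" where
  "broken_d T j v = (\<lambda>x. \<Sum>K\<in>T. indicator K x *\<^sub>R ext_d K j v x)"

definition broken_inner :: "'n region set \<Rightarrow> 'n::{finite,linorder} form \<Rightarrow> 'n form \<Rightarrow> real" where
  "broken_inner T v w = (\<Sum>K\<in>T. L2_inner K v w)"

type_synonym 'n broken_trace = "(real ^ 'n) set \<Rightarrow> 'n form set"

definition broken_tan :: "'n region set \<Rightarrow> int \<Rightarrow> 'n::{finite,linorder} form \<Rightarrow> 'n broken_trace" where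
  "broken_tan T j v = (\<lambda>K\<in>T. tan_trace K j v)"

definition broken_nor :: "'n region set \<Rightarrow> int \<Rightarrow> 'n::{finite,linorder} form \<Rightarrow> 'n broken_trace" where
  "broken_nor T j \<eta> = (\<lambda>K\<in>T. nor_trace K j \<eta>)"

definition trace_diff ::
    "'n region set \<Rightarrow> 'n::finite broken_trace \<Rightarrow> 'n broken_trace \<Rightarrow> 'n broken_trace" where
  "trace_diff T A B = (\<lambda>K\<in>T. {(\<lambda>x. v x - w x) | v w. v \<in> A K \<and> w \<in> B K})"

definition broken_pair ::
    "'n region set \<Rightarrow> int \<Rightarrow> 'n::{finite,linorder} broken_trace \<Rightarrow> 'n broken_trace \<Rightarrow> real" where
  "broken_pair T j V E = (\<Sum>K\<in>T. trace_pair K j (V K) (E K))"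

text \<open>Following the usual indexing, \<open>W_nor T j\<close> consists of normal traces of \<open>(j + 1)\<close>-forms.\<close>

definition W_nor :: "'n region set \<Rightarrow> int \<Rightarrow> 'n::{finite,linorder} broken_trace set" where
  "W_nor T j = broken_nor T (j + 1) ` broken_H_delta T (j + 1)"

definition V_tan :: "'n region \<Rightarrow> 'n region set \<Rightarrow> int \<Rightarrow> 'n::{finite,linorder} broken_trace set" where
  "V_tan \<Omega> T j = broken_tan T j ` H_d \<Omega> j"


section \<open>The two problems\<close>

definition hybrid_solution ::
    "'n region \<Rightarrow> 'n region set \<Rightarrow> int \<Rightarrow> 'n::{finite,linorder} form \<Rightarrow>
     'n form \<Rightarrow> 'n form \<Rightarrow> 'n form \<Rightarrow> 'n broken_trace \<Rightarrow> 'n broken_trace \<Rightarrow>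
     'n form \<Rightarrow> 'n form \<Rightarrow> 'n broken_trace \<Rightarrow> 'n broken_trace \<Rightarrow> bool" where
  "hybrid_solution \<Omega> T k f \<sigma> u pbar u_nor \<rho>_nor p ubar \<sigma>_tan u_tan \<longleftrightarrow>
     \<sigma> \<in> broken_H_d T (k - 1) \<and> u \<in> broken_H_d T k \<and> pbar \<in> broken_harmonic0 T k \<and>
     u_nor \<in> W_nor T (k - 1) \<and> \<rho>_nor \<in> W_nor T k \<and> p \<in> harmonic \<Omega> k \<and>
     ubar \<in> broken_harmonic0 T k \<and> \<sigma>_tan \<in> V_tan \<Omega> T (k - 1) \<and> u_tan \<in> V_tan \<Omega> T k \<and>
     (\<forall>\<tau>\<in>broken_H_d T (k - 1).
        broken_inner T \<sigma> \<tau> - broken_inner T u (broken_d T (k - 1) \<tau>)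
        + broken_pair T (k - 1) (broken_tan T (k - 1) \<tau>) u_nor = 0) \<and>
     (\<forall>v\<in>broken_H_d T k.
        broken_inner T (broken_d T (k - 1) \<sigma>) v
        + broken_inner T (broken_d T k u) (broken_d T k v)
        + broken_inner T (\<lambda>x. pbar x + p x) v
        - broken_pair T k (broken_tan T k v) \<rho>_nor = broken_inner T f v) \<and>
     (\<forall>qbar\<in>broken_harmonic0 T k. broken_inner T (\<lambda>x. ubar x - u x) qbar = 0) \<and>
     (\<forall>v_nor\<in>W_nor T (k - 1).
        broken_pair T (k - 1) (trace_diff T \<sigma>_tan (broken_tan T (k - 1) \<sigma>)) v_nor = 0) \<and>
     (\<forall>\<eta>_nor\<in>W_nor T k. broken_pair T k (trace_diff T u_tan (broken_tan T k u)) \<eta>_nor = 0) \<and>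
     (\<forall>q\<in>harmonic \<Omega> k. broken_inner T u q = 0) \<and>
     (\<forall>vbar\<in>broken_harmonic0 T k. broken_inner T pbar vbar = 0) \<and>
     (\<forall>\<tau>_tan\<in>V_tan \<Omega> T (k - 1). broken_pair T (k - 1) \<tau>_tan u_nor = 0) \<and>
     (\<forall>v_tan\<in>V_tan \<Omega> T k. broken_pair T k v_tan \<rho>_nor = 0)"

definition mixed_solution ::
    "'n region \<Rightarrow> int \<Rightarrow> 'n::{finite,linorder} form \<Rightarrow>
     'n form \<Rightarrow> 'n form \<Rightarrow> 'n form \<Rightarrow> bool" where
  "mixed_solution \<Omega> k f \<sigma> u p \<longleftrightarrow>
     \<sigma> \<in> H_d \<Omega> (k - 1) \<and> u \<in> H_d \<Omega> k \<and> p \<in> harmonic \<Omega> k \<and>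
     (\<forall>\<tau>\<in>H_d \<Omega> (k - 1). L2_inner \<Omega> \<sigma> \<tau> - L2_inner \<Omega> u (ext_d \<Omega> (k - 1) \<tau>) = 0) \<and>
     (\<forall>v\<in>H_d \<Omega> k. L2_inner \<Omega> (ext_d \<Omega> (k - 1) \<sigma>) v
        + L2_inner \<Omega> (ext_d \<Omega> k u) (ext_d \<Omega> k v) + L2_inner \<Omega> p v = L2_inner \<Omega> f v) \<and>
     (\<forall>q\<in>harmonic \<Omega> k. L2_inner \<Omega> u q = 0)"

text \<open>The orthogonal projection of \<open>u\<close> onto \<^term>\<open>broken_harmonic0 T k\<close>, determined up to null sets.\<close>

definition is_broken_harmonic0_proj ::
    "'n region set \<Rightarrow> int \<Rightarrow> 'n::{finite,linorder} form \<Rightarrow> 'n form \<Rightarrow> bool" where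
  "is_broken_harmonic0_proj T k u ubar \<longleftrightarrow> ubar \<in> broken_harmonic0 T k \<and>
     (\<forall>q\<in>broken_harmonic0 T k. broken_inner T (\<lambda>x. u x - ubar x) q = 0)"

end

theory Submission
  imports Defs
begin

text \<open>
  On an open set \<open>U\<close>, the spaces \<open>H_d0 U j\<close> and \<open>H_delta0 U (j + 1)\<close> are the left and right kernels of the
  pairing \<open>(dv, \<eta>) - (v, \<delta>\<eta>)\<close> on \<open>H_d U j \<times> H_delta U (j + 1)\<close>. Indeed, a pair orthogonal to the graph of
  \<open>d\<close> on test forms has the form \<open>(- \<delta>\<eta>, \<eta>)\<close>, so this says that the closure of the graph is its second
  orthogonal complement in \<open>L\<^sup>2\<close>; the same holds with the roles of \<open>d\<close> and \<open>\<delta>\<close> exchanged. Hence traces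
  are determined by the pairing.

  By (d) and (e), \<open>\<sigma>\<close> and \<open>u\<close> have the tangential traces of conforming forms and are therefore conforming,
  as the boundaries of the elements are null sets. By (g), \<open>pbar\<close> is orthogonal to itself. Testing (a)
  and (b) with forms compactly supported in one element gives \<open>\<delta>u = \<sigma>\<close> and \<open>\<delta>du = f - d\<sigma> - p\<close> there;
  testing with arbitrary forms on the element identifies the normal traces. Then (h) and (i) remove the
  boundary terms from (a) and (b) for conforming test forms, which leaves the mixed problem. Conversely,
  the mixed problem yields the two codifferentials on \<open>\<Omega>\<close>, hence on each element.
\<close>

section \<open>Square integrable functions\<close>

text \<open>The equations see boundary data through pairings, whereas \<open>H_d0\<close>,
  \<open>H_delta0\<close> and hence traces are defined by approximation with test forms. Passing
  from a vanishing pairing to approximability is done by orthogonal projection instead of explicit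
  smoothing, so it works on any open set. Functions in \<open>L2\<close> take values in an arbitrary
  Euclidean space and lie in a prescribed subspace; a form paired with its derivative is again such
  a function, and one lemma treats the graphs of \<open>d\<close> and \<delta> alike.

  Signs are the second obstacle: weak derivatives are defined by wedge products and by conjugation
  with the Hodge star. Both are recast as adjointness in the inner product, \<open>d\<close> against
  \<open>smooth_codiff\<close> and \<delta> against \<open>smooth_d\<close>, which confines the
  signs to that translation. Since \<open>ext_d\<close> and \<open>codiff\<close> are choices, they
  are determined almost everywhere; bump functions supply this uniqueness.

  Finally, (b) has the shape of (a): the residual f - d\<sigma> - p relates to du as \<sigma>
  relates to u. One lemma about a pair (s, z), with s in the role of \<delta>z, therefore serves
  both normal traces.\<close>

definition L2 :: "'a measure \<Rightarrow> 'b::euclidean_space set \<Rightarrow> ('a \<Rightarrow> 'b) set" where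
  "L2 M S = {v \<in> borel_measurable M. integrable M (\<lambda>x. (norm (v x))\<^sup>2) \<and> (AE x in M. v x \<in> S)}"

definition ip :: "'a measure \<Rightarrow> ('a \<Rightarrow> 'b::euclidean_space) \<Rightarrow> ('a \<Rightarrow> 'b) \<Rightarrow> real" where
  "ip M v w = (LINT x|M. v x \<bullet> w x)"

abbreviation sqn :: "'a measure \<Rightarrow> ('a \<Rightarrow> 'b::euclidean_space) \<Rightarrow> real" where
  "sqn M v \<equiv> ip M v v"

lemma L2_D:
  assumes "v \<in> L2 M S"
  shows "v \<in> borel_measurable M" "integrable M (\<lambda>x. (norm (v x))\<^sup>2)" "AE x in M. v x \<in> S"
  using assms by (auto simp: L2_def)

lemma integrable_inner_L2:
  assumes "v \<in> L2 M S" "w \<in> L2 M R"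
  shows "integrable M (\<lambda>x. v x \<bullet> w x)"
proof (rule Bochner_Integration.integrable_bound)
  show "integrable M (\<lambda>x. (norm (v x))\<^sup>2 + (norm (w x))\<^sup>2)"
    using assms by (auto dest: L2_D)
  show "(\<lambda>x. v x \<bullet> w x) \<in> borel_measurable M"
    using L2_D(1)[OF assms(1)] L2_D(1)[OF assms(2)] by measurable
  have "\<bar>a \<bullet> b\<bar> \<le> (norm a)\<^sup>2 + (norm b)\<^sup>2" for a b :: 'b
    using Cauchy_Schwarz_ineq2[of a b] sum_squares_bound[of "norm a" "norm b"]
      mult_nonneg_nonneg[OF norm_ge_zero[of a] norm_ge_zero[of b]] by linarith
  then show "AE x in M. norm (v x \<bullet> w x) \<le> norm ((norm (v x))\<^sup>2 + (norm (w x))\<^sup>2)"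
    by auto
qed

lemma L2_linear:
  assumes "v \<in> L2 M S" "bounded_linear L" "\<And>a. a \<in> S \<Longrightarrow> L a \<in> R"
  shows "(\<lambda>x. L (v x)) \<in> L2 M R"
proof -
  obtain B where B: "\<And>a. norm (L a) \<le> norm a * B" using bounded_linear.bounded[OF assms(2)] by blast
  have m: "(\<lambda>x. L (v x)) \<in> borel_measurable M"
    using borel_measurable_continuous_on[OF linear_continuous_on[OF assms(2)] L2_D(1)[OF assms(1)]] .
  have "integrable M (\<lambda>x. (norm (L (v x)))\<^sup>2)"
  proof (rule Bochner_Integration.integrable_bound)
    show "integrable M (\<lambda>x. (norm (v x))\<^sup>2 * B\<^sup>2)" using L2_D(2)[OF assms(1)] by simp
    have "(norm (L a))\<^sup>2 \<le> (norm a)\<^sup>2 * B\<^sup>2" for a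
      using power_mono[OF B[of a], of 2] by (simp add: power_mult_distrib)
    then show "AE x in M. norm ((norm (L (v x)))\<^sup>2) \<le> norm ((norm (v x))\<^sup>2 * B\<^sup>2)" by simp
  qed (use m in measurable)
  moreover have "AE x in M. L (v x) \<in> R" using L2_D(3)[OF assms(1)] assms(3) by auto
  ultimately show ?thesis using m by (simp add: L2_def)
qed

lemma L2_add:
  assumes "subspace S" "v \<in> L2 M S" "w \<in> L2 M S"
  shows "(\<lambda>x. v x + w x) \<in> L2 M S"
proof -
  note [measurable] = L2_D(1)[OF assms(2)] L2_D(1)[OF assms(3)]
  have m: "(\<lambda>x. v x + w x) \<in> borel_measurable M" by measurable
  have "integrable M (\<lambda>x. (v x \<bullet> v x + w x \<bullet> w x) + 2 * (v x \<bullet> w x))"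
    by (intro Bochner_Integration.integrable_add integrable_mult_right integrable_inner_L2[OF assms(2,3)] integrable_inner_L2[OF assms(2,2)]
        integrable_inner_L2[OF assms(3,3)])
  then have "integrable M (\<lambda>x. (norm (v x + w x))\<^sup>2)"
    by (simp add: power2_norm_eq_inner inner_add algebra_simps inner_commute)
  moreover have "AE x in M. v x + w x \<in> S"
    using L2_D(3)[OF assms(2)] L2_D(3)[OF assms(3)] subspace_add[OF assms(1)] by auto
  ultimately show ?thesis using m by (simp add: L2_def)
qed

lemma L2_scaleR:
  assumes "subspace S" "v \<in> L2 M S"
  shows "(\<lambda>x. c *\<^sub>R v x) \<in> L2 M S"
  by (rule L2_linear[OF assms(2) bounded_linear_scaleR_right]) (rule subspace_scale[OF assms(1)])

lemma L2_diff:
  assumes "subspace S" "v \<in> L2 M S" "w \<in> L2 M S"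
  shows "(\<lambda>x. v x - w x) \<in> L2 M S"
  using L2_add[OF assms(1,2) L2_scaleR[OF assms(1,3), of "-1"]] by simp

lemma L2_zero: "subspace S \<Longrightarrow> (\<lambda>x. 0) \<in> L2 M S"
  by (simp add: L2_def subspace_0)

lemma ip_commute: "ip M v w = ip M w v"
  by (simp add: ip_def inner_commute)

lemma ip_add_left:
  assumes "v \<in> L2 M S" "w \<in> L2 M S'" "z \<in> L2 M R"
  shows "ip M (\<lambda>x. v x + w x) z = ip M v z + ip M w z"
  using integrable_inner_L2[OF assms(1,3)] integrable_inner_L2[OF assms(2,3)]
  by (simp add: ip_def inner_add_left)

lemma ip_diff_left:
  assumes "v \<in> L2 M S" "w \<in> L2 M S'" "z \<in> L2 M R"
  shows "ip M (\<lambda>x. v x - w x) z = ip M v z - ip M w z"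
  using integrable_inner_L2[OF assms(1,3)] integrable_inner_L2[OF assms(2,3)]
  by (simp add: ip_def inner_diff_left)

lemma ip_scale_left: "ip M (\<lambda>x. c *\<^sub>R v x) z = c * ip M v z"
  by (simp add: ip_def)

lemma ip_minus_left: "ip M (\<lambda>x. - v x) z = - ip M v z"
  by (simp add: ip_def)

lemma ip_diff_right:
  assumes "v \<in> L2 M S" "w \<in> L2 M S'" "z \<in> L2 M R"
  shows "ip M z (\<lambda>x. v x - w x) = ip M z v - ip M z w"
  using ip_diff_left[OF assms] by (simp add: ip_commute)

lemma ip_scale_right: "ip M z (\<lambda>x. c *\<^sub>R v x) = c * ip M z v"
  by (simp add: ip_def)

lemma ip_cong_AE:
  assumes "AE x in M. v x = v' x" "AE x in M. w x = w' x"
    and "v \<in> L2 M S" "v' \<in> L2 M S'" "w \<in> L2 M R" "w' \<in> L2 M R'"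
  shows "ip M v w = ip M v' w'"
  unfolding ip_def
proof (rule Bochner_Integration.integral_cong_AE)
  show "AE x in M. v x \<bullet> w x = v' x \<bullet> w' x" using assms(1,2) by auto
qed (use assms(3-) in \<open>auto intro!: borel_measurable_integrable integrable_inner_L2\<close>)

lemma ip_nonneg: "0 \<le> ip M v v"
  by (simp add: ip_def)

lemma ip_self_eq_0:
  assumes "v \<in> L2 M S" "ip M v v = 0"
  shows "AE x in M. v x = 0"
  using assms integral_nonneg_eq_0_iff_AE[OF integrable_inner_L2[OF assms(1,1)]]
  by (simp add: ip_def)

text \<open>Evaluate at the minimizer \<open>- b / c\<close>; when \<open>c = 0\<close>, an affine
  function bounded below is constant. Besides Cauchy-Schwarz, this handles near-minimizers in the
  projection theorem, where \<open>a\<close> is the distance from the infimum.\<close>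

lemma discriminant_le:
  fixes a b c :: real
  assumes "\<And>t. 0 \<le> a + 2 * t * b + t\<^sup>2 * c" "0 \<le> c"
  shows "b\<^sup>2 \<le> a * c"
proof (cases "c = 0")
  case True
  have "b = 0"
  proof (rule ccontr)
    assume "b \<noteq> 0"
    \<comment> \<open>At this \<open>t\<close> the affine function takes the value -1.\<close>
    then show False using assms(1)[of "- (a + 1) / (2 * b)"] True by (simp add: field_simps)
  qed
  then show ?thesis using True by simp
next
  case False
  have "0 \<le> c * (a + 2 * (- b / c) * b + (- b / c)\<^sup>2 * c)"
    by (intro mult_nonneg_nonneg assms)
  also have "\<dots> = a * c - b\<^sup>2" using False by (simp add: field_simps power2_eq_square)
  finally show ?thesis by simp
qed

lemma ip_add_scale_self:
  assumes "v \<in> L2 M S" "w \<in> L2 M R"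
  shows "sqn M (\<lambda>x. v x + t *\<^sub>R w x) = ip M v v + 2 * t * ip M v w + t\<^sup>2 * ip M w w"
proof -
  have [simp]: "integrable M (\<lambda>x. v x \<bullet> w x)" "integrable M (\<lambda>x. v x \<bullet> v x)" "integrable M (\<lambda>x. w x \<bullet> w x)"
    using assms integrable_inner_L2 by blast+
  have "sqn M (\<lambda>x. v x + t *\<^sub>R w x) =
     (LINT x|M. v x \<bullet> v x + 2 * t * (v x \<bullet> w x) + t\<^sup>2 * (w x \<bullet> w x))"
    by (simp add: ip_def inner_add inner_commute algebra_simps power2_eq_square)
  then show ?thesis by (simp add: ip_def)
qed

lemma ip_Cauchy_Schwarz:
  assumes "v \<in> L2 M S" "w \<in> L2 M R"
  shows "(ip M v w)\<^sup>2 \<le> ip M v v * ip M w w"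
proof (rule discriminant_le)
  show "0 \<le> ip M v v + 2 * t * ip M v w + t\<^sup>2 * ip M w w" for t
    unfolding ip_add_scale_self[OF assms, symmetric] by (rule ip_nonneg)
qed (rule ip_nonneg)

lemma ip_parallelogram:
  assumes "v \<in> L2 M S" "w \<in> L2 M R"
  shows "sqn M (\<lambda>x. v x + w x) + sqn M (\<lambda>x. v x - w x) = 2 * ip M v v + 2 * ip M w w"
  using ip_add_scale_self[OF assms, of 1] ip_add_scale_self[OF assms, of "-1"] by simp

section \<open>Completeness and orthogonal projection\<close>

lemma nn_integral_eq_ip:
  assumes "v \<in> L2 M S"
  shows "(\<integral>\<^sup>+x. ennreal ((norm (v x))\<^sup>2) \<partial>M) = ennreal (ip M v v)"
  using nn_integral_eq_integral[OF L2_D(2)[OF assms]] by (simp add: ip_def power2_norm_eq_inner)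

lemma L2_nn_integralI:
  assumes "v \<in> borel_measurable M" "(\<integral>\<^sup>+x. ennreal ((norm (v x))\<^sup>2) \<partial>M) < \<infinity>" "AE x in M. v x \<in> S"
  shows "v \<in> L2 M S"
proof -
  have [measurable]: "v \<in> borel_measurable M" by fact
  have "integrable M (\<lambda>x. (norm (v x))\<^sup>2)"
    by (rule integrableI_bounded) (use assms in auto)
  then show ?thesis using assms by (simp add: L2_def)
qed

text \<open>Weighting the squared increments by \<open>2^k\<close> makes the increments summable almost everywhere
  without Minkowski's inequality.\<close>

lemma AE_convergent_of_fast_L2_Cauchy:
  fixes f :: "nat \<Rightarrow> 'a \<Rightarrow> 'b::euclidean_space"
  assumes f: "\<And>k. f k \<in> L2 M S" and S: "subspace S"
    and c: "\<And>k. sqn M (\<lambda>x. f (Suc k) x - f k x) \<le> (1/4)^k"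
  shows "AE x in M. convergent (\<lambda>k. f k x)"
proof -
  define g where "g = (\<lambda>k x. f (Suc k) x - f k x)"
  have gL: "g k \<in> L2 M S" for k unfolding g_def by (rule L2_diff[OF S f f])
  have fm[measurable]: "f k \<in> borel_measurable M" for k by (rule L2_D(1)[OF f])
  have gm[measurable]: "g k \<in> borel_measurable M" for k by (rule L2_D(1)[OF gL])
  have "(\<integral>\<^sup>+x. (\<Sum>k. ennreal (2^k * (norm (g k x))\<^sup>2)) \<partial>M) = (\<Sum>k. \<integral>\<^sup>+x. ennreal (2^k * (norm (g k x))\<^sup>2) \<partial>M)"
    by (rule nn_integral_suminf) measurable
  also have "\<dots> = (\<Sum>k. ennreal (2^k * ip M (g k) (g k)))"
    by (simp add: ennreal_mult nn_integral_cmult nn_integral_eq_ip[OF gL] ip_nonneg)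
  also have "\<dots> \<le> (\<Sum>k. ennreal ((1/2)^k))"
  proof (rule suminf_le)
    fix k
    have "2^k * ip M (g k) (g k) \<le> 2^k * (1/4)^k"
      using c[of k] by (simp add: g_def)
    also have "\<dots> = (1/2)^k" by (simp add: power_mult_distrib[symmetric])
    finally show "ennreal (2^k * ip M (g k) (g k)) \<le> ennreal ((1/2)^k)" by (rule ennreal_leI)
  qed auto
  also have "\<dots> < \<infinity>"
    by (subst suminf_ennreal2) (auto simp: summable_geometric)
  finally have "AE x in M. (\<Sum>k. ennreal (2^k * (norm (g k x))\<^sup>2)) \<noteq> \<infinity>"
    by (intro nn_integral_PInf_AE) auto
  then show ?thesis
  proof eventually_elim
    case (elim x)
    define a where "a = norm o (\<lambda>k. g k x)"
    have "summable (\<lambda>k. 2^k * (norm (g k x))\<^sup>2)"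
      using elim by (intro summable_suminf_not_top) (auto simp: top_ennreal.rep_eq)
    moreover have "summable (\<lambda>k. (1/2::real)^k)" by (simp add: summable_geometric)
    ultimately have "summable (\<lambda>k. 2^k * (norm (g k x))\<^sup>2 + (1/2)^k)" by (rule summable_add)
    then have "summable (\<lambda>k. norm (g k x))"
    proof (rule summable_comparison_test'[where N=0])
      fix k
      \<comment> \<open>Completing the square shows that twice the norm is at most
        \<open>2^k * norm^2 + (1/2)^k\<close>, which trades the weighted squares for the norm
        itself.\<close>
      have "norm (g k x) = (2^k * (norm (g k x))\<^sup>2 + (1/2)^k) - (2^k * (norm (g k x) - (1/2)^k)\<^sup>2 + norm (g k x))"
      proof -
        have h: "(2::real)^k * (1/2)^k = 1" by (simp add: power_mult_distrib[symmetric])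
        have "(2::real)^k * (norm (g k x) - (1/2)^k)\<^sup>2
            = 2^k * (norm (g k x))\<^sup>2 - 2 * (2^k * (1/2)^k) * norm (g k x) + (2^k*(1/2)^k) * (1/2)^k"
          by (simp only: power2_eq_square) (simp add: algebra_simps)
        then show ?thesis unfolding h by simp
      qed
      then show "norm (norm (g k x)) \<le> 2^k * (norm (g k x))\<^sup>2 + (1/2)^k"
        using mult_nonneg_nonneg[OF zero_le_power[of "2::real" k] zero_le_power2[of "norm (g k x) - (1/2)^k"]]
          norm_ge_zero[of "g k x"] unfolding real_norm_def abs_norm_cancel by linarith
    qed
    then have "summable (\<lambda>k. g k x)" by (rule summable_norm_cancel)
    then have "convergent (\<lambda>n. \<Sum>k<n. g k x)"
      by (simp add: summable_iff_convergent)
    moreover have "(\<Sum>k<n. g k x) = f n x - f 0 x" for n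
      by (induct n) (auto simp: g_def)
    ultimately have "convergent (\<lambda>n. f n x - f 0 x)" by simp
    from convergent_add[OF this convergent_const[of "f 0 x"]] show ?case by simp
  qed
qed

text \<open>A rapidly Cauchy subsequence converges almost everywhere. Fatou's lemma along that
  subsequence bounds the distance from every late \<open>f n\<close> to the limit, so the whole
  sequence converges in norm.\<close>

lemma L2_complete:
  fixes f :: "nat \<Rightarrow> 'a \<Rightarrow> 'b::euclidean_space"
  assumes f: "\<And>k. f k \<in> L2 M S" and S: "subspace S"
    and c: "\<And>e. e > 0 \<Longrightarrow> \<exists>N. \<forall>m\<ge>N. \<forall>n\<ge>N. sqn M (\<lambda>x. f m x - f n x) \<le> e"
  shows "\<exists>z\<in>L2 M S. (\<lambda>n. sqn M (\<lambda>x. f n x - z x)) \<longlonglongrightarrow> 0"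
proof -
  have "\<forall>k. \<exists>N. \<forall>m\<ge>N. \<forall>n\<ge>N. sqn M (\<lambda>x. f m x - f n x) \<le> (1/4)^k"
    using c by simp
  then obtain N where N: "\<And>k m n. m \<ge> N k \<Longrightarrow> n \<ge> N k \<Longrightarrow> sqn M (\<lambda>x. f m x - f n x) \<le> (1/4)^k"
    by metis
  \<comment> \<open>The partial sums dominate each \<open>N k\<close> and are monotone; the extra
    \<open>k\<close> makes the indices tend to infinity.\<close>
  define s where "s k = (\<Sum>i\<le>k. N i) + k" for k
  have s1: "s k \<ge> N k" for k unfolding s_def by (simp add: sum.remove[of "{..k}" k] trans_le_add1)
  have s2: "s k \<le> s (Suc k)" for k unfolding s_def by simp
  have s3: "s k \<ge> k" for k unfolding s_def by simp
  have "AE x in M. convergent (\<lambda>k. f (s k) x)"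
    by (rule AE_convergent_of_fast_L2_Cauchy[OF f S]) (use N s1 s2 le_trans in blast)
  moreover have "AE x in M. \<forall>k. f (s k) x \<in> S" using L2_D(3)[OF f] by (simp add: AE_all_countable)
  moreover define z where "z x = lim (\<lambda>k. f (s k) x)" for x
  ultimately have zl: "AE x in M. (\<lambda>k. f (s k) x) \<longlonglongrightarrow> z x \<and> (\<forall>k. f (s k) x \<in> S)"
    by (auto simp: convergent_LIMSEQ_iff)
  have fm[measurable]: "f k \<in> borel_measurable M" for k by (rule L2_D(1)[OF f])
  have zm[measurable]: "z \<in> borel_measurable M" unfolding z_def by measurable
  have zS: "AE x in M. z x \<in> S"
    using zl by eventually_elim (metis closed_sequentially closed_subspace[OF S])
  \<comment> \<open>Fatou's lemma in the second index. It is stated for nonnegative integrals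
    because \<open>z\<close> is not yet known to be square integrable.\<close>
  have est: "(\<integral>\<^sup>+x. ennreal ((norm (f n x - z x))\<^sup>2) \<partial>M) \<le> ennreal e"
    if e: "e > 0" and M: "\<forall>m\<ge>K. \<forall>n\<ge>K. sqn M (\<lambda>x. f m x - f n x) \<le> e" and n: "n \<ge> K" for e K n
  proof -
    have "(\<integral>\<^sup>+x. ennreal ((norm (f n x - z x))\<^sup>2) \<partial>M) = (\<integral>\<^sup>+x. liminf (\<lambda>k. ennreal ((norm (f n x - f (s k) x))\<^sup>2)) \<partial>M)"
    proof (rule nn_integral_cong_AE, use zl in eventually_elim)
      case (elim x)
      then have "(\<lambda>k. ennreal ((norm (f n x - f (s k) x))\<^sup>2)) \<longlonglongrightarrow> ennreal ((norm (f n x - z x))\<^sup>2)"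
        by (intro tendsto_intros) auto
      then show ?case using lim_imp_Liminf[of sequentially] by (metis trivial_limit_sequentially)
    qed
    also have "\<dots> \<le> liminf (\<lambda>k. \<integral>\<^sup>+x. ennreal ((norm (f n x - f (s k) x))\<^sup>2) \<partial>M)"
      by (rule nn_integral_liminf) measurable
    also have "\<dots> = liminf (\<lambda>k. ennreal (sqn M (\<lambda>x. f n x - f (s k) x)))"
      by (subst nn_integral_eq_ip[OF L2_diff[OF S f f]]) simp
    also have "\<dots> \<le> ennreal e"
    proof (rule Liminf_le)
      show "\<forall>\<^sub>F k in sequentially. ennreal (sqn M (\<lambda>x. f n x - f (s k) x)) \<le> ennreal e"
        unfolding eventually_sequentially
        using M n s3 by (intro exI[of _ K]) (meson ennreal_leI le_trans)
    qed simp
    finally show ?thesis .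
  qed
  have dL: "(\<lambda>x. f n x - z x) \<in> L2 M S" if M: "\<forall>m\<ge>K. \<forall>n\<ge>K. sqn M (\<lambda>x. f m x - f n x) \<le> 1" and n: "n \<ge> K" for K n
  proof (rule L2_nn_integralI)
    show "(\<integral>\<^sup>+x. ennreal ((norm (f n x - z x))\<^sup>2) \<partial>M) < \<infinity>"
      using est[OF _ M n] by (simp add: le_less_trans[OF _ ennreal_one_less_top])
    show "AE x in M. f n x - z x \<in> S" using zS L2_D(3)[OF f[of n]] by eventually_elim (rule subspace_diff[OF S])
  qed measurable
  obtain K where K: "\<forall>m\<ge>K. \<forall>n\<ge>K. sqn M (\<lambda>x. f m x - f n x) \<le> 1"
    using c[of 1] by auto
  have zL: "z \<in> L2 M S" using L2_diff[OF S f[of K] dL[OF K order_refl]] by simp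
  have "(\<lambda>n. sqn M (\<lambda>x. f n x - z x)) \<longlonglongrightarrow> 0"
  proof (rule LIMSEQ_I)
    fix r :: real assume "r > 0"
    then have "r / 2 > 0" by simp
    from c[OF this] obtain K where K: "\<forall>m\<ge>K. \<forall>n\<ge>K. sqn M (\<lambda>x. f m x - f n x) \<le> r / 2" by auto
    have "sqn M (\<lambda>x. f n x - z x) \<le> r / 2" if "n \<ge> K" for n
      using est[OF \<open>r / 2 > 0\<close> K that] \<open>r > 0\<close> nn_integral_eq_ip[OF L2_diff[OF S f[of n] zL]] by simp
    then show "\<exists>no. \<forall>n\<ge>no. norm (sqn M (\<lambda>x. f n x - z x) - 0) < r"
      using \<open>r > 0\<close> by (intro exI[of _ K]) (fastforce simp: abs_of_nonneg ip_nonneg)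
  qed
  then show ?thesis using zL by blast
qed

text \<open>A minimizing sequence is Cauchy by the parallelogram law. Since \<open>G\<close> is not
  assumed closed, the minimizer may lie outside \<open>G\<close>, and the approximating sequence is
  part of the conclusion.\<close>

lemma L2_projection:
  fixes G :: "('a \<Rightarrow> 'b::euclidean_space) set"
  assumes S: "subspace S" and GL: "G \<subseteq> L2 M S" and G0: "(\<lambda>x. 0) \<in> G"
    and Gadd: "\<And>\<phi> \<psi>. \<phi> \<in> G \<Longrightarrow> \<psi> \<in> G \<Longrightarrow> (\<lambda>x. \<phi> x + \<psi> x) \<in> G"
    and Gscale: "\<And>c \<phi>. \<phi> \<in> G \<Longrightarrow> (\<lambda>x. c *\<^sub>R \<phi> x) \<in> G"
    and g: "g \<in> L2 M S"
  shows "\<exists>z\<in>L2 M S. (\<forall>\<psi>\<in>G. ip M (\<lambda>x. g x - z x) \<psi> = 0) \<and>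
    (\<exists>\<phi>. range \<phi> \<subseteq> G \<and> (\<lambda>n::nat. sqn M (\<lambda>x. \<phi> n x - z x)) \<longlonglongrightarrow> 0)"
proof -
  define Q where "Q \<psi> = sqn M (\<lambda>x. g x - \<psi> x)" for \<psi>
  define d where "d = (INF \<psi>\<in>G. Q \<psi>)"
  have bdd: "bdd_below (Q ` G)" unfolding Q_def by (rule bdd_belowI2[of _ 0]) (rule ip_nonneg)
  have dle: "d \<le> Q \<psi>" if "\<psi> \<in> G" for \<psi> unfolding d_def by (rule cINF_lower[OF bdd that])
  have "\<exists>\<psi>\<in>G. Q \<psi> < d + 1 / (Suc n)" for n :: nat
    using cINF_less_iff[OF _ bdd, of "d + 1/(Suc n)"] G0 unfolding d_def by auto
  then obtain \<phi> where \<phi>G: "\<And>n. \<phi> n \<in> G" and \<phi>Q: "\<And>n::nat. Q (\<phi> n) < d + 1 / (Suc n)" by metis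
  have \<phi>L: "\<phi> n \<in> L2 M S" for n using \<phi>G GL by auto
  have par: "sqn M (\<lambda>x. \<phi> m x - \<phi> n x) \<le> 2 / (Suc m) + 2 / (Suc n)" for m n
  proof -
    have h: "(\<lambda>x. (1/2) *\<^sub>R (\<phi> m x + \<phi> n x)) \<in> G" by (intro Gscale Gadd \<phi>G)
    \<comment> \<open>The midpoint of two near-minimizers is in \<open>G\<close>, so its distance is
      at least \<open>d\<close>; the parallelogram law then leaves little room for their
      difference.\<close>
    have "sqn M (\<lambda>x. (g x - \<phi> n x) + (g x - \<phi> m x))
       = 4 * Q (\<lambda>x. (1/2) *\<^sub>R (\<phi> m x + \<phi> n x))"
    proof -
      have "(\<lambda>x. (g x - \<phi> n x) + (g x - \<phi> m x)) = (\<lambda>x. 2 *\<^sub>R (g x - (1/2) *\<^sub>R (\<phi> m x + \<phi> n x)))"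
        by (auto simp: algebra_simps scaleR_2)
      then show ?thesis by (simp only: ip_scale_left ip_scale_right Q_def)
    qed
    moreover have "(\<lambda>x. (g x - \<phi> n x) - (g x - \<phi> m x)) = (\<lambda>x. \<phi> m x - \<phi> n x)" by auto
    ultimately have "4 * Q (\<lambda>x. (1/2) *\<^sub>R (\<phi> m x + \<phi> n x)) + sqn M (\<lambda>x. \<phi> m x - \<phi> n x)
        = 2 * Q (\<phi> n) + 2 * Q (\<phi> m)"
      using ip_parallelogram[OF L2_diff[OF S g \<phi>L[of n]] L2_diff[OF S g \<phi>L[of m]]]
      by (simp add: Q_def)
    then show ?thesis using dle[OF h] \<phi>Q[of m] \<phi>Q[of n] by (simp add: add_divide_distrib)
  qed
  have "\<exists>z\<in>L2 M S. (\<lambda>n. sqn M (\<lambda>x. \<phi> n x - z x)) \<longlonglongrightarrow> 0"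
  proof (rule L2_complete[OF \<phi>L S])
    fix e :: real assume "e > 0"
    then obtain K :: nat where K: "K > 0" "1 / K < e / 4"
      by (metis divide_pos_pos ex_inverse_of_nat_less inverse_eq_divide zero_less_numeral)
    have "sqn M (\<lambda>x. \<phi> m x - \<phi> n x) \<le> e" if "m \<ge> K" "n \<ge> K" for m n
    proof -
      have "1 / (Suc m) \<le> 1 / K" "1 / (Suc n) \<le> 1 / K" using that K by (auto simp: frac_le)
      then show ?thesis using par[of m n] K by simp
    qed
    then show "\<exists>N. \<forall>m\<ge>N. \<forall>n\<ge>N. sqn M (\<lambda>x. \<phi> m x - \<phi> n x) \<le> e" by blast
  qed
  then obtain z where z: "z \<in> L2 M S" and lim: "(\<lambda>n. sqn M (\<lambda>x. \<phi> n x - z x)) \<longlonglongrightarrow> 0"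
    by blast
  have "ip M (\<lambda>x. g x - z x) \<psi> = 0" if \<psi>: "\<psi> \<in> G" for \<psi>
  proof -
    have \<psi>L: "\<psi> \<in> L2 M S" using \<psi> GL by auto
    have a: "(ip M (\<lambda>x. g x - \<phi> n x) \<psi>)\<^sup>2 \<le> 1 / (Suc n) * ip M \<psi> \<psi>" for n
    proof (rule discriminant_le)
      fix t
      \<comment> \<open>Moving \<open>\<phi> n\<close> along \<open>\<psi>\<close> gains at most
        \<open>1 / Suc n\<close> over its own distance, for every step size \<open>t\<close>; this
        is the quadratic inequality with \<open>a = 1 / Suc n\<close>.\<close>
      have "d \<le> Q (\<lambda>x. \<phi> n x + (-t) *\<^sub>R \<psi> x)" by (intro dle Gadd Gscale \<phi>G \<psi>)
      also have "\<dots> = Q (\<phi> n) + 2 * t * ip M (\<lambda>x. g x - \<phi> n x) \<psi> + t\<^sup>2 * ip M \<psi> \<psi>"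
        unfolding Q_def ip_add_scale_self[OF L2_diff[OF S g \<phi>L] \<psi>L, symmetric] by (simp add: algebra_simps)
      finally show "0 \<le> 1 / real (Suc n) + 2 * t * ip M (\<lambda>x. g x - \<phi> n x) \<psi> + t\<^sup>2 * ip M \<psi> \<psi>"
        using \<phi>Q[of n] by simp
    qed (rule ip_nonneg)
    have b: "ip M (\<lambda>x. g x - z x) \<psi> = ip M (\<lambda>x. g x - \<phi> n x) \<psi> + ip M (\<lambda>x. \<phi> n x - z x) \<psi>" for n
      using ip_add_left[OF L2_diff[OF S g \<phi>L[of n]] L2_diff[OF S \<phi>L[of n] z] \<psi>L] by simp
    have c: "(ip M (\<lambda>x. g x - z x) \<psi>)\<^sup>2 \<le> 2 * (1 / (Suc n) * ip M \<psi> \<psi>) + 2 * (sqn M (\<lambda>x. \<phi> n x - z x) * ip M \<psi> \<psi>)" for n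
    proof -
      have "(ip M (\<lambda>x. g x - z x) \<psi>)\<^sup>2 \<le> 2 * (ip M (\<lambda>x. g x - \<phi> n x) \<psi>)\<^sup>2 + 2 * (ip M (\<lambda>x. \<phi> n x - z x) \<psi>)\<^sup>2"
        unfolding b[of n] using sum_squares_bound[of "ip M (\<lambda>x. g x - \<phi> n x) \<psi>" "ip M (\<lambda>x. \<phi> n x - z x) \<psi>"]
        by (simp add: power2_sum)
      then show ?thesis using a[of n] ip_Cauchy_Schwarz[OF L2_diff[OF S \<phi>L[of n] z] \<psi>L] by linarith
    qed
    have "(\<lambda>n. 2 * (1 / (Suc n) * ip M \<psi> \<psi>) + 2 * (sqn M (\<lambda>x. \<phi> n x - z x) * ip M \<psi> \<psi>)) \<longlonglongrightarrow> 2 * (0 * ip M \<psi> \<psi>) + 2 * (0 * ip M \<psi> \<psi>)"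
      by (intro tendsto_intros lim LIMSEQ_Suc[OF lim_1_over_n])
    then have "(ip M (\<lambda>x. g x - z x) \<psi>)\<^sup>2 \<le> 2 * (0 * ip M \<psi> \<psi>) + 2 * (0 * ip M \<psi> \<psi>)"
      by (rule LIMSEQ_le_const) (use c in blast)
    then show ?thesis by simp
  qed
  moreover have "range \<phi> \<subseteq> G" using \<phi>G by auto
  ultimately show ?thesis using z lim by blast
qed

text \<open>The residual of the projection is an admissible test for \<open>orth\<close>, which
  forces it to vanish; then \<open>g\<close> equals its projection almost everywhere and inherits
  the approximating sequence.\<close>

lemma double_orthogonal_closure:
  fixes G :: "('a \<Rightarrow> 'b::euclidean_space) set"
  assumes S: "subspace S" and GL: "G \<subseteq> L2 M S" and G0: "(\<lambda>x. 0) \<in> G"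
    and Gadd: "\<And>\<phi> \<psi>. \<phi> \<in> G \<Longrightarrow> \<psi> \<in> G \<Longrightarrow> (\<lambda>x. \<phi> x + \<psi> x) \<in> G"
    and Gscale: "\<And>c \<phi>. \<phi> \<in> G \<Longrightarrow> (\<lambda>x. c *\<^sub>R \<phi> x) \<in> G"
    and g: "g \<in> L2 M S"
    and orth: "\<And>r. r \<in> L2 M S \<Longrightarrow> (\<And>\<psi>. \<psi> \<in> G \<Longrightarrow> ip M r \<psi> = 0) \<Longrightarrow> ip M r g = 0"
    and e: "e > 0"
  shows "\<exists>\<phi>\<in>G. sqn M (\<lambda>x. g x - \<phi> x) < e"
proof -
  obtain z \<phi> where z: "z \<in> L2 M S" and \<phi>r: "range \<phi> \<subseteq> G"
    and lim: "(\<lambda>n::nat. sqn M (\<lambda>x. \<phi> n x - z x)) \<longlonglongrightarrow> 0"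
    and o: "\<forall>\<psi>\<in>G. ip M (\<lambda>x. g x - z x) \<psi> = 0"
    using L2_projection[OF S GL G0 Gadd Gscale g] by blast
  have \<phi>G: "\<phi> n \<in> G" for n using \<phi>r by auto
  define r where "r = (\<lambda>x. g x - z x)"
  have rL: "r \<in> L2 M S" unfolding r_def by (rule L2_diff[OF S g z])
  have \<phi>L: "\<phi> n \<in> L2 M S" for n using \<phi>G GL by auto
  have rg: "ip M r g = 0" by (rule orth[OF rL]) (simp add: r_def o)
  \<comment> \<open>\<open>r\<close> is orthogonal to \<open>g\<close> and to \<open>\<phi> n\<close>, hence \<open>\<parallel>r\<parallel>\<^sup>2 = (r, \<phi> n - z)\<close>, which tends to \<open>0\<close>.\<close>
  have "ip M r r = ip M r (\<lambda>x. \<phi> n x - z x)" for n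
  proof -
    have "ip M r (\<phi> n) = 0" using o \<phi>G by (simp add: r_def)
    moreover have "ip M r r = ip M r g - ip M r z" using ip_diff_right[OF g z rL] by (simp add: r_def)
    moreover have "ip M r (\<lambda>x. \<phi> n x - z x) = ip M r (\<phi> n) - ip M r z" by (rule ip_diff_right[OF \<phi>L z rL])
    ultimately show ?thesis using rg by simp
  qed
  then have "(ip M r r)\<^sup>2 \<le> ip M r r * sqn M (\<lambda>x. \<phi> n x - z x)" for n
    using ip_Cauchy_Schwarz[OF rL L2_diff[OF S \<phi>L z]] by metis
  then have "(ip M r r)\<^sup>2 \<le> ip M r r * 0"
    by (intro LIMSEQ_le_const[OF tendsto_mult_left[OF lim]]) blast
  then have r0: "ip M r r = 0" by simp
  obtain n where n: "sqn M (\<lambda>x. \<phi> n x - z x) < e"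
    using order_tendstoD(2)[OF lim e] by (auto dest: eventually_happens)
  have zr: "AE x in M. r x = 0" by (rule ip_self_eq_0[OF rL r0])
  have "sqn M (\<lambda>x. g x - \<phi> n x) = sqn M (\<lambda>x. z x - \<phi> n x)"
    by (rule ip_cong_AE[OF _ _ L2_diff[OF S g \<phi>L] L2_diff[OF S z \<phi>L] L2_diff[OF S g \<phi>L] L2_diff[OF S z \<phi>L]])
      (use zr in \<open>auto simp: r_def\<close>)
  also have "\<dots> = sqn M (\<lambda>x. \<phi> n x - z x)"
    unfolding ip_def by (rule Bochner_Integration.integral_cong) (auto simp: inner_diff inner_commute)
  finally show ?thesis using n \<phi>G by (intro bexI[of _ "\<phi> n"]) auto
qed

section \<open>Smooth compactly supported functions\<close>

lemma C_k_Suc_D: "C_k (Suc m) \<phi> \<Longrightarrow> C_k m \<phi>"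
proof (induction m arbitrary: \<phi>)
  case 0
  then show ?case
    by (simp add: continuous_on_eq_continuous_within differentiable_imp_continuous_within)
next
  case (Suc m)
  from Suc.prems have "\<forall>i. C_k (Suc m) (partial_deriv i \<phi>)" by simp
  with Suc.IH have "\<forall>i. C_k m (partial_deriv i \<phi>)" by blast
  with Suc.prems show ?case by simp
qed

lemma partial_deriv_eq: "(\<phi> has_derivative D) (at x) \<Longrightarrow> partial_deriv i \<phi> x = D (axis i 1)"
  unfolding partial_deriv_def by (metis frechet_derivative_at)

lemma C_k_const: "C_k m (\<lambda>x. c)"
proof (induction m arbitrary: c)
  case (Suc m)
  have "partial_deriv i (\<lambda>x. c) = (\<lambda>x. 0)" for i :: 'a
    by (rule ext, subst partial_deriv_eq[OF has_derivative_const]) simp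
  with Suc show ?case by simp
qed simp

lemma partial_deriv_linear:
  assumes "bounded_linear L" "\<phi> differentiable (at x)"
  shows "partial_deriv i (\<lambda>x. L (\<phi> x)) x = L (partial_deriv i \<phi> x)"
proof -
  obtain D where D: "(\<phi> has_derivative D) (at x)" using assms(2) by (auto simp: differentiable_def)
  show ?thesis
    using partial_deriv_eq[OF bounded_linear.has_derivative[OF assms(1) D]] partial_deriv_eq[OF D] by simp
qed

lemma C_k_linear:
  assumes "bounded_linear L"
  shows "C_k m \<phi> \<Longrightarrow> C_k m (\<lambda>x. L (\<phi> x))"
proof (induction m arbitrary: \<phi>)
  case 0
  then show ?case using continuous_on_compose2[OF linear_continuous_on[OF assms, of UNIV]] by auto
next
  case (Suc m)
  have "partial_deriv i (\<lambda>x. L (\<phi> x)) = (\<lambda>x. L (partial_deriv i \<phi> x))" for i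
    using Suc.prems by (intro ext partial_deriv_linear[OF assms]) simp
  moreover have "(\<lambda>x. L (\<phi> x)) differentiable (at x)" for x
    using Suc.prems bounded_linear.has_derivative[OF assms] by (simp add: differentiable_def) blast
  ultimately show ?case using Suc by simp
qed

lemma partial_deriv_bilinear:
  assumes "bounded_bilinear B" "f differentiable (at x)" "g differentiable (at x)"
  shows "partial_deriv i (\<lambda>x. B (f x) (g x)) x = B (f x) (partial_deriv i g x) + B (partial_deriv i f x) (g x)"
proof -
  obtain D E where D: "(f has_derivative D) (at x)" "(g has_derivative E) (at x)"
    using assms(2,3) by (auto simp: differentiable_def)
  show ?thesis
    using partial_deriv_eq[OF bounded_bilinear.FDERIV[OF assms(1) D]] partial_deriv_eq[OF D(1)] partial_deriv_eq[OF D(2)]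
    by simp
qed

lemma partial_deriv_add:
  assumes "f differentiable (at x)" "g differentiable (at x)"
  shows "partial_deriv i (\<lambda>x. f x + g x) x = partial_deriv i f x + partial_deriv i g x"
proof -
  obtain D E where D: "(f has_derivative D) (at x)" "(g has_derivative E) (at x)"
    using assms by (auto simp: differentiable_def)
  show ?thesis
    using partial_deriv_eq[OF has_derivative_add[OF D]] partial_deriv_eq[OF D(1)] partial_deriv_eq[OF D(2)]
    by simp
qed

lemma C_k_add: "C_k m f \<Longrightarrow> C_k m g \<Longrightarrow> C_k m (\<lambda>x. f x + g x)"
proof (induction m arbitrary: f g)
  case 0
  then show ?case by (simp add: continuous_on_add)
next
  case (Suc m)
  have "partial_deriv i (\<lambda>x. f x + g x) = (\<lambda>x. partial_deriv i f x + partial_deriv i g x)" for i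
    using Suc.prems by (intro ext partial_deriv_add) simp_all
  then show ?case using Suc by simp
qed

lemma C_k_bilinear:
  assumes "bounded_bilinear B"
  shows "C_k m f \<Longrightarrow> C_k m g \<Longrightarrow> C_k m (\<lambda>x. B (f x) (g x))"
proof (induction m arbitrary: f g)
  case 0
  then show ?case by (simp add: bounded_bilinear.continuous_on[OF assms])
next
  case (Suc m)
  have "partial_deriv i (\<lambda>x. B (f x) (g x)) = (\<lambda>x. B (f x) (partial_deriv i g x) + B (partial_deriv i f x) (g x))" for i
    using Suc.prems by (intro ext partial_deriv_bilinear[OF assms]) simp_all
  moreover have "(\<lambda>x. B (f x) (g x)) differentiable (at x)" for x
  proof -
    obtain D E where D: "(f has_derivative D) (at x)" "(g has_derivative E) (at x)"
      using Suc.prems unfolding C_k.simps differentiable_def by blast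
    show ?thesis using bounded_bilinear.FDERIV[OF assms D] unfolding differentiable_def by blast
  qed
  ultimately show ?case using Suc C_k_Suc_D[OF Suc.prems(1)] C_k_Suc_D[OF Suc.prems(2)]
    by (auto intro!: C_k_add)
qed

lemma C_k_prod:
  fixes f :: "'i \<Rightarrow> real ^ 'n::finite \<Rightarrow> real"
  shows "(\<And>i. i \<in> A \<Longrightarrow> C_k m (f i)) \<Longrightarrow> C_k m (\<lambda>x. \<Prod>i\<in>A. f i x)"
  by (induction A rule: infinite_finite_induct)
    (simp_all add: C_k_bilinear[OF bounded_bilinear_mult] C_k_const)

text \<open>All derivatives are supplied at once as the family \<open>h\<close>: a partial
  derivative of the composition is a constant multiple of the composition with the next member, so
  induction on the order generalizes over \<open>n\<close>.\<close>

lemma C_k_compose_real: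
  fixes h :: "nat \<Rightarrow> real \<Rightarrow> real" and L :: "real ^ 'n::finite \<Rightarrow> real"
  assumes h: "\<And>n t. (h n has_real_derivative h (Suc n) t) (at t)" and L: "bounded_linear L"
  shows "C_k m (\<lambda>x. h n (L x + c))"
proof (induction m arbitrary: n)
  case 0
  have "continuous_on UNIV (h n)" by (rule DERIV_continuous_on[OF h])
  then show ?case
    using continuous_on_compose2[of UNIV "h n" UNIV "\<lambda>x. L x + c"] linear_continuous_on[OF L, of UNIV]
    by (simp add: continuous_on_add)
next
  case (Suc m)
  have D: "((\<lambda>x. h n (L x + c)) has_derivative (\<lambda>v. L v * h (Suc n) (L x + c))) (at x)" for x
  proof -
    have "((\<lambda>x. L x + c) has_derivative L) (at x)"
      using has_derivative_add_const bounded_linear_imp_has_derivative[OF L] by blast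
    from has_derivative_compose[OF this h[unfolded has_field_derivative_def, of n "L x + c"]]
    show ?thesis by (simp add: mult.commute)
  qed
  have "partial_deriv i (\<lambda>x. h n (L x + c)) = (\<lambda>x. L (axis i 1) * h (Suc n) (L x + c))" for i
    by (rule ext) (rule partial_deriv_eq[OF D])
  moreover have "C_k m (\<lambda>x. L (axis i 1) * h (Suc n) (L x + c))" for i
    by (rule C_k_linear[OF bounded_linear_mult_right Suc.IH])
  ultimately show ?case using D by (auto simp: differentiable_def)
qed

section \<open>Flat functions and bumps on boxes\<close>

fun flat_poly :: "nat \<Rightarrow> real poly" where
  "flat_poly 0 = 1"
| "flat_poly (Suc n) = [:0, 0, 1:] * (flat_poly n - pderiv (flat_poly n))"

text \<open>The \<open>n\<close>-th derivative of the flat function \<open>exp (-1/t)\<close>, extended by zero to \<open>t \<le> 0\<close>.\<close>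

definition flat :: "nat \<Rightarrow> real \<Rightarrow> real" where
  "flat n t = (if 0 < t then poly (flat_poly n) (inverse t) * exp (- inverse t) else 0)"

lemma poly_exp_minus_tendsto_0: "((\<lambda>t::real. poly p t * exp (- t)) \<longlongrightarrow> 0) at_top"
proof -
  have "((\<lambda>t::real. \<Sum>i\<le>degree p. coeff p i * (t ^ i / exp t)) \<longlongrightarrow> (\<Sum>i\<le>degree p. coeff p i * 0)) at_top"
    by (intro tendsto_intros tendsto_power_div_exp_0)
  then show ?thesis
    by (simp add: poly_altdef sum_distrib_right exp_minus divide_inverse mult.assoc)
qed

lemma flat_has_derivative: "(flat n has_real_derivative flat (Suc n) t) (at t)"
proof -
  consider "t < 0" | "t = 0" | "t > 0" by linarith
  then show ?thesis
  proof cases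
    case 1
    have "((\<lambda>s. 0) has_real_derivative flat (Suc n) t) (at t)" using 1 by (simp add: flat_def)
    then show ?thesis
      by (rule has_field_derivative_transform_within_open[where S="{..<0}"]) (use 1 in \<open>auto simp: flat_def\<close>)
  next
    case 3
    have i: "(inverse has_real_derivative - (inverse t)\<^sup>2) (at t)"
      using DERIV_inverse[of t UNIV] 3 by (simp add: power2_eq_square)
    have p: "((\<lambda>s. poly (flat_poly n) (inverse s)) has_real_derivative
        poly (pderiv (flat_poly n)) (inverse t) * - (inverse t)\<^sup>2) (at t)"
      by (rule DERIV_chain2[OF poly_DERIV i])
    have e: "((\<lambda>s. exp (- inverse s)) has_real_derivative exp (- inverse t) * (inverse t)\<^sup>2) (at t)"
      using DERIV_chain2[OF DERIV_exp DERIV_minus[OF i]] by simp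
    \<comment> \<open>Differentiating p(1/t) exp(-1/t) gives (p - p')(1/t) exp(-1/t) / t^2, which is
      the origin of the recurrence for \<open>flat_poly\<close>.\<close>
    have "((\<lambda>s. poly (flat_poly n) (inverse s) * exp (- inverse s)) has_real_derivative flat (Suc n) t) (at t)"
      using DERIV_mult[OF p e] 3 by (simp add: flat_def algebra_simps power2_eq_square)
    then show ?thesis
      by (rule has_field_derivative_transform_within_open[where S="{0<..}"]) (use 3 in \<open>auto simp: flat_def\<close>)
  next
    case 2
    \<comment> \<open>Dividing by \<open>s\<close> multiplies the polynomial in
      \<open>inverse s\<close> by its variable, so the difference quotient at 0 is again a
      polynomial against a decaying exponential.\<close>
    have "((\<lambda>s. poly ([:0, 1:] * flat_poly n) (inverse s) * exp (- inverse s)) \<longlongrightarrow> 0) (at_right 0)"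
      by (rule filterlim_compose[OF poly_exp_minus_tendsto_0 filterlim_inverse_at_top_right])
    then have "((\<lambda>s. flat n s / s) \<longlongrightarrow> 0) (at_right 0)"
      by (rule Lim_transform_eventually) (auto simp: eventually_at_filter flat_def divide_inverse)
    moreover have "((\<lambda>s. flat n s / s) \<longlongrightarrow> 0) (at_left 0)"
      by (rule Lim_transform_eventually[OF tendsto_const]) (auto simp: eventually_at_filter flat_def)
    ultimately have "((\<lambda>s. flat n s / s) \<longlongrightarrow> 0) (at 0)" by (simp add: filterlim_split_at)
    then show ?thesis using 2 by (simp add: has_field_derivative_iff flat_def)
  qed
qed

definition box_bump :: "real ^ 'n::finite \<Rightarrow> real ^ 'n \<Rightarrow> real ^ 'n \<Rightarrow> real" where
  "box_bump a b x = (\<Prod>i\<in>UNIV. flat 0 (x $ i - a $ i) * flat 0 (b $ i - x $ i))"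

lemma flat_0_bounds: "0 \<le> flat 0 t" "flat 0 t \<le> 1" "0 < flat 0 t \<longleftrightarrow> 0 < t"
  by (auto simp: flat_def)

lemma box_bump_C_k: "C_k m (box_bump a b)"
proof -
  have 1: "C_k m (\<lambda>x. flat 0 (x $ i - a $ i))" for i
    using C_k_compose_real[of flat "\<lambda>x. x $ i" m 0 "- a $ i"] flat_has_derivative bounded_linear_vec_nth[of i] by simp
  have 2: "C_k m (\<lambda>x. flat 0 (b $ i - x $ i))" for i
    using C_k_compose_real[of flat "\<lambda>x. - x $ i" m 0 "b $ i"] flat_has_derivative
      bounded_linear_minus[OF bounded_linear_vec_nth[of i]] by simp
  show ?thesis unfolding box_bump_def[abs_def]
    by (intro C_k_prod C_k_bilinear[OF bounded_bilinear_mult] 1 2)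
qed

lemma box_bump_bounds: "0 \<le> box_bump a b x" "box_bump a b x \<le> 1"
  unfolding box_bump_def
  by (auto intro!: prod_nonneg prod_le_1 mult_nonneg_nonneg mult_le_one flat_0_bounds)

lemma box_bump_pos: "0 < box_bump a b x \<longleftrightarrow> x \<in> box a b"
proof -
  have "0 < box_bump a b x \<longleftrightarrow> box_bump a b x \<noteq> 0" using box_bump_bounds(1)[of a b x] by auto
  also have "\<dots> \<longleftrightarrow> (\<forall>i. flat 0 (x $ i - a $ i) \<noteq> 0 \<and> flat 0 (b $ i - x $ i) \<noteq> 0)"
    by (auto simp: box_bump_def)
  also have "\<dots> \<longleftrightarrow> (\<forall>i. 0 < flat 0 (x $ i - a $ i) \<and> 0 < flat 0 (b $ i - x $ i))"
    using flat_0_bounds(1) by (auto simp: order_less_le)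
  also have "\<dots> \<longleftrightarrow> x \<in> box a b" by (auto simp: flat_0_bounds mem_box_cart)
  finally show ?thesis .
qed

section \<open>Smooth functions with compact support in a region\<close>

definition smooth_compact :: "'n region \<Rightarrow> (real ^ 'n::finite \<Rightarrow> 'b::real_normed_vector) \<Rightarrow> bool" where
  "smooth_compact U \<phi> \<longleftrightarrow> (\<forall>m. C_k m \<phi>) \<and> compact (closure {x. \<phi> x \<noteq> 0}) \<and> closure {x. \<phi> x \<noteq> 0} \<subseteq> U"

lemma smooth_compact_C_k: "smooth_compact U \<phi> \<Longrightarrow> C_k m \<phi>"
  by (simp add: smooth_compact_def)

text \<open>The closure in the last hypothesis accommodates derivatives, which can be nonzero at a
  zero of \<open>\<phi>\<close> but never outside its closed support.\<close>

lemma smooth_compact_cong_support: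
  assumes "smooth_compact U \<phi>" "\<And>m. C_k m \<psi>" "{x. \<psi> x \<noteq> 0} \<subseteq> closure {x. \<phi> x \<noteq> 0}"
  shows "smooth_compact U \<psi>"
proof -
  have "closure {x. \<psi> x \<noteq> 0} \<subseteq> closure {x. \<phi> x \<noteq> 0}" using assms(3) closure_minimal by blast
  moreover from this have "compact (closure {x. \<psi> x \<noteq> 0})"
    using compact_Int_closed[OF _ closed_closure, of "closure {x. \<phi> x \<noteq> 0}" "{x. \<psi> x \<noteq> 0}"] assms(1)
    by (simp add: smooth_compact_def Int_absorb1)
  ultimately show ?thesis using assms by (auto simp: smooth_compact_def)
qed

lemma partial_deriv_support: "{x. partial_deriv i \<phi> x \<noteq> 0} \<subseteq> closure {x. \<phi> x \<noteq> 0}"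
proof
  fix x assume "x \<in> {x. partial_deriv i \<phi> x \<noteq> 0}"
  then have nz: "partial_deriv i \<phi> x \<noteq> 0" by simp
  show "x \<in> closure {x. \<phi> x \<noteq> 0}"
  proof (rule ccontr)
    assume "x \<notin> closure {x. \<phi> x \<noteq> 0}"
    moreover have "v \<in> closure {x. \<phi> x \<noteq> 0}" if "\<phi> v \<noteq> 0" for v
      by (rule subsetD[OF closure_subset]) (use that in simp)
    ultimately have "(\<phi> has_derivative (\<lambda>v. 0)) (at x)"
      using has_derivative_transform_within_open[OF has_derivative_const[of 0 "at x"], of "- closure {x. \<phi> x \<noteq> 0}" \<phi>]
      by fastforce
    then show False using partial_deriv_eq nz by force
  qed
qed

lemma smooth_compact_partial_deriv:
  assumes "smooth_compact U \<phi>"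
  shows "smooth_compact U (partial_deriv i \<phi>)"
proof (rule smooth_compact_cong_support[OF assms _ partial_deriv_support])
  show "C_k m (partial_deriv i \<phi>)" for m
    using smooth_compact_C_k[OF assms, of "Suc m"] by simp
qed

lemma smooth_compact_linear:
  assumes "smooth_compact U \<phi>" "bounded_linear L"
  shows "smooth_compact U (\<lambda>x. L (\<phi> x))"
proof (rule smooth_compact_cong_support[OF assms(1)])
  show "C_k m (\<lambda>x. L (\<phi> x))" for m
    using assms(1) C_k_linear[OF assms(2)] unfolding smooth_compact_def by blast
  show "{x. L (\<phi> x) \<noteq> 0} \<subseteq> closure {x. \<phi> x \<noteq> 0}"
    using closure_subset[of "{x. \<phi> x \<noteq> 0}"] linear_0[OF bounded_linear.linear[OF assms(2)]] by fastforce
qed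

lemma smooth_compact_zero: "smooth_compact U (\<lambda>x. 0)"
  by (simp add: smooth_compact_def C_k_const)

lemma smooth_compact_add:
  assumes "smooth_compact U \<phi>" "smooth_compact U \<psi>"
  shows "smooth_compact U (\<lambda>x. \<phi> x + \<psi> x)"
proof -
  have "closure {x. \<phi> x + \<psi> x \<noteq> 0} \<subseteq> closure {x. \<phi> x \<noteq> 0} \<union> closure {x. \<psi> x \<noteq> 0}" (is "?A \<subseteq> ?B")
    unfolding closure_Un[symmetric] by (rule closure_mono) auto
  moreover have "compact ?B" using assms by (simp add: smooth_compact_def compact_Un)
  ultimately have "compact ?A"
    using compact_Int_closed[OF _ closed_closure, of ?B "{x. \<phi> x + \<psi> x \<noteq> 0}"] by (simp add: Int_absorb1)
  then show ?thesis using assms \<open>?A \<subseteq> ?B\<close> by (auto simp: smooth_compact_def intro: C_k_add)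
qed

lemma smooth_compact_sum:
  "(\<And>i. i \<in> A \<Longrightarrow> smooth_compact U (f i)) \<Longrightarrow> smooth_compact U (\<lambda>x. \<Sum>i\<in>A. f i x)"
  by (induction A rule: infinite_finite_induct) (simp_all add: smooth_compact_add smooth_compact_zero)

lemma smooth_compact_mono: "smooth_compact U \<phi> \<Longrightarrow> U \<subseteq> V \<Longrightarrow> smooth_compact V \<phi>"
  by (auto simp: smooth_compact_def)

lemma smooth_compact_continuous: "smooth_compact U \<phi> \<Longrightarrow> continuous_on UNIV \<phi>"
  using smooth_compact_C_k[of U \<phi> 0] by simp

lemma smooth_compact_differentiable: "smooth_compact U \<phi> \<Longrightarrow> \<phi> differentiable (at x)"
  using smooth_compact_C_k[of U \<phi> "Suc 0"] by simp

lemma smooth_compact_bounds: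
  assumes "smooth_compact U \<phi>"
  obtains R B where "\<And>x. \<phi> x \<noteq> 0 \<Longrightarrow> norm x \<le> R" "\<And>x. norm (\<phi> x) \<le> B"
proof -
  define K where "K = closure {x. \<phi> x \<noteq> 0}"
  have K: "compact K" using assms by (simp add: smooth_compact_def K_def)
  then obtain R where R: "\<And>x. x \<in> K \<Longrightarrow> norm x \<le> R" using compact_imp_bounded[OF K] unfolding bounded_iff by auto
  have "compact (\<phi> ` K)"
    by (rule compact_continuous_image[OF continuous_on_subset[OF smooth_compact_continuous[OF assms]] K]) simp
  then obtain B where B: "\<And>x. x \<in> K \<Longrightarrow> norm (\<phi> x) \<le> B"
    using compact_imp_bounded[of "\<phi> ` K"] unfolding bounded_iff by auto
  have sub: "\<phi> x \<noteq> 0 \<Longrightarrow> x \<in> K" for x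
    using subsetD[OF closure_subset, of x "{x. \<phi> x \<noteq> 0}"] by (simp add: K_def)
  \<comment> \<open>When the support is empty, \<open>B\<close> may be negative.\<close>
  have "norm (\<phi> x) \<le> max B 0" for x using B[OF sub] by (cases "\<phi> x = 0") (auto simp: le_max_iff_disj)
  moreover have "norm x \<le> R" if "\<phi> x \<noteq> 0" for x using R sub that by simp
  ultimately show ?thesis using that by blast
qed

section \<open>Integrals of derivatives with compact support\<close>

lemma integrable_lborel_cball: "integrable lborel (\<lambda>x::real^'n::finite. C * indicator (cball 0 R) x :: real)"
  by (intro integrable_mult_right)
    (use emeasure_bounded_finite[OF bounded_cball, of "0::real^'n" R] in \<open>auto intro!: integrable_real_indicator\<close>)

lemma smooth_compact_measurable: "smooth_compact U \<phi> \<Longrightarrow> \<phi> \<in> borel_measurable borel"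
  by (rule borel_measurable_continuous_onI[OF smooth_compact_continuous])

lemma integrable_lborel_smooth_compact:
  fixes \<zeta> :: "real ^ 'n::finite \<Rightarrow> real"
  assumes "smooth_compact U \<zeta>"
  shows "integrable lborel \<zeta>"
proof -
  obtain R B where R: "\<And>x. \<zeta> x \<noteq> 0 \<Longrightarrow> norm x \<le> R" and B: "\<And>x. norm (\<zeta> x) \<le> B"
    using smooth_compact_bounds[OF assms] by blast
  show ?thesis
  proof (rule Bochner_Integration.integrable_bound[OF integrable_lborel_cball[of B R]])
    show "AE x in lborel. norm (\<zeta> x) \<le> norm (B * indicator (cball 0 R) x)"
    proof (rule AE_I2)
      fix x show "norm (\<zeta> x) \<le> norm (B * indicator (cball 0 R) x)"
        using R[of x] B[of x] by (cases "\<zeta> x = 0") (auto simp: indicator_def)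
    qed
  qed (use smooth_compact_measurable[OF assms] in simp)
qed

text \<open>By translation invariance of Lebesgue measure every difference quotient has integral 0,
  and dominated convergence carries this over to the derivative.\<close>

lemma integral_partial_deriv_lborel:
  fixes \<zeta> :: "real ^ 'n::finite \<Rightarrow> real"
  assumes "smooth_compact U \<zeta>"
  shows "(LINT x|lborel. partial_deriv i \<zeta> x) = 0"
proof -
  define e :: "real ^ 'n" where "e = axis i 1"
  have ne: "norm e = 1" by (simp add: e_def norm_axis_1)
  obtain R where R: "\<And>x. \<zeta> x \<noteq> 0 \<Longrightarrow> norm x \<le> R"
    using smooth_compact_bounds[OF assms] by blast
  obtain M where M: "\<And>x. norm (partial_deriv i \<zeta> x) \<le> M"
    using smooth_compact_bounds[OF smooth_compact_partial_deriv[OF assms]] by metis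
  note cont = smooth_compact_continuous[OF assms]
  have [measurable]: "\<zeta> \<in> borel_measurable borel" by (rule borel_measurable_continuous_onI[OF cont])
  have [measurable]: "partial_deriv i \<zeta> \<in> borel_measurable borel"
    by (rule borel_measurable_continuous_onI[OF smooth_compact_continuous[OF smooth_compact_partial_deriv[OF assms]]])
  \<comment> \<open>Steps of length at most 1 keep all shifted supports inside the ball of radius
    \<open>R + 1\<close>, where the dominating function lives.\<close>
  define h where "h n = inverse (real (Suc n))" for n
  have hpos: "0 < h n" "h n \<le> 1" for n by (auto simp: h_def inverse_eq_divide)
  have h0: "h \<longlonglongrightarrow> 0" unfolding h_def using LIMSEQ_inverse_real_of_nat by simp
  define s where "s n x = (\<zeta> (h n *\<^sub>R e + x) - \<zeta> x) / h n" for n x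
  note \<zeta>i = integrable_lborel_smooth_compact[OF assms]
  have tr: "integrable lborel (\<lambda>x. \<zeta> (c + x))" "(LINT x|lborel. \<zeta> (c + x)) = (LINT x|lborel. \<zeta> x)" for c
  proof -
    have d: "distr lborel borel ((+) c) = lborel" by (rule lborel_distr_plus)
    show "integrable lborel (\<lambda>x. \<zeta> (c + x))"
      using \<zeta>i by (subst (asm) d[symmetric, of ]) (simp add: integrable_distr_eq)
    show "(LINT x|lborel. \<zeta> (c + x)) = (LINT x|lborel. \<zeta> x)"
      by (subst (2) d[symmetric]) (simp add: integral_distr)
  qed
  have s0: "(LINT x|lborel. s n x) = 0" for n
    unfolding s_def using tr \<zeta>i by (simp add: Bochner_Integration.integral_diff)
  have "(\<lambda>n. LINT x|lborel. s n x) \<longlonglongrightarrow> (LINT x|lborel. partial_deriv i \<zeta> x)"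
  proof (rule integral_dominated_convergence[where w="\<lambda>x. M * indicator (cball 0 (R + 1)) x"])
    show "AE x in lborel. (\<lambda>n. s n x) \<longlonglongrightarrow> partial_deriv i \<zeta> x"
    proof (rule AE_I2)
      fix x
      obtain D where D: "(\<zeta> has_derivative D) (at x)"
        using smooth_compact_differentiable[OF assms] by (auto simp: differentiable_def)
      have lin: "linear D" using D has_derivative_linear by blast
      have "((\<lambda>t. \<zeta> (x + t *\<^sub>R e)) has_derivative (\<lambda>t. D (t *\<^sub>R e))) (at 0)"
        by (rule has_derivative_compose[of "\<lambda>t. x + t *\<^sub>R e" "\<lambda>t. t *\<^sub>R e" 0 UNIV \<zeta>, simplified])
          (auto intro!: derivative_eq_intros D)
      then have "((\<lambda>t. \<zeta> (x + t *\<^sub>R e)) has_real_derivative D e) (at 0)"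
        unfolding has_field_derivative_def by (simp add: linear_cmul[OF lin] mult_commute_abs)
      then have "((\<lambda>t. (\<zeta> (x + t *\<^sub>R e) - \<zeta> x) / t) \<longlongrightarrow> D e) (at 0)"
        by (simp add: has_field_derivative_iff)
      moreover have "filterlim h (at 0) sequentially"
        using h0 hpos by (auto simp: filterlim_at less_imp_neq[symmetric])
      ultimately have "(\<lambda>n. (\<zeta> (x + h n *\<^sub>R e) - \<zeta> x) / h n) \<longlonglongrightarrow> D e"
        by (rule filterlim_compose)
      then show "(\<lambda>n. s n x) \<longlonglongrightarrow> partial_deriv i \<zeta> x"
        by (simp add: s_def partial_deriv_eq[OF D] e_def add.commute)
    qed
    show "AE x in lborel. norm (s n x) \<le> M * indicator (cball 0 (R + 1)) x" for n
    proof (rule AE_I2)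
      fix x
      show "norm (s n x) \<le> M * indicator (cball 0 (R + 1)) x"
      proof (cases "\<zeta> (h n *\<^sub>R e + x) = 0 \<and> \<zeta> x = 0")
        case True
        then show ?thesis using order_trans[OF norm_ge_zero M] by (simp add: s_def)
      next
        case False
        have "norm x \<le> R + 1"
        proof (cases "\<zeta> x = 0")
          case True
          then have "norm (h n *\<^sub>R e + x) \<le> R" using False R by blast
          moreover have "norm x \<le> norm (h n *\<^sub>R e + x) + norm (h n *\<^sub>R e)"
            by (metis add.commute add_diff_cancel_left' norm_triangle_sub norm_triangle_ineq4)
          ultimately show ?thesis using hpos[of n] ne by simp
        qed (use R in force)
        \<comment> \<open>By the mean value theorem along the segment, the quotient is a value of
          the partial derivative, hence bounded by \<open>M\<close>.\<close>
        moreover have "norm (\<zeta> (h n *\<^sub>R e + x) - \<zeta> x) \<le> M * h n"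
        proof -
          have "((\<lambda>t. \<zeta> (x + t *\<^sub>R e)) has_real_derivative partial_deriv i \<zeta> (x + t *\<^sub>R e)) (at t)" for t
          proof -
            obtain D where D: "(\<zeta> has_derivative D) (at (x + t *\<^sub>R e))"
              using smooth_compact_differentiable[OF assms] by (auto simp: differentiable_def)
            have lin: "linear D" using D has_derivative_linear by blast
            have "((\<lambda>t. \<zeta> (x + t *\<^sub>R e)) has_derivative (\<lambda>t. D (t *\<^sub>R e))) (at t)"
              by (rule has_derivative_compose[of "\<lambda>t. x + t *\<^sub>R e" "\<lambda>t. t *\<^sub>R e" t UNIV \<zeta>, simplified])
                (auto intro!: derivative_eq_intros D)
            then show ?thesis
              unfolding has_field_derivative_def partial_deriv_eq[OF D] e_def[symmetric]
              by (simp add: linear_cmul[OF lin] mult_commute_abs)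
          qed
          from MVT2[OF hpos(1)[of n], of "\<lambda>t. \<zeta> (x + t *\<^sub>R e)" "\<lambda>t. partial_deriv i \<zeta> (x + t *\<^sub>R e)"] this
          obtain z where "\<zeta> (x + h n *\<^sub>R e) - \<zeta> (x + 0 *\<^sub>R e) = (h n - 0) * partial_deriv i \<zeta> (x + z *\<^sub>R e)"
            by blast
          then have "norm (\<zeta> (h n *\<^sub>R e + x) - \<zeta> x) = h n * norm (partial_deriv i \<zeta> (x + z *\<^sub>R e))"
            using hpos[of n] by (simp add: add.commute abs_mult)
          then show ?thesis using M hpos[of n] by (simp add: mult.commute)
        qed
        ultimately show ?thesis using hpos[of n] by (simp add: s_def divide_simps)
      qed
    qed
    show "integrable lborel (\<lambda>x::real^'n. M * indicator (cball 0 (R + 1)) x :: real)" by (rule integrable_lborel_cball)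
  qed (auto simp: s_def[abs_def])
  then show ?thesis unfolding s0 using LIMSEQ_unique tendsto_const by blast
qed

lemma integral_partial_deriv:
  fixes \<zeta> :: "real ^ 'n::finite \<Rightarrow> real"
  assumes "smooth_compact U \<zeta>" "open U"
  shows "(LINT x|lebesgue_on U. partial_deriv i \<zeta> x) = 0"
proof -
  have "smooth_compact U (partial_deriv i \<zeta>)" using assms by (intro smooth_compact_partial_deriv)
  then have "closure {x. partial_deriv i \<zeta> x \<noteq> 0} \<subseteq> U" by (simp add: smooth_compact_def)
  then have sub: "partial_deriv i \<zeta> x \<noteq> 0 \<Longrightarrow> x \<in> U" for x
    using closure_subset[of "{x. partial_deriv i \<zeta> x \<noteq> 0}"] by auto
  have "(LINT x|lebesgue_on U. partial_deriv i \<zeta> x) = (LINT x|lebesgue. indicator U x *\<^sub>R partial_deriv i \<zeta> x)"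
    using assms(2) by (intro integral_restrict_space) auto
  also have "\<dots> = (LINT x|lebesgue. partial_deriv i \<zeta> x)"
    by (rule Bochner_Integration.integral_cong) (use sub in \<open>auto simp: indicator_def\<close>)
  also have "\<dots> = (LINT x|lborel. partial_deriv i \<zeta> x)"
    by (rule integral_completion)
      (use smooth_compact_measurable[OF smooth_compact_partial_deriv[OF assms(1)]] in simp)
  also have "\<dots> = 0" by (rule integral_partial_deriv_lborel[OF assms(1)])
  finally show ?thesis .
qed

section \<open>The fundamental lemma of the calculus of variations\<close>

lemma smooth_compactI_box:
  fixes \<phi> :: "real ^ 'n::finite \<Rightarrow> 'b::real_normed_vector"
  assumes "\<And>m. C_k m \<phi>" "\<And>x. x \<notin> cbox a b \<Longrightarrow> \<phi> x = 0" "cbox a b \<subseteq> U"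
  shows "smooth_compact U \<phi>"
proof -
  have s: "closure {x. \<phi> x \<noteq> 0} \<subseteq> cbox a b" by (rule closure_minimal) (use assms(2) in auto)
  then have "compact (closure {x. \<phi> x \<noteq> 0})"
    using compact_Int_closed[OF compact_cbox closed_closure, of a b "{x. \<phi> x \<noteq> 0}"] by (simp add: Int_absorb1)
  then show ?thesis using s assms by (auto simp: smooth_compact_def)
qed

text \<open>The smooth functions \<open>1 - (1 - box_bump)\<^sup>m\<close> increase to the indicator function of the box.\<close>

lemma integral_box_eq_0_if_smooth_annihilator:
  fixes g :: "real ^ 'n::finite \<Rightarrow> real"
  assumes "open U" "g \<in> L2 (lebesgue_on U) UNIV"
    and ann: "\<And>\<zeta>. smooth_compact U \<zeta> \<Longrightarrow> (LINT x|lebesgue_on U. g x * \<zeta> x) = 0"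
    and sub: "cbox a b \<subseteq> U"
  shows "integrable lebesgue (\<lambda>x. indicator (cbox a b) x * g x)"
    and "(LINT x|lebesgue. indicator (cbox a b) x * g x) = 0"
proof -
  have cs: "cbox a b \<in> sets (lebesgue_on U)"
    using sub assms(1) by (subst sets_restrict_space_iff) auto
  have "emeasure (lebesgue_on U) (cbox a b) < \<infinity>"
    using sub assms(1) by (subst emeasure_restrict_space) (auto simp: emeasure_lborel_cbox_eq)
  then have "integrable (lebesgue_on U) (indicator (cbox a b) :: _ \<Rightarrow> real)"
    using cs by (simp add: integrable_real_indicator)
  moreover have "(\<lambda>x. (norm (indicator (cbox a b) x :: real))\<^sup>2) = indicator (cbox a b)"
    by (auto simp: indicator_def)
  ultimately have "(indicator (cbox a b) :: _ \<Rightarrow> real) \<in> L2 (lebesgue_on U) UNIV"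
    using cs by (auto simp: L2_def)
  from integrable_inner_L2[OF this assms(2)]
  have i: "integrable (lebesgue_on U) (\<lambda>x. indicator (cbox a b) x * g x)" by simp
  have e: "indicator U x * (indicator (cbox a b) x * g x) = indicator (cbox a b) x * g x" for x
    using sub by (auto simp: indicator_def)
  show "integrable lebesgue (\<lambda>x. indicator (cbox a b) x * g x)"
    using i assms(1) by (subst (asm) integrable_restrict_space) (simp_all add: e)
  define \<beta> where "\<beta> = box_bump a b"
  define s where "s m x = 1 - (1 - \<beta> x) ^ m" for m x
  have Ck: "C_k m (s n)" for m n
  proof -
    \<comment> \<open>Written as a sum with a scalar multiple, and the power below as a product, to
      fit the closure rules for \<open>C_k\<close>.\<close>
    have "C_k m (\<lambda>x. 1 + - 1 * \<beta> x)"
      unfolding \<beta>_def by (intro C_k_add C_k_const C_k_linear[OF bounded_linear_mult_right] box_bump_C_k)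
    then have "C_k m (\<lambda>x. \<Prod>i\<in>{..<n}. (1 + - 1 * \<beta> x))" by (rule C_k_prod)
    then have "C_k m (\<lambda>x. 1 + - 1 * (\<Prod>i\<in>{..<n}. (1 + - 1 * \<beta> x)))"
      by (intro C_k_add C_k_const C_k_linear[OF bounded_linear_mult_right])
    then show ?thesis by (simp add: s_def[abs_def])
  qed
  have \<beta>0: "\<beta> x = 0" if "x \<notin> box a b" for x
    using that box_bump_pos[of a b x] box_bump_bounds(1)[of a b x] by (simp add: \<beta>_def)
  have sb: "0 \<le> s m x" "s m x \<le> 1" for m x
    using box_bump_bounds[of a b x] by (auto simp: s_def \<beta>_def power_le_one)
  have s0: "s m x = 0" if "x \<notin> cbox a b" for m x
  proof -
    have "x \<notin> box a b" using that box_subset_cbox[of a b] by blast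
    then show ?thesis using \<beta>0 by (simp add: s_def)
  qed
  have "(\<lambda>m. LINT x|lebesgue_on U. g x * s m x) \<longlonglongrightarrow> (LINT x|lebesgue_on U. indicator (box a b) x * g x)"
  proof (rule integral_dominated_convergence[where w="\<lambda>x. norm (indicator (cbox a b) x * g x)"])
    show "AE x in lebesgue_on U. (\<lambda>m. g x * s m x) \<longlonglongrightarrow> indicator (box a b) x * g x"
    proof (rule AE_I2)
      fix x
      show "(\<lambda>m. g x * s m x) \<longlonglongrightarrow> indicator (box a b) x * g x"
      proof (cases "x \<in> box a b")
        case True
        then have "(\<lambda>m. (1 - \<beta> x) ^ m) \<longlonglongrightarrow> 0"
          using box_bump_pos[of a b x] box_bump_bounds[of a b x] by (intro LIMSEQ_power_zero) (simp add: \<beta>_def)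
        then have "(\<lambda>m. g x * s m x) \<longlonglongrightarrow> g x * (1 - 0)" unfolding s_def by (intro tendsto_mult tendsto_diff tendsto_const)
        then show ?thesis using True by simp
      qed (simp add: s_def \<beta>0)
    qed
    show "AE x in lebesgue_on U. norm (g x * s m x) \<le> norm (indicator (cbox a b) x * g x)" for m
    proof (rule AE_I2)
      fix x show "norm (g x * s m x) \<le> norm (indicator (cbox a b) x * g x)"
        using sb[of m x] s0[of x m] by (cases "x \<in> cbox a b") (auto simp: abs_mult mult_left_le)
    qed
    have [measurable]: "g \<in> borel_measurable (lebesgue_on U)" by (rule L2_D(1)[OF assms(2)])
    have "s m \<in> borel_measurable borel" for m
      by (rule borel_measurable_continuous_onI) (use Ck[of 0 m] in simp)
    then have "s m \<in> borel_measurable (lebesgue_on U)" for m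
      by (intro measurable_restrict_space1 measurable_completion) simp
    then show "(\<lambda>x. g x * s m x) \<in> borel_measurable (lebesgue_on U)" for m by measurable
    have "box a b \<in> sets (lebesgue_on U)"
      using sub assms(1) box_subset_cbox[of a b] by (subst sets_restrict_space_iff) auto
    then show "(\<lambda>x. indicator (box a b) x * g x) \<in> borel_measurable (lebesgue_on U)" by measurable
    show "integrable (lebesgue_on U) (\<lambda>x. norm (indicator (cbox a b) x * g x))" using i by (rule integrable_norm)
  qed
  moreover have "(LINT x|lebesgue_on U. g x * s m x) = 0" for m
    by (rule ann[OF smooth_compactI_box[OF Ck s0 sub]])
  ultimately have "(LINT x|lebesgue_on U. indicator (box a b) x * g x) = 0"
    using LIMSEQ_unique[OF tendsto_const] by fastforce
  moreover have "(LINT x|lebesgue_on U. indicator (box a b) x * g x) = (LINT x|lebesgue. indicator (box a b) x * g x)"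
    using assms(1) order_trans[OF box_subset_cbox[of a b] sub]
    by (subst integral_restrict_space) (auto intro!: Bochner_Integration.integral_cong simp: indicator_def)
  moreover have "(LINT x|lebesgue. indicator (cbox a b) x * g x) = (LINT x|lebesgue. indicator (box a b) x * g x)"
  proof (rule Bochner_Integration.integral_cong_AE)
    have "cbox a b - box a b \<in> null_sets lebesgue"
      using negligible_frontier_interval negligible_iff_null_sets by blast
    then have "AE x in lebesgue. x \<notin> cbox a b - box a b" by (rule AE_not_in)
    then show "AE x in lebesgue. indicator (cbox a b) x * g x = indicator (box a b) x * g x"
      by eventually_elim (use box_subset_cbox[of a b] in \<open>auto simp: indicator_def\<close>)
    show m: "(\<lambda>x. indicator (cbox a b) x * g x) \<in> borel_measurable lebesgue"
      using \<open>integrable lebesgue (\<lambda>x. indicator (cbox a b) x * g x)\<close> by simp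
    have "(\<lambda>x. indicator (box a b) x * (indicator (cbox a b) x * g x)) \<in> borel_measurable lebesgue"
      by (rule borel_measurable_times[OF borel_measurable_indicator m]) auto
    moreover have "(\<lambda>x. indicator (box a b) x * (indicator (cbox a b) x * g x)) = (\<lambda>x. indicator (box a b) x * g x)"
      using box_subset_cbox[of a b] by (intro ext) (auto simp: indicator_def)
    ultimately show "(\<lambda>x. indicator (box a b) x * g x) \<in> borel_measurable lebesgue" by simp
  qed
  ultimately show "(LINT x|lebesgue. indicator (cbox a b) x * g x) = 0" by simp
qed

text \<open>The integrals over all boxes vanish, so Lebesgue's differentiation theorem gives
  \<open>g = 0\<close> almost everywhere on each closed box in \<open>U\<close>. Negligibility is a
  local property, and such boxes are neighbourhoods of all points of \<open>U\<close>.\<close>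

lemma smooth_annihilator_eq_0:
  fixes g :: "real ^ 'n::finite \<Rightarrow> real"
  assumes U: "open U" and g: "g \<in> L2 (lebesgue_on U) UNIV"
    and ann: "\<And>\<zeta>. smooth_compact U \<zeta> \<Longrightarrow> (LINT x|lebesgue_on U. g x * \<zeta> x) = 0"
  shows "AE x in lebesgue_on U. g x = 0"
proof -
  have loc: "negligible {x \<in> cbox c d. g x \<noteq> 0}" if cd: "cbox c d \<subseteq> U" for c d
  proof -
    define f where "f x = indicator (cbox c d) x * g x" for x
    have fi: "integrable lebesgue f" unfolding f_def
      by (rule integral_box_eq_0_if_smooth_annihilator(1)[OF U g ann cd])
    have f: "set_integrable lebesgue (cbox a b) f" for a b
      using integrable_mult_indicator[OF _ fi, of "cbox a b"] by (simp add: set_integrable_def)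
    have "integral (cbox a b) f = 0" for a b
    proof -
      \<comment> \<open>Truncation makes \<open>f\<close> integrable on the whole space; boxes are
        closed under intersection, so truncated integrals are again integrals over boxes inside
        \<open>U\<close>.\<close>
      obtain p q where pq: "cbox a b \<inter> cbox c d = cbox p q"
        using Int_interval[of a b c d] by blast
      have "integral (cbox a b) f = (LINT x:cbox a b|lebesgue. f x)"
        using set_lebesgue_integral_eq_integral(2)[OF f] by simp
      also have "\<dots> = (LINT x|lebesgue. indicator (cbox p q) x * g x)"
        unfolding set_lebesgue_integral_def pq[symmetric]
        by (rule Bochner_Integration.integral_cong) (auto simp: f_def indicator_def)
      also have "\<dots> = 0" using pq cd
        by (intro integral_box_eq_0_if_smooth_annihilator(2)[OF U g ann]) auto
      finally show ?thesis .
    qed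
    moreover obtain N where N: "negligible N"
      "\<And>x e. \<lbrakk>x \<notin> N; 0 < e\<rbrakk> \<Longrightarrow> \<exists>d>0. \<forall>h. 0 < h \<and> h < d \<longrightarrow>
          norm (integral (cbox x (x + h *\<^sub>R One)) f /\<^sub>R h ^ DIM(real^'n) - f x) < e"
      using integrable_ccontinuous_explicit[of f, OF set_lebesgue_integral_eq_integral(1)[OF f]] by blast
    ultimately have "f x = 0" if x: "x \<notin> N" for x
    proof (rule_tac ccontr)
      assume "f x \<noteq> 0"
      then obtain r where r: "r > 0" "\<forall>h. 0 < h \<and> h < r \<longrightarrow>
          norm (integral (cbox x (x + h *\<^sub>R One)) f /\<^sub>R h ^ DIM(real^'n) - f x) < norm (f x)"
        using N(2)[OF x, of "norm (f x)"] by (auto simp del: real_norm_def)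
      then have "norm (integral (cbox x (x + (r/2) *\<^sub>R One)) f /\<^sub>R (r/2) ^ DIM(real^'n) - f x) < norm (f x)"
        by auto
      then show False using \<open>\<And>a b. integral (cbox a b) f = 0\<close> by simp
    qed
    then have "x \<in> N" if "x \<in> cbox c d" "g x \<noteq> 0" for x
      using that unfolding f_def by fastforce
    then show ?thesis by (intro negligible_subset[OF N(1)]) auto
  qed
  \<comment> \<open>Every point of the exceptional set has a relative neighbourhood inside one of
    the boxes just treated.\<close>
  have "negligible {x \<in> U. g x \<noteq> 0}"
  proof (subst locally_negligible_alt, intro ballI)
    fix x assume x: "x \<in> {x \<in> U. g x \<noteq> 0}"
    then have "x \<in> U" by simp
    obtain c d where cd: "cbox c d \<subseteq> U" "x \<in> box c d"
      by (rule open_contains_cbox[OF U \<open>x \<in> U\<close>])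
    show "\<exists>V. openin (top_of_set {x \<in> U. g x \<noteq> 0}) V \<and> x \<in> V \<and> negligible V"
    proof (intro exI conjI)
      show "openin (top_of_set {x \<in> U. g x \<noteq> 0}) ({x \<in> U. g x \<noteq> 0} \<inter> box c d)"
        by (simp add: openin_open_Int open_box)
      show "negligible ({x \<in> U. g x \<noteq> 0} \<inter> box c d)"
        by (rule negligible_subset[OF loc[OF cd(1)]]) (use box_subset_cbox[of c d] in auto)
    qed (use x cd in auto)
  qed
  then have "AE x in lebesgue. x \<notin> {x \<in> U. g x \<noteq> 0}"
    unfolding negligible_iff_null_sets by (rule AE_not_in)
  then show ?thesis using U by (subst AE_restrict_space_iff) auto
qed

section \<open>Exterior algebra\<close>

lemma shuffle_sign_square: "shuffle_sign I J * shuffle_sign I J = 1"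
  by (simp add: shuffle_sign_def flip: power_mult_distrib)

lemma shuffle_sign_Un_left:
  assumes "A \<inter> B = {}"
  shows "shuffle_sign (A \<union> B) C = shuffle_sign A C * shuffle_sign B C"
proof -
  have "{(i, j). i \<in> A \<union> B \<and> j \<in> C \<and> j < i} =
      {(i, j). i \<in> A \<and> j \<in> C \<and> j < i} \<union> {(i, j). i \<in> B \<and> j \<in> C \<and> j < i}" by auto
  moreover have "card \<dots> = card {(i, j). i \<in> A \<and> j \<in> C \<and> j < i} + card {(i, j). i \<in> B \<and> j \<in> C \<and> j < i}"
    using assms by (intro card_Un_disjoint) auto
  ultimately show ?thesis by (simp add: shuffle_sign_def power_add)
qed

lemma shuffle_sign_Un_right:
  assumes "B \<inter> C = {}"
  shows "shuffle_sign A (B \<union> C) = shuffle_sign A B * shuffle_sign A C"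
proof -
  have "{(i, j). i \<in> A \<and> j \<in> B \<union> C \<and> j < i} =
      {(i, j). i \<in> A \<and> j \<in> B \<and> j < i} \<union> {(i, j). i \<in> A \<and> j \<in> C \<and> j < i}" by auto
  moreover have "card \<dots> = card {(i, j). i \<in> A \<and> j \<in> B \<and> j < i} + card {(i, j). i \<in> A \<and> j \<in> C \<and> j < i}"
    using assms by (intro card_Un_disjoint) auto
  ultimately show ?thesis by (simp add: shuffle_sign_def power_add)
qed

text \<open>The inversions counted by the two signs together are all pairs in
  \<open>I \<times> J\<close>, each occurring once.\<close>

lemma shuffle_sign_commute:
  assumes "I \<inter> J = {}"
  shows "shuffle_sign I J * shuffle_sign J I = (-1) ^ (card I * card J)"
proof -
  have "card {(i, j). i \<in> J \<and> j \<in> I \<and> j < i} = card {(i, j). i \<in> I \<and> j \<in> J \<and> i < j}"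
    by (rule bij_betw_same_card[of prod.swap]) (auto simp: bij_betw_def image_def prod.swap_def)
  moreover have "card {(i, j). i \<in> I \<and> j \<in> J \<and> j < i} + card {(i, j). i \<in> I \<and> j \<in> J \<and> i < j} = card (I \<times> J)"
  proof -
    have "I \<times> J = {(i, j). i \<in> I \<and> j \<in> J \<and> j < i} \<union> {(i, j). i \<in> I \<and> j \<in> J \<and> i < j}"
      using assms by (auto simp: not_less le_less)
    moreover have "card \<dots> = card {(i, j). i \<in> I \<and> j \<in> J \<and> j < i} + card {(i, j). i \<in> I \<and> j \<in> J \<and> i < j}"
      by (rule card_Un_disjoint) auto
    ultimately show ?thesis by simp
  qed
  ultimately show ?thesis
    by (simp add: shuffle_sign_def card_cartesian_product flip: power_add)
qed

section \<open>Degrees, top coefficients and the Hodge star\<close>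

lemma subspace_alt_deg: "subspace (alt_deg j)"
  unfolding subspace_def alt_deg_def by auto (metis add_cancel_right_right)+

lemma alt_deg_D: "a \<in> alt_deg j \<Longrightarrow> int (card I) \<noteq> j \<Longrightarrow> a $ I = 0"
  by (auto simp: alt_deg_def)

lemma wedge_top: "wedge a b $ UNIV = (\<Sum>I\<in>UNIV. shuffle_sign I (- I) * a $ I * b $ (- I))"
  by (simp add: wedge_def Compl_eq_Diff_UNIV)

text \<open>The shuffle sign occurs once in the wedge and once in the star, and squares to 1. This
  identifies \<open>L2_inner\<close> with the abstract inner product \<open>ip\<close> on
  coefficient vectors.\<close>

lemma wedge_hodge_top: "wedge a (hodge b) $ UNIV = a \<bullet> b"
proof -
  have "shuffle_sign I (- I) * a $ I * (hodge b $ (- I)) = a $ I * b $ I" for I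
  proof -
    have "shuffle_sign I (- I) * a $ I * (hodge b $ (- I)) = (shuffle_sign I (- I) * shuffle_sign I (- I)) * (a $ I * b $ I)"
      by (simp add: hodge_def mult_ac)
    then show ?thesis by (simp only: shuffle_sign_square)
  qed
  then show ?thesis by (simp only: wedge_top inner_vec_def inner_real_def)
qed

text \<open>The coefficient at \<open>J\<close> of the inverse is read off at the complement, so the
  two arguments of the sign are exchanged compared with \<open>hodge\<close>.\<close>

definition hodge_inv :: "'n::{finite,linorder} alt \<Rightarrow> 'n alt" where
  "hodge_inv a = (\<chi> J. shuffle_sign J (- J) * a $ (- J))"

lemma hodge_hodge_inv: "hodge (hodge_inv a) = a"
proof -
  have "shuffle_sign (- J) J * (shuffle_sign (- J) J * c) = c" for J :: "'a set" and c
    unfolding mult.assoc[symmetric] shuffle_sign_square by simp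
  then show ?thesis by (simp add: hodge_def hodge_inv_def vec_eq_iff)
qed

lemma hodge_inv_hodge: "hodge_inv (hodge a) = a"
proof -
  have "shuffle_sign J (- J) * (shuffle_sign J (- J) * c) = c" for J :: "'a set" and c
    unfolding mult.assoc[symmetric] shuffle_sign_square by simp
  then show ?thesis by (simp add: hodge_def hodge_inv_def vec_eq_iff)
qed

lemma inv_hodge: "inv hodge = hodge_inv"
  by (rule inv_equality) (auto simp: hodge_hodge_inv hodge_inv_hodge)

lemma bounded_linear_hodge: "bounded_linear hodge"
  unfolding linear_conv_bounded_linear[symmetric]
  by (rule linearI) (simp_all add: hodge_def vec_eq_iff algebra_simps)

lemma bounded_linear_hodge_inv: "bounded_linear hodge_inv"
  unfolding linear_conv_bounded_linear[symmetric]
  by (rule linearI) (simp_all add: hodge_inv_def vec_eq_iff algebra_simps)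

lemma card_Compl_int: "int (card (- J :: 'n::finite set)) = int CARD('n) - int (card J)"
  using card_Diff_subset[of J UNIV] card_mono[of UNIV J] by (simp add: Compl_eq_Diff_UNIV)

lemma hodge_alt_deg: "a \<in> alt_deg j \<Longrightarrow> hodge a \<in> alt_deg (int CARD('n) - j)" for a :: "'n::{finite,linorder} alt"
  unfolding alt_deg_def hodge_def by (auto simp: card_Compl_int)

lemma hodge_inv_alt_deg: "a \<in> alt_deg j \<Longrightarrow> hodge_inv a \<in> alt_deg (int CARD('n) - j)" for a :: "'n::{finite,linorder} alt"
  unfolding alt_deg_def hodge_inv_def by (auto simp: card_Compl_int)

lemma minus_one_power_eq: "(-1 :: real) ^ m = (-1) powi (int m)"
  by simp

lemma minus_one_powi: "(-1 :: real) powi j = (if even j then 1 else -1)"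
  by (simp add: power_int_minus_left)

text \<open>With the star on the left factor, the two shuffle signs belong to opposite orders of
  complementary sets and multiply to a sign depending on the cardinality; homogeneity of
  \<open>b\<close> makes it the same for all contributing terms.\<close>

lemma wedge_hodge_left_top:
  fixes a b :: "'n::{finite,linorder} alt"
  assumes "b \<in> alt_deg j"
  shows "wedge (hodge a) b $ UNIV = (-1) powi (j * (int CARD('n) - j)) * (a \<bullet> b)"
proof -
  have "wedge (hodge a) b $ UNIV = (\<Sum>I\<in>UNIV. (shuffle_sign I (- I) * shuffle_sign (- I) I) * (a $ (- I) * b $ (- I)))"
    by (simp add: wedge_top hodge_def mult_ac)
  also have "\<dots> = (\<Sum>J\<in>UNIV. (shuffle_sign (- J) J * shuffle_sign J (- J)) * (a $ J * b $ J))"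
    by (rule sum.reindex_bij_witness[of _ uminus uminus]) auto
  also have "\<dots> = (\<Sum>J\<in>UNIV. (-1) powi (j * (int CARD('n) - j)) * (a $ J * b $ J))"
  proof (rule sum.cong[OF refl])
    fix J :: "'n set"
    show "(shuffle_sign (- J) J * shuffle_sign J (- J)) * (a $ J * b $ J) = (-1) powi (j * (int CARD('n) - j)) * (a $ J * b $ J)"
    proof (cases "int (card J) = j")
      case True
      have "shuffle_sign (- J) J * shuffle_sign J (- J) = (-1) ^ (card (- J) * card J)"
        by (rule shuffle_sign_commute) auto
      also have "\<dots> = (-1) powi (int (card (- J) * card J))" by (rule minus_one_power_eq)
      also have "int (card (- J) * card J) = j * (int CARD('n) - j)"
        by (simp only: of_nat_mult card_Compl_int True mult.commute)
      finally show ?thesis by simp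
    qed (simp add: alt_deg_D[OF assms])
  qed
  finally show ?thesis by (simp add: inner_vec_def sum_distrib_left)
qed

lemma wedge_axis: "wedge (axis {i} 1) b $ J = (if i \<in> J then shuffle_sign {i} (J - {i}) * b $ (J - {i}) else 0)"
proof -
  have "wedge (axis {i} 1) b $ J = (\<Sum>I\<in>Pow J. if {i} = I then shuffle_sign I (J - I) * b $ (J - I) else 0)"
    unfolding wedge_def vec_lambda_beta by (rule sum.cong) (auto simp: axis_def)
  then show ?thesis by (simp add: sum.delta)
qed

lemma wedge_axis_alt_deg: "b \<in> alt_deg j \<Longrightarrow> wedge (axis {i} 1) b \<in> alt_deg (j + 1)"
proof (unfold alt_deg_def, clarsimp simp: wedge_axis split: if_splits)
  fix J assume a: "\<forall>I. b $ I \<noteq> 0 \<longrightarrow> int (card I) = j" "b $ (J - {i}) \<noteq> 0" "i \<in> J"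
  then show "int (card J) = j + 1" using card_Suc_Diff1[of J i] by force
qed

text \<open>Moving \<open>dx_i\<close> past a form of degree \<open>j\<close> costs j
  transpositions. The top coefficient suffices, since the identity is applied under the
  integral.\<close>

lemma wedge_axis_shift:
  assumes "a \<in> alt_deg j"
  shows "wedge (wedge (axis {i} 1) a) b $ UNIV = (-1) powi j * (wedge a (wedge (axis {i} 1) b) $ UNIV)"
proof -
  have "wedge (wedge (axis {i} 1) a) b $ UNIV =
      (\<Sum>K | i \<in> K. shuffle_sign K (- K) * shuffle_sign {i} (K - {i}) * a $ (K - {i}) * b $ (- K))"
    unfolding wedge_top by (rule sum.mono_neutral_cong_right) (auto simp: wedge_axis mult_ac)
  also have "\<dots> = (\<Sum>I | i \<notin> I. shuffle_sign (insert i I) (- insert i I) * shuffle_sign {i} I * a $ I * b $ (- insert i I))"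
    by (rule sum.reindex_bij_witness[of _ "insert i" "\<lambda>K. K - {i}"]) (auto simp: insert_absorb)
  also have "\<dots> = (\<Sum>I | i \<notin> I. (-1) powi j * (shuffle_sign I (- I) * a $ I * (wedge (axis {i} 1) b $ (- I))))"
  proof (rule sum.cong[OF refl])
    fix I assume "I \<in> {I. i \<notin> I}"
    then have i: "i \<notin> I" by simp
    \<comment> \<open>The signs of \<open>insert i I\<close> and \<open>insert i J\<close> split
      into signs between \<open>{i}\<close>, \<open>I\<close> and \<open>J\<close>; the only
      discrepancy left is the exchange of \<open>i\<close> with \<open>I\<close>.\<close>
    define J where "J = - insert i I"
    have J: "i \<notin> J" "I \<inter> J = {}" "- I = insert i J" using i by (auto simp: J_def)
    have 1: "shuffle_sign (insert i I) J = shuffle_sign {i} J * shuffle_sign I J"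
      using shuffle_sign_Un_left[of "{i}" I J] i by simp
    have 2: "shuffle_sign I (insert i J) = shuffle_sign I {i} * shuffle_sign I J"
      using shuffle_sign_Un_right[of "{i}" J I] J by simp
    have 3: "shuffle_sign {i} I = (-1) ^ card I * shuffle_sign I {i}"
    proof -
      have "shuffle_sign I {i} * shuffle_sign {i} I = (-1) ^ card I"
        using shuffle_sign_commute[of I "{i}"] i by simp
      then have "shuffle_sign I {i} * (shuffle_sign I {i} * shuffle_sign {i} I) = (-1) ^ card I * shuffle_sign I {i}"
        by simp
      then show ?thesis unfolding mult.assoc[symmetric] shuffle_sign_square by simp
    qed
    show "shuffle_sign (insert i I) (- insert i I) * shuffle_sign {i} I * a $ I * b $ (- insert i I)
        = (-1) powi j * (shuffle_sign I (- I) * a $ I * (wedge (axis {i} 1) b $ (- I)))"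
    proof (cases "int (card I) = j")
      case True
      then have "(-1 :: real) powi j = (-1) ^ card I" using minus_one_power_eq[of "card I"] by simp
      then show ?thesis
        unfolding J_def[symmetric] J(3) wedge_axis using J(1) by (simp add: 1 2 3 mult_ac)
    qed (simp add: alt_deg_D[OF assms])
  qed
  also have "\<dots> = (\<Sum>I\<in>UNIV. (-1) powi j * (shuffle_sign I (- I) * a $ I * (wedge (axis {i} 1) b $ (- I))))"
    by (rule sum.mono_neutral_left) (auto simp: wedge_axis)
  finally show ?thesis by (simp add: wedge_top sum_distrib_left)
qed

lemma bounded_bilinear_wedge: "bounded_bilinear wedge"
  unfolding bilinear_conv_bounded_bilinear[symmetric] bilinear_def
  by (auto intro!: linearI simp: wedge_def vec_eq_iff algebra_simps sum.distrib sum_distrib_left)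

lemma bounded_linear_wedge: "bounded_linear (wedge a)"
  by (rule bounded_bilinear.bounded_linear_right[OF bounded_bilinear_wedge])

lemma bounded_bilinear_wedge_top: "bounded_bilinear (\<lambda>a b. wedge a b $ UNIV)"
  unfolding bilinear_conv_bounded_bilinear[symmetric] bilinear_def
  by (auto intro!: linearI simp: wedge_def algebra_simps sum.distrib sum_distrib_left)

section \<open>Test forms and their exterior derivative\<close>

lemma test_forms_iff: "\<phi> \<in> test_forms U j \<longleftrightarrow> smooth_compact U \<phi> \<and> (\<forall>x. \<phi> x \<in> alt_deg j)"
  by (auto simp: test_forms_def smooth_compact_def)

lemma partial_deriv_alt_deg:
  assumes "\<phi> differentiable (at x)" "\<And>x. \<phi> x \<in> alt_deg j"
  shows "partial_deriv i \<phi> x \<in> alt_deg j"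
proof -
  have "partial_deriv i \<phi> x $ I = 0" if "int (card I) \<noteq> j" for I
  proof -
    have "partial_deriv i \<phi> x $ I = partial_deriv i (\<lambda>x. \<phi> x $ I) x"
      by (rule partial_deriv_linear[OF bounded_linear_vec_nth assms(1), symmetric])
    also have "(\<lambda>x. \<phi> x $ I) = (\<lambda>x. 0)" using alt_deg_D[OF assms(2) that] by auto
    finally show ?thesis using partial_deriv_eq[OF has_derivative_const[of 0 "at x"]] by simp
  qed
  then show ?thesis by (auto simp: alt_deg_def)
qed

lemma smooth_d_test_forms:
  assumes "\<phi> \<in> test_forms U j"
  shows "smooth_d \<phi> \<in> test_forms U (j + 1)"
proof -
  have s: "smooth_compact U \<phi>" and d: "\<And>x. \<phi> x \<in> alt_deg j" using assms by (auto simp: test_forms_iff)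
  have "smooth_compact U (\<lambda>x. \<Sum>i\<in>UNIV. wedge (axis {i} 1) (partial_deriv i \<phi> x))"
    by (intro smooth_compact_sum smooth_compact_linear[OF _ bounded_linear_wedge] smooth_compact_partial_deriv s)
  moreover have "smooth_d \<phi> = (\<lambda>x. \<Sum>i\<in>UNIV. wedge (axis {i} 1) (partial_deriv i \<phi> x))"
    by (rule ext) (rule smooth_d_def)
  moreover have "smooth_d \<phi> x \<in> alt_deg (j + 1)" for x
    unfolding smooth_d_def
    by (intro subspace_sum subspace_alt_deg wedge_axis_alt_deg partial_deriv_alt_deg smooth_compact_differentiable[OF s] d)
  ultimately show ?thesis by (simp add: test_forms_iff)
qed

lemma test_forms_hodge: "\<phi> \<in> test_forms U j \<Longrightarrow> (\<lambda>x. hodge (\<phi> x)) \<in> test_forms U (int CARD('n) - j)"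
  for \<phi> :: "'n::{finite,linorder} form"
  by (auto simp: test_forms_iff intro: smooth_compact_linear bounded_linear_hodge hodge_alt_deg)

lemma test_forms_hodge_inv: "\<phi> \<in> test_forms U j \<Longrightarrow> (\<lambda>x. hodge_inv (\<phi> x)) \<in> test_forms U (int CARD('n) - j)"
  for \<phi> :: "'n::{finite,linorder} form"
  by (auto simp: test_forms_iff intro: smooth_compact_linear bounded_linear_hodge_inv hodge_inv_alt_deg)

lemma test_forms_zero: "(\<lambda>x. 0) \<in> test_forms U j"
  by (simp add: test_forms_iff smooth_compact_zero subspace_0[OF subspace_alt_deg])

lemma test_forms_add: "\<phi> \<in> test_forms U j \<Longrightarrow> \<psi> \<in> test_forms U j \<Longrightarrow> (\<lambda>x. \<phi> x + \<psi> x) \<in> test_forms U j"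
  by (simp add: test_forms_iff smooth_compact_add subspace_add[OF subspace_alt_deg])

lemma test_forms_scaleR: "\<phi> \<in> test_forms U j \<Longrightarrow> (\<lambda>x. c *\<^sub>R \<phi> x) \<in> test_forms U j"
  by (simp add: test_forms_iff smooth_compact_linear[OF _ bounded_linear_scaleR_right] subspace_scale[OF subspace_alt_deg])

lemma test_forms_mono: "U \<subseteq> V \<Longrightarrow> test_forms U j \<subseteq> test_forms V j"
  by (auto simp: test_forms_iff smooth_compact_mono)

lemma smooth_d_add:
  assumes "\<phi> \<in> test_forms U j" "\<psi> \<in> test_forms U j"
  shows "smooth_d (\<lambda>x. \<phi> x + \<psi> x) x = smooth_d \<phi> x + smooth_d \<psi> x"
proof -
  have "partial_deriv i (\<lambda>x. \<phi> x + \<psi> x) x = partial_deriv i \<phi> x + partial_deriv i \<psi> x" for i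
    using assms by (intro partial_deriv_add) (auto simp: test_forms_iff intro: smooth_compact_differentiable)
  then show ?thesis
    by (simp add: smooth_d_def linear_add[OF bounded_linear.linear[OF bounded_linear_wedge]] sum.distrib)
qed

lemma smooth_d_scaleR:
  assumes "\<phi> \<in> test_forms U j"
  shows "smooth_d (\<lambda>x. c *\<^sub>R \<phi> x) x = c *\<^sub>R smooth_d \<phi> x"
proof -
  have "partial_deriv i (\<lambda>x. c *\<^sub>R \<phi> x) x = c *\<^sub>R partial_deriv i \<phi> x" for i
    using assms by (intro partial_deriv_linear bounded_linear_scaleR_right) (auto simp: test_forms_iff intro: smooth_compact_differentiable)
  then show ?thesis
    by (simp add: smooth_d_def linear_cmul[OF bounded_linear.linear[OF bounded_linear_wedge]] scaleR_sum_right)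
qed

section \<open>Integration by parts for test forms\<close>

lemma integrable_smooth_compact:
  fixes \<zeta> :: "real ^ 'n::finite \<Rightarrow> real"
  assumes "smooth_compact V \<zeta>" "open U"
  shows "integrable (lebesgue_on U) \<zeta>"
proof -
  have "integrable lborel \<zeta>" by (rule integrable_lborel_smooth_compact[OF assms(1)])
  then have "integrable lebesgue \<zeta>" by (simp add: integrable_completion)
  then have "integrable lebesgue (\<lambda>x. indicator U x *\<^sub>R \<zeta> x)"
    using assms(2) by (intro integrable_mult_indicator) auto
  then show ?thesis using assms(2) by (simp add: integrable_restrict_space)
qed

lemma smooth_compact_borel_measurable_lebesgue_on:
  assumes "smooth_compact V \<phi>"
  shows "\<phi> \<in> borel_measurable (lebesgue_on U)"
proof -
  have "\<phi> \<in> borel_measurable lebesgue"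
    using smooth_compact_measurable[OF assms] by (intro measurable_completion) simp
  then show ?thesis by (rule measurable_restrict_space1)
qed

lemma smooth_compact_bilinear:
  assumes "smooth_compact U \<phi>" "\<And>m. C_k m \<psi>" "bounded_bilinear B"
  shows "smooth_compact U (\<lambda>x. B (\<phi> x) (\<psi> x))"
proof (rule smooth_compact_cong_support[OF assms(1)])
  show "C_k m (\<lambda>x. B (\<phi> x) (\<psi> x))" for m
    using assms by (intro C_k_bilinear[OF assms(3)]) (auto simp: smooth_compact_C_k)
  show "{x. B (\<phi> x) (\<psi> x) \<noteq> 0} \<subseteq> closure {x. \<phi> x \<noteq> 0}"
    by (rule order_trans[OF _ closure_subset]) (auto simp: bounded_bilinear.zero_left[OF assms(3)])
qed

lemma test_forms_L2:
  assumes "\<phi> \<in> test_forms V j" "open U"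
  shows "\<phi> \<in> L2 (lebesgue_on U) (alt_deg j)"
proof -
  have s: "smooth_compact V \<phi>" using assms by (simp add: test_forms_iff)
  have "smooth_compact V (\<lambda>x. \<phi> x \<bullet> \<phi> x)"
    by (rule smooth_compact_bilinear[OF s smooth_compact_C_k[OF s] bounded_bilinear_inner])
  then have "integrable (lebesgue_on U) (\<lambda>x. \<phi> x \<bullet> \<phi> x)" by (rule integrable_smooth_compact[OF _ assms(2)])
  then show ?thesis using assms(1) smooth_compact_borel_measurable_lebesgue_on[OF s]
    by (simp add: L2_def power2_norm_eq_inner test_forms_iff)
qed

text \<open>Stokes' theorem for compactly supported forms, coordinate by coordinate. It makes the
  classical derivative of a test form its weak derivative, which identifies \<open>ext_d\<close> on
  test forms.\<close>

lemma wedge_integral_by_parts: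
  fixes \<psi> \<phi> :: "'n::{finite,linorder} form"
  assumes U: "open U" and \<psi>: "\<psi> \<in> test_forms U j" and \<phi>: "\<phi> \<in> test_forms U l"
  shows "form_integral U (\<lambda>x. wedge (smooth_d \<psi> x) (\<phi> x)) =
     (-1) powi (j + 1) * form_integral U (\<lambda>x. wedge (\<psi> x) (smooth_d \<phi> x))"
proof -
  \<comment> \<open>\<open>\<beta> i\<close> is bilinear, so the product rule differentiates
    \<open>\<beta> i (\<psi> x) (\<phi> x)\<close> in direction \<open>i\<close>; summed over
    \<open>i\<close>, its two terms are the two integrands up to sign.\<close>
  define \<beta> where "\<beta> i a b = wedge (wedge (axis {i} 1) a) b $ UNIV" for i and a b :: "'n alt"
  have bil: "bounded_bilinear (\<beta> i)" for i
    unfolding \<beta>_def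
    using bounded_bilinear.comp[OF bounded_bilinear_wedge_top bounded_linear_wedge bounded_linear_ident] .
  have s: "smooth_compact U \<psi>" "smooth_compact U \<phi>" and d: "\<And>x. \<psi> x \<in> alt_deg j"
    using \<psi> \<phi> by (auto simp: test_forms_iff)
  have 1: "smooth_compact U (\<lambda>x. \<beta> i (\<psi> x) (\<phi> x))" for i
    by (rule smooth_compact_bilinear[OF s(1) smooth_compact_C_k[OF s(2)] bil])
  have 2: "integrable (lebesgue_on U) (\<lambda>x. \<beta> i (\<psi> x) (partial_deriv i \<phi> x))" for i
    by (rule integrable_smooth_compact[OF _ U], rule smooth_compact_bilinear[OF s(1) _ bil],
        rule smooth_compact_C_k[OF smooth_compact_partial_deriv[OF s(2)]])
  have 3: "integrable (lebesgue_on U) (\<lambda>x. \<beta> i (partial_deriv i \<psi> x) (\<phi> x))" for i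
    by (rule integrable_smooth_compact[OF _ U], rule smooth_compact_bilinear[OF _ _ bil],
        rule smooth_compact_partial_deriv[OF s(1)], rule smooth_compact_C_k[OF s(2)])
  have z: "(LINT x|lebesgue_on U. \<beta> i (\<psi> x) (partial_deriv i \<phi> x)) + (LINT x|lebesgue_on U. \<beta> i (partial_deriv i \<psi> x) (\<phi> x)) = 0" for i
  proof -
    have "0 = (LINT x|lebesgue_on U. partial_deriv i (\<lambda>x. \<beta> i (\<psi> x) (\<phi> x)) x)"
      by (rule integral_partial_deriv[OF 1 U, symmetric])
    also have "\<dots> = (LINT x|lebesgue_on U. \<beta> i (\<psi> x) (partial_deriv i \<phi> x) + \<beta> i (partial_deriv i \<psi> x) (\<phi> x))"
      by (rule Bochner_Integration.integral_cong[OF refl])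
        (rule partial_deriv_bilinear[OF bil smooth_compact_differentiable[OF s(1)] smooth_compact_differentiable[OF s(2)]])
    finally show ?thesis using 2[of i] 3[of i] by simp
  qed
  have L: "wedge (smooth_d \<psi> x) (\<phi> x) $ UNIV = (\<Sum>i\<in>UNIV. \<beta> i (partial_deriv i \<psi> x) (\<phi> x))" for x
    unfolding smooth_d_def \<beta>_def using bounded_bilinear.sum_left[OF bounded_bilinear_wedge_top] by fast
  have R: "wedge (\<psi> x) (smooth_d \<phi> x) $ UNIV = (\<Sum>i\<in>UNIV. (-1) powi j * \<beta> i (\<psi> x) (partial_deriv i \<phi> x))" for x
  proof -
    have "wedge (\<psi> x) (smooth_d \<phi> x) $ UNIV = (\<Sum>i\<in>UNIV. wedge (\<psi> x) (wedge (axis {i} 1) (partial_deriv i \<phi> x)) $ UNIV)"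
      unfolding smooth_d_def using bounded_bilinear.sum_right[OF bounded_bilinear_wedge_top] by fast
    also have "\<dots> = (\<Sum>i\<in>UNIV. (-1) powi j * \<beta> i (\<psi> x) (partial_deriv i \<phi> x))"
      unfolding \<beta>_def wedge_axis_shift[OF d] by (simp add: minus_one_powi)
    finally show ?thesis .
  qed
  have "form_integral U (\<lambda>x. wedge (smooth_d \<psi> x) (\<phi> x)) = (\<Sum>i\<in>UNIV. LINT x|lebesgue_on U. \<beta> i (partial_deriv i \<psi> x) (\<phi> x))"
    unfolding form_integral_def L by (rule Bochner_Integration.integral_sum) (rule 3)
  also have "\<dots> = (\<Sum>i\<in>UNIV. - (LINT x|lebesgue_on U. \<beta> i (\<psi> x) (partial_deriv i \<phi> x)))"
    by (rule sum.cong[OF refl]) (use z in \<open>simp add: eq_neg_iff_add_eq_0 add.commute\<close>)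
  also have "\<dots> = (-1) powi (j + 1) * (\<Sum>i\<in>UNIV. (-1) powi j * (LINT x|lebesgue_on U. \<beta> i (\<psi> x) (partial_deriv i \<phi> x)))"
    by (simp add: minus_one_powi sum_negf)
  also have "\<dots> = (-1) powi (j + 1) * form_integral U (\<lambda>x. wedge (\<psi> x) (smooth_d \<phi> x))"
    unfolding form_integral_def R
    by (subst Bochner_Integration.integral_sum) (auto intro!: integrable_mult_right 2)
  finally show ?thesis .
qed

section \<open>Weak exterior derivative and codifferential\<close>

lemma L2_Pair_iff:
  "(\<lambda>x. (v x, w x)) \<in> L2 M (S \<times> R) \<longleftrightarrow> v \<in> L2 M S \<and> w \<in> L2 M R"
proof
  assume a: "(\<lambda>x. (v x, w x)) \<in> L2 M (S \<times> R)"
  have "(\<lambda>x. fst (v x, w x)) \<in> L2 M S" by (rule L2_linear[OF a bounded_linear_fst]) auto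
  moreover have "(\<lambda>x. snd (v x, w x)) \<in> L2 M R" by (rule L2_linear[OF a bounded_linear_snd]) auto
  ultimately show "v \<in> L2 M S \<and> w \<in> L2 M R" by simp
next
  assume a: "v \<in> L2 M S \<and> w \<in> L2 M R"
  then have [measurable]: "v \<in> borel_measurable M" "w \<in> borel_measurable M" by (auto dest: L2_D)
  have n: "(norm (x, y))\<^sup>2 = (norm x)\<^sup>2 + (norm y)\<^sup>2" for x :: 'b and y :: 'c
    by (simp add: norm_Pair)
  have "AE x in M. v x \<in> S" "AE x in M. w x \<in> R" using a by (auto dest: L2_D)
  then have "AE x in M. (v x, w x) \<in> S \<times> R" by eventually_elim simp
  then show "(\<lambda>x. (v x, w x)) \<in> L2 M (S \<times> R)"
    using a unfolding L2_def by (auto simp: n intro!: borel_measurable_Pair)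
qed

lemma ip_Pair:
  assumes "v \<in> L2 M S" "v' \<in> L2 M S'" "w \<in> L2 M R" "w' \<in> L2 M R'"
  shows "ip M (\<lambda>x. (v x, w x)) (\<lambda>x. (v' x, w' x)) = ip M v v' + ip M w w'"
  using integrable_inner_L2[OF assms(1,2)] integrable_inner_L2[OF assms(3,4)]
  by (simp add: ip_def inner_Pair)

text \<open>The difference of the two sides is continuous in the graph norm and vanishes at the
  approximants; Cauchy-Schwarz bounds its square by a constant times \<open>e\<close>.\<close>

lemma pairing_eq_of_approximation:
  assumes S: "subspace S" "subspace R"
    and ab: "a \<in> L2 M S" "b \<in> L2 M R" and \<eta>c: "\<eta> \<in> L2 M R'" "c \<in> L2 M S'"
    and approx: "\<And>e. e > 0 \<Longrightarrow> \<exists>a'\<in>L2 M S. \<exists>b'\<in>L2 M R. ip M b' \<eta> = ip M a' c \<and>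
      sqn M (\<lambda>x. a x - a' x) + sqn M (\<lambda>x. b x - b' x) < e"
  shows "ip M b \<eta> = ip M a c"
proof -
  define N where "N = ip M \<eta> \<eta> + ip M c c"
  have N: "0 \<le> N" by (simp add: N_def ip_nonneg)
  have bd: "(ip M b \<eta> - ip M a c)\<^sup>2 \<le> e * (2 * N)" if e: "e > 0" for e
  proof -
    obtain a' b' where a': "a' \<in> L2 M S" and b': "b' \<in> L2 M R" and eq: "ip M b' \<eta> = ip M a' c"
      and le: "sqn M (\<lambda>x. a x - a' x) + sqn M (\<lambda>x. b x - b' x) < e"
      using approx[OF e] by blast
    define p q where "p = ip M (\<lambda>x. a x - a' x) c" and "q = ip M (\<lambda>x. b x - b' x) \<eta>"
    have "p = ip M a c - ip M a' c" "q = ip M b \<eta> - ip M b' \<eta>"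
      unfolding p_def q_def by (rule ip_diff_left[OF ab(1) a' \<eta>c(2)], rule ip_diff_left[OF ab(2) b' \<eta>c(1)])
    then have D: "ip M b \<eta> - ip M a c = q - p" using eq by simp
    have "(q - p)\<^sup>2 \<le> 2 * q\<^sup>2 + 2 * p\<^sup>2"
      using zero_le_power2[of "q + p"] by (simp add: power2_eq_square algebra_simps)
    moreover have "p\<^sup>2 \<le> e * ip M c c"
    proof -
      have "p\<^sup>2 \<le> sqn M (\<lambda>x. a x - a' x) * ip M c c"
        unfolding p_def by (rule ip_Cauchy_Schwarz[OF L2_diff[OF S(1) ab(1) a'] \<eta>c(2)])
      also have "\<dots> \<le> e * ip M c c"
        using le ip_nonneg[of M "\<lambda>x. b x - b' x"] by (intro mult_right_mono ip_nonneg) simp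
      finally show ?thesis .
    qed
    moreover have "q\<^sup>2 \<le> e * ip M \<eta> \<eta>"
    proof -
      have "q\<^sup>2 \<le> sqn M (\<lambda>x. b x - b' x) * ip M \<eta> \<eta>"
        unfolding q_def by (rule ip_Cauchy_Schwarz[OF L2_diff[OF S(2) ab(2) b'] \<eta>c(1)])
      also have "\<dots> \<le> e * ip M \<eta> \<eta>"
        using le ip_nonneg[of M "\<lambda>x. a x - a' x"] by (intro mult_right_mono ip_nonneg) simp
      finally show ?thesis .
    qed
    ultimately show ?thesis unfolding D N_def by (simp add: algebra_simps)
  qed
  have "(ip M b \<eta> - ip M a c)\<^sup>2 \<le> 0"
  proof (rule field_le_epsilon)
    fix e :: real assume "e > 0"
    \<comment> \<open>The summand 1 keeps the denominator positive when \<open>\<eta>\<close> and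
      \<open>c\<close> are null.\<close>
    then have "e / (2 * N + 1) > 0" using N by simp
    from bd[OF this] have "(ip M b \<eta> - ip M a c)\<^sup>2 \<le> e * (2 * N / (2 * N + 1))" by simp
    also have "\<dots> \<le> e * 1" using N \<open>e > 0\<close> by (intro mult_left_mono) auto
    finally show "(ip M b \<eta> - ip M a c)\<^sup>2 \<le> 0 + e" by simp
  qed
  then show ?thesis by simp
qed

text \<open>Graph norms are square roots, while the projection argument produces squared
  distances.\<close>

lemma sqrt_less_all_iff:
  "(\<forall>e>0. \<exists>\<phi>\<in>D. sqrt (F \<phi>) < e) \<longleftrightarrow> (\<forall>e>0. \<exists>\<phi>\<in>D. F \<phi> < e)"
proof (intro iffI allI impI)
  fix e :: real assume "\<forall>e>0. \<exists>\<phi>\<in>D. sqrt (F \<phi>) < e" "e > 0"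
  moreover from this have "sqrt e > 0" by simp
  ultimately show "\<exists>\<phi>\<in>D. F \<phi> < e" using real_sqrt_less_iff by blast
next
  fix e :: real assume h: "\<forall>e>0. \<exists>\<phi>\<in>D. F \<phi> < e" and e: "e > 0"
  then obtain \<phi> where "\<phi> \<in> D" "F \<phi> < e\<^sup>2" by (meson zero_less_power)
  then show "\<exists>\<phi>\<in>D. sqrt (F \<phi>) < e" using e real_less_lsqrt[of e] by (intro bexI[of _ \<phi>]) auto
qed

text \<open>The condition on \<open>c\<close> and \<open>\<eta>\<close> says that
  \<open>(c, - \<eta>)\<close> is orthogonal to the graph of \<open>A\<close> on \<open>D\<close>,
  so the right-hand side is membership of \<open>(a, b)\<close> in the second orthogonal complement.
  The operator is left abstract to cover both \<open>smooth_d\<close> and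
  \<open>smooth_codiff\<close>.\<close>

lemma graph_approximation_iff:
  fixes D :: "('a \<Rightarrow> 'b::euclidean_space) set" and A :: "('a \<Rightarrow> 'b) \<Rightarrow> 'a \<Rightarrow> 'c::euclidean_space"
  assumes S: "subspace S" "subspace R"
    and D: "D \<subseteq> L2 M S" "\<And>\<phi>. \<phi> \<in> D \<Longrightarrow> A \<phi> \<in> L2 M R" "(\<lambda>x. 0) \<in> D"
      "\<And>\<phi> \<psi>. \<phi> \<in> D \<Longrightarrow> \<psi> \<in> D \<Longrightarrow> (\<lambda>x. \<phi> x + \<psi> x) \<in> D"
      "\<And>c \<phi>. \<phi> \<in> D \<Longrightarrow> (\<lambda>x. c *\<^sub>R \<phi> x) \<in> D"
    and A: "\<And>\<phi> \<psi>. \<phi> \<in> D \<Longrightarrow> \<psi> \<in> D \<Longrightarrow> A (\<lambda>x. \<phi> x + \<psi> x) = (\<lambda>x. A \<phi> x + A \<psi> x)"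
      "\<And>c \<phi>. \<phi> \<in> D \<Longrightarrow> A (\<lambda>x. c *\<^sub>R \<phi> x) = (\<lambda>x. c *\<^sub>R A \<phi> x)"
    and ab: "a \<in> L2 M S" "b \<in> L2 M R"
  shows "(\<forall>e>0. \<exists>\<phi>\<in>D. sqrt (sqn M (\<lambda>x. a x - \<phi> x) + sqn M (\<lambda>x. b x - A \<phi> x)) < e) \<longleftrightarrow>
    (\<forall>c\<in>L2 M S. \<forall>\<eta>\<in>L2 M R. (\<forall>\<phi>\<in>D. ip M c \<phi> = ip M \<eta> (A \<phi>)) \<longrightarrow> ip M c a = ip M \<eta> b)"
  unfolding sqrt_less_all_iff
proof (intro iffI allI impI ballI)
  fix c \<eta> assume approx: "\<forall>e>0. \<exists>\<phi>\<in>D. sqn M (\<lambda>x. a x - \<phi> x) + sqn M (\<lambda>x. b x - A \<phi> x) < e"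
    and c: "c \<in> L2 M S" and \<eta>: "\<eta> \<in> L2 M R" and eq: "\<forall>\<phi>\<in>D. ip M c \<phi> = ip M \<eta> (A \<phi>)"
  have "ip M b \<eta> = ip M a c"
  proof (rule pairing_eq_of_approximation[OF S ab \<eta> c])
    fix e :: real assume "e > 0"
    then obtain \<phi> where \<phi>: "\<phi> \<in> D" "sqn M (\<lambda>x. a x - \<phi> x) + sqn M (\<lambda>x. b x - A \<phi> x) < e"
      using approx by blast
    moreover have "ip M (A \<phi>) \<eta> = ip M \<phi> c" using eq \<phi>(1) by (simp add: ip_commute)
    ultimately show "\<exists>a'\<in>L2 M S. \<exists>b'\<in>L2 M R. ip M b' \<eta> = ip M a' c \<and>
        sqn M (\<lambda>x. a x - a' x) + sqn M (\<lambda>x. b x - b' x) < e"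
      using D(1,2) by blast
  qed
  then show "ip M c a = ip M \<eta> b" by (simp add: ip_commute)
next
  fix e :: real
  assume orth: "\<forall>c\<in>L2 M S. \<forall>\<eta>\<in>L2 M R. (\<forall>\<phi>\<in>D. ip M c \<phi> = ip M \<eta> (A \<phi>)) \<longrightarrow> ip M c a = ip M \<eta> b"
    and e: "e > 0"
  define G where "G = (\<lambda>\<phi> x. (\<phi> x, A \<phi> x)) ` D"
  have A0: "A (\<lambda>x. 0) = (\<lambda>x. 0)" using A(2)[OF D(3), of 0] by simp
  have "\<exists>\<gamma>\<in>G. sqn M (\<lambda>x. (a x, b x) - \<gamma> x) < e"
  proof (rule double_orthogonal_closure[OF _ _ _ _ _ _ _ e])
    show "subspace (S \<times> R)" by (rule subspace_Times[OF S])
    show "G \<subseteq> L2 M (S \<times> R)" using D by (auto simp: G_def L2_Pair_iff)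
    show "(\<lambda>x. 0) \<in> G" unfolding G_def using D(3) A0 by (intro image_eqI[of _ _ "\<lambda>x. 0"]) (auto simp: zero_prod_def)
    show "(\<lambda>x. \<gamma> x + \<eta> x) \<in> G" if \<gamma>\<eta>: "\<gamma> \<in> G" "\<eta> \<in> G" for \<gamma> \<eta>
    proof -
      obtain \<phi> \<psi> where "\<phi> \<in> D" "\<psi> \<in> D" "\<gamma> = (\<lambda>x. (\<phi> x, A \<phi> x))" "\<eta> = (\<lambda>x. (\<psi> x, A \<psi> x))"
        using \<gamma>\<eta> unfolding G_def by blast
      then show ?thesis unfolding G_def using D(4) A(1) by (intro image_eqI[of _ _ "\<lambda>x. \<phi> x + \<psi> x"]) auto
    qed
    show "(\<lambda>x. c *\<^sub>R \<gamma> x) \<in> G" if \<gamma>: "\<gamma> \<in> G" for c \<gamma>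
    proof -
      obtain \<phi> where "\<phi> \<in> D" "\<gamma> = (\<lambda>x. (\<phi> x, A \<phi> x))" using \<gamma> unfolding G_def by blast
      then show ?thesis unfolding G_def using D(5) A(2) by (intro image_eqI[of _ _ "\<lambda>x. c *\<^sub>R \<phi> x"]) auto
    qed
    show "(\<lambda>x. (a x, b x)) \<in> L2 M (S \<times> R)" using ab by (simp add: L2_Pair_iff)
    show "ip M \<rho> (\<lambda>x. (a x, b x)) = 0" if \<rho>: "\<rho> \<in> L2 M (S \<times> R)" "\<And>\<gamma>. \<gamma> \<in> G \<Longrightarrow> ip M \<rho> \<gamma> = 0" for \<rho>
    proof -
      define r s where "r x = fst (\<rho> x)" and "s x = snd (\<rho> x)" for x
      have \<rho>e: "\<rho> = (\<lambda>x. (r x, s x))" by (simp add: r_def s_def)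
      have rs: "r \<in> L2 M S" "s \<in> L2 M R" using \<rho>(1) unfolding \<rho>e L2_Pair_iff by auto
      \<comment> \<open>The second component of a pair orthogonal to the graph enters the adjoint
        relation with the opposite sign.\<close>
      have ms: "(\<lambda>x. - s x) \<in> L2 M R" using L2_scaleR[OF S(2) rs(2), of "-1"] by simp
      have "ip M r \<phi> = ip M (\<lambda>x. - s x) (A \<phi>)" if "\<phi> \<in> D" for \<phi>
      proof -
        have "ip M (\<lambda>x. (r x, s x)) (\<lambda>x. (\<phi> x, A \<phi> x)) = 0"
          using \<rho>(2) that unfolding \<rho>e G_def by blast
        then show ?thesis using D that by (subst (asm) ip_Pair[OF rs(1) _ rs(2)]) (auto simp: ip_minus_left)
      qed
      then have "ip M r a = ip M (\<lambda>x. - s x) b" using orth rs(1) ms by blast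
      then show ?thesis unfolding \<rho>e using ip_Pair[OF rs(1) ab(1) rs(2) ab(2)] by (simp add: ip_minus_left)
    qed
  qed
  then obtain \<phi> where \<phi>: "\<phi> \<in> D" "sqn M (\<lambda>x. (a x, b x) - (\<phi> x, A \<phi> x)) < e"
    unfolding G_def by auto
  have "(\<lambda>x. a x - \<phi> x) \<in> L2 M S" "(\<lambda>x. b x - A \<phi> x) \<in> L2 M R"
    using D \<phi>(1) ab by (auto intro!: L2_diff S)
  from ip_Pair[OF this(1,1) this(2,2)]
  show "\<exists>\<phi>\<in>D. sqn M (\<lambda>x. a x - \<phi> x) + sqn M (\<lambda>x. b x - A \<phi> x) < e"
    using \<phi> by (intro bexI[of _ \<phi>]) auto
qed

section \<open>Weak derivatives as adjoints in the inner product\<close>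

lemma L2_forms_eq: "L2_forms U j = L2 (lebesgue_on U) (alt_deg j)"
  by (simp add: L2_forms_def L2_def)

lemma L2_inner_eq: "L2_inner U = ip (lebesgue_on U)"
  by (intro ext) (simp add: L2_inner_def form_integral_def ip_def wedge_hodge_top)

text \<open>Test forms with a single coefficient reduce the claim to scalar functions; coefficients
  of the wrong degree vanish already because \<open>w\<close> is homogeneous.\<close>

lemma test_forms_annihilator_eq_0:
  assumes U: "open U" and w: "w \<in> L2_forms U j"
    and ann: "\<And>\<phi>. \<phi> \<in> test_forms U j \<Longrightarrow> L2_inner U w \<phi> = 0"
  shows "AE x in lebesgue_on U. w x = 0"
proof -
  have wL: "w \<in> L2 (lebesgue_on U) (alt_deg j)" using w by (simp add: L2_forms_eq)
  have "AE x in lebesgue_on U. w x $ I = 0" for I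
  proof (cases "int (card I) = j")
    case True
    have "(LINT x|lebesgue_on U. w x $ I * \<zeta> x) = 0" if \<zeta>: "smooth_compact U \<zeta>" for \<zeta>
    proof -
      have "axis I 1 \<in> alt_deg j" using True by (simp add: alt_deg_def axis_def)
      then have "(\<lambda>x. \<zeta> x *\<^sub>R axis I 1) \<in> test_forms U j"
        by (simp add: test_forms_iff smooth_compact_linear[OF \<zeta> bounded_linear_scaleR_left]
            subspace_scale[OF subspace_alt_deg])
      from ann[OF this] show ?thesis by (simp add: L2_inner_eq ip_def inner_axis mult.commute)
    qed
    moreover have "(\<lambda>x. w x $ I) \<in> L2 (lebesgue_on U) UNIV"
      by (rule L2_linear[OF wL bounded_linear_vec_nth]) simp
    ultimately show ?thesis by (intro smooth_annihilator_eq_0[OF U])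
  next
    case False
    show ?thesis using L2_D(3)[OF wL] by eventually_elim (rule alt_deg_D[OF _ False])
  qed
  then have "AE x in lebesgue_on U. \<forall>I. w x $ I = 0" by (simp add: AE_all_countable)
  then show ?thesis by eventually_elim (simp add: vec_eq_iff)
qed

text \<open>The formal adjoint of \<open>smooth_d\<close>, with the sign convention of
  \<open>codiff\<close>.\<close>

definition smooth_codiff :: "int \<Rightarrow> 'n::{finite,linorder} form \<Rightarrow> 'n form" where
  "smooth_codiff j \<psi> x = (-1) powi j *\<^sub>R hodge_inv (smooth_d (\<lambda>y. hodge (\<psi> y)) x)"

lemma smooth_codiff_test_forms:
  fixes \<psi> :: "'n::{finite,linorder} form"
  assumes "\<psi> \<in> test_forms U j"
  shows "smooth_codiff j \<psi> \<in> test_forms U (j - 1)"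
proof -
  have "(\<lambda>x. hodge_inv (smooth_d (\<lambda>y. hodge (\<psi> y)) x)) \<in> test_forms U (int CARD('n) - (int CARD('n) - j + 1))"
    by (intro test_forms_hodge_inv smooth_d_test_forms test_forms_hodge assms)
  from test_forms_scaleR[OF this, of "(-1) powi j"] show ?thesis
    by (simp add: smooth_codiff_def[abs_def] algebra_simps)
qed

lemma smooth_codiff_add:
  assumes "\<phi> \<in> test_forms U j" "\<psi> \<in> test_forms U j"
  shows "smooth_codiff l (\<lambda>x. \<phi> x + \<psi> x) = (\<lambda>x. smooth_codiff l \<phi> x + smooth_codiff l \<psi> x)"
  using smooth_d_add[OF test_forms_hodge[OF assms(1)] test_forms_hodge[OF assms(2)]]
  by (simp add: smooth_codiff_def[abs_def] linear_add[OF bounded_linear.linear[OF bounded_linear_hodge]]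
      linear_add[OF bounded_linear.linear[OF bounded_linear_hodge_inv]] scaleR_add_right)

lemma smooth_codiff_scaleR:
  assumes "\<phi> \<in> test_forms U j"
  shows "smooth_codiff l (\<lambda>x. c *\<^sub>R \<phi> x) = (\<lambda>x. c *\<^sub>R smooth_codiff l \<phi> x)"
  using smooth_d_scaleR[OF test_forms_hodge[OF assms], of c]
  by (simp add: smooth_codiff_def[abs_def] linear_cmul[OF bounded_linear.linear[OF bounded_linear_hodge]]
      linear_cmul[OF bounded_linear.linear[OF bounded_linear_hodge_inv]] mult.commute)

text \<open>The Hodge star is a bijection between the test forms of complementary degrees;
  substituting it for the test form turns wedge products into inner products and absorbs the sign
  into \<open>smooth_codiff\<close>.\<close>

lemma has_weak_d_iff:
  fixes v w :: "'n::{finite,linorder} form"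
  shows "has_weak_d U j v w \<longleftrightarrow>
    (\<forall>\<psi>\<in>test_forms U (j + 1). L2_inner U w \<psi> = L2_inner U v (smooth_codiff (j + 1) \<psi>))"
proof -
  have e: "(form_integral U (\<lambda>x. wedge (w x) (hodge (\<psi> x))) =
     (-1) powi (j + 1) * form_integral U (\<lambda>x. wedge (v x) (smooth_d (\<lambda>x. hodge (\<psi> x)) x))) \<longleftrightarrow>
     L2_inner U w \<psi> = L2_inner U v (smooth_codiff (j + 1) \<psi>)" for \<psi>
  proof -
    have "form_integral U (\<lambda>x. wedge (v x) (smooth_d (\<lambda>x. hodge (\<psi> x)) x)) =
        L2_inner U v (\<lambda>x. hodge_inv (smooth_d (\<lambda>x. hodge (\<psi> x)) x))"
      by (simp add: L2_inner_def hodge_hodge_inv)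
    moreover have "L2_inner U v (smooth_codiff (j + 1) \<psi>) =
        (-1) powi (j + 1) * L2_inner U v (\<lambda>x. hodge_inv (smooth_d (\<lambda>x. hodge (\<psi> x)) x))"
      unfolding smooth_codiff_def[abs_def] L2_inner_eq by (rule ip_scale_right)
    ultimately show ?thesis by (simp add: L2_inner_def)
  qed
  show ?thesis
  proof
    assume h: "has_weak_d U j v w"
    show "\<forall>\<psi>\<in>test_forms U (j + 1). L2_inner U w \<psi> = L2_inner U v (smooth_codiff (j + 1) \<psi>)"
    proof
      fix \<psi> assume "\<psi> \<in> test_forms U (j + 1)"
      from test_forms_hodge[OF this] have "(\<lambda>x. hodge (\<psi> x)) \<in> test_forms U (int CARD('n) - j - 1)"
        by (simp add: algebra_simps)
      from bspec[OF h[unfolded has_weak_d_def] this]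
      show "L2_inner U w \<psi> = L2_inner U v (smooth_codiff (j + 1) \<psi>)"
        unfolding e[symmetric] .
    qed
  next
    assume h: "\<forall>\<psi>\<in>test_forms U (j + 1). L2_inner U w \<psi> = L2_inner U v (smooth_codiff (j + 1) \<psi>)"
    show "has_weak_d U j v w" unfolding has_weak_d_def
    proof
      fix \<phi> :: "'n form" assume "\<phi> \<in> test_forms U (int CARD('n) - j - 1)"
      from test_forms_hodge_inv[OF this] have "(\<lambda>x. hodge_inv (\<phi> x)) \<in> test_forms U (j + 1)"
        by (simp add: algebra_simps)
      with h have "L2_inner U w (\<lambda>x. hodge_inv (\<phi> x)) = L2_inner U v (smooth_codiff (j + 1) (\<lambda>x. hodge_inv (\<phi> x)))"
        by blast
      then show "form_integral U (\<lambda>x. wedge (w x) (\<phi> x)) =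
          (-1) powi (j + 1) * form_integral U (\<lambda>x. wedge (v x) (smooth_d \<phi> x))"
        unfolding e[symmetric] by (simp add: hodge_hodge_inv)
    qed
  qed
qed

text \<open>The codifferential by duality instead of by conjugation with the star: this is the
  relation that a variational equation yields when tested with compactly supported forms.\<close>

definition has_weak_codiff :: "'n region \<Rightarrow> int \<Rightarrow> 'n::{finite,linorder} form \<Rightarrow> 'n form \<Rightarrow> bool" where
  "has_weak_codiff U j \<eta> c \<longleftrightarrow> (\<forall>\<phi>\<in>test_forms U (j - 1). L2_inner U c \<phi> = L2_inner U \<eta> (smooth_d \<phi>))"

text \<open>Links the dual description with the conjugated one underlying \<open>codiff\<close>. The
  star sits on the left factor here, so the degree-dependent signs of
  \<open>wedge_hodge_left_top\<close> appear on both sides.\<close>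

lemma has_weak_d_hodge_iff:
  fixes \<eta> c :: "'n::{finite,linorder} form"
  shows "has_weak_d U (int CARD('n) - j) (\<lambda>x. hodge (\<eta> x)) (\<lambda>x. (-1) powi j *\<^sub>R hodge (c x)) \<longleftrightarrow> has_weak_codiff U j \<eta> c"
proof -
  have "(form_integral U (\<lambda>x. wedge ((-1) powi j *\<^sub>R hodge (c x)) (\<phi> x)) =
     (-1) powi (int CARD('n) - j + 1) * form_integral U (\<lambda>x. wedge (hodge (\<eta> x)) (smooth_d \<phi> x)))
     \<longleftrightarrow> L2_inner U c \<phi> = L2_inner U \<eta> (smooth_d \<phi>)" if \<phi>: "\<phi> \<in> test_forms U (j - 1)" for \<phi>
  proof -
    have d: "\<phi> x \<in> alt_deg (j - 1)" "smooth_d \<phi> x \<in> alt_deg j" for x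
      using \<phi> smooth_d_test_forms[OF \<phi>] by (auto simp: test_forms_iff)
    have "form_integral U (\<lambda>x. wedge ((-1) powi j *\<^sub>R hodge (c x)) (\<phi> x)) =
        (-1) powi j * ((-1) powi ((j - 1) * (int CARD('n) - (j - 1))) * L2_inner U c \<phi>)"
      unfolding form_integral_def L2_inner_eq ip_def
      by (simp add: bounded_bilinear.scaleR_left[OF bounded_bilinear_wedge] wedge_hodge_left_top[OF d(1)])
    moreover have "form_integral U (\<lambda>x. wedge (hodge (\<eta> x)) (smooth_d \<phi> x)) =
        (-1) powi (j * (int CARD('n) - j)) * L2_inner U \<eta> (smooth_d \<phi>)"
      unfolding form_integral_def L2_inner_eq ip_def by (simp add: wedge_hodge_left_top[OF d(2)])
    \<comment> \<open>The exponents j + (j - 1)(n - j + 1) and (n - j + 1) + j(n - j) have the same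
      parity.\<close>
    ultimately show ?thesis
      by (simp only: minus_one_powi) (cases "even j"; cases "even (int CARD('n))"; simp)
  qed
  then show ?thesis
    unfolding has_weak_d_def has_weak_codiff_def by (simp add: ball_def)
qed

lemma ext_d_spec:
  assumes "v \<in> H_d U j"
  shows "ext_d U j v \<in> L2_forms U (j + 1)" "has_weak_d U j v (ext_d U j v)"
  using someI_ex[of "\<lambda>w. w \<in> L2_forms U (j + 1) \<and> has_weak_d U j v w"] assms
  by (auto simp: H_d_def ext_d_def)

lemma H_delta_I:
  fixes \<eta> c :: "'n::{finite,linorder} form"
  assumes "\<eta> \<in> L2_forms U j" "c \<in> L2_forms U (j - 1)" "has_weak_codiff U j \<eta> c"
  shows "\<eta> \<in> H_delta U j"
proof -
  have 1: "(\<lambda>x. hodge (\<eta> x)) \<in> L2_forms U (int CARD('n) - j)"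
    using L2_linear[OF _ bounded_linear_hodge hodge_alt_deg] assms(1) unfolding L2_forms_eq by blast
  have "(\<lambda>x. hodge (c x)) \<in> L2_forms U (int CARD('n) - (j - 1))"
    using L2_linear[OF _ bounded_linear_hodge hodge_alt_deg] assms(2) unfolding L2_forms_eq by blast
  then have "(\<lambda>x. (-1) powi j *\<^sub>R hodge (c x)) \<in> L2_forms U (int CARD('n) - (j - 1))"
    unfolding L2_forms_eq by (intro L2_scaleR subspace_alt_deg)
  then have 2: "(\<lambda>x. (-1) powi j *\<^sub>R hodge (c x)) \<in> L2_forms U (int CARD('n) - j + 1)"
    by (simp add: algebra_simps)
  show ?thesis using 1 2 has_weak_d_hodge_iff assms unfolding H_delta_def H_d_def by blast
qed

lemma codiff_spec:
  fixes \<eta> :: "'n::{finite,linorder} form"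
  assumes "\<eta> \<in> H_delta U j"
  shows "codiff U j \<eta> \<in> L2_forms U (j - 1)" "has_weak_codiff U j \<eta> (codiff U j \<eta>)"
proof -
  define w where "w = ext_d U (int CARD('n) - j) (\<lambda>y. hodge (\<eta> y))"
  have w: "w \<in> L2_forms U (int CARD('n) - j + 1)" "has_weak_d U (int CARD('n) - j) (\<lambda>y. hodge (\<eta> y)) w"
    unfolding w_def using assms by (auto intro!: ext_d_spec simp: H_delta_def)
  have c: "codiff U j \<eta> = (\<lambda>x. (-1) powi j *\<^sub>R hodge_inv (w x))"
    by (simp add: codiff_def inv_hodge w_def)
  have "(\<lambda>x. hodge_inv (w x)) \<in> L2_forms U (int CARD('n) - (int CARD('n) - j + 1))"
    using L2_linear[OF _ bounded_linear_hodge_inv hodge_inv_alt_deg] w(1) unfolding L2_forms_eq by blast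
  from this[unfolded L2_forms_eq] have "codiff U j \<eta> \<in> L2_forms U (int CARD('n) - (int CARD('n) - j + 1))"
    unfolding c L2_forms_eq by (rule L2_scaleR[OF subspace_alt_deg])
  then show "codiff U j \<eta> \<in> L2_forms U (j - 1)" by (simp add: algebra_simps)
  have "w = (\<lambda>x. (-1) powi j *\<^sub>R hodge (codiff U j \<eta> x))"
    unfolding c by (simp add: linear_cmul[OF bounded_linear.linear[OF bounded_linear_hodge]] hodge_hodge_inv minus_one_powi)
  with w(2) show "has_weak_codiff U j \<eta> (codiff U j \<eta>)"
    using has_weak_d_hodge_iff[of U j \<eta> "codiff U j \<eta>"] by simp
qed

lemma H_d_I: "v \<in> L2_forms U j \<Longrightarrow> w \<in> L2_forms U (j + 1) \<Longrightarrow> has_weak_d U j v w \<Longrightarrow> v \<in> H_d U j"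
  by (auto simp: H_d_def)

lemma H_d_L2: "v \<in> H_d U j \<Longrightarrow> v \<in> L2_forms U j"
  by (simp add: H_d_def)

lemma H_delta_L2: "v \<in> H_delta U j \<Longrightarrow> v \<in> L2_forms U j"
  by (simp add: H_delta_def)

text \<open>The difference of two weak derivatives annihilates all test forms. This is how a
  property of the chosen representative \<open>ext_d\<close> is obtained from any explicit
  candidate.\<close>

lemma ext_d_unique:
  assumes U: "open U" and v: "v \<in> H_d U j" and w: "w \<in> L2_forms U (j + 1)" "has_weak_d U j v w"
  shows "AE x in lebesgue_on U. ext_d U j v x = w x"
proof -
  note d = ext_d_spec[OF v]
  have "(\<lambda>x. ext_d U j v x - w x) \<in> L2_forms U (j + 1)"
    using d(1) w(1) unfolding L2_forms_eq by (rule L2_diff[OF subspace_alt_deg])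
  moreover have "L2_inner U (\<lambda>x. ext_d U j v x - w x) \<psi> = 0" if \<psi>: "\<psi> \<in> test_forms U (j + 1)" for \<psi>
    using d w \<psi> ip_diff_left[OF d(1)[unfolded L2_forms_eq] w(1)[unfolded L2_forms_eq] test_forms_L2[OF \<psi> U]]
    unfolding has_weak_d_iff L2_inner_eq by simp
  ultimately have "AE x in lebesgue_on U. ext_d U j v x - w x = 0" by (rule test_forms_annihilator_eq_0[OF U])
  then show ?thesis by simp
qed

lemma codiff_unique:
  assumes U: "open U" and v: "v \<in> H_delta U j" and w: "w \<in> L2_forms U (j - 1)" "has_weak_codiff U j v w"
  shows "AE x in lebesgue_on U. codiff U j v x = w x"
proof -
  note d = codiff_spec[OF v]
  have "(\<lambda>x. codiff U j v x - w x) \<in> L2_forms U (j - 1)"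
    using d(1) w(1) unfolding L2_forms_eq by (rule L2_diff[OF subspace_alt_deg])
  moreover have "L2_inner U (\<lambda>x. codiff U j v x - w x) \<psi> = 0" if \<psi>: "\<psi> \<in> test_forms U (j - 1)" for \<psi>
    using d w \<psi> ip_diff_left[OF d(1)[unfolded L2_forms_eq] w(1)[unfolded L2_forms_eq] test_forms_L2[OF \<psi> U]]
    unfolding has_weak_codiff_def L2_inner_eq by simp
  ultimately have "AE x in lebesgue_on U. codiff U j v x - w x = 0" by (rule test_forms_annihilator_eq_0[OF U])
  then show ?thesis by simp
qed

lemma ip_ext_d_eq:
  assumes "open U" "v \<in> H_d U j" "w \<in> L2_forms U (j + 1)" "has_weak_d U j v w" "\<eta> \<in> L2 (lebesgue_on U) R"
  shows "ip (lebesgue_on U) (ext_d U j v) \<eta> = ip (lebesgue_on U) w \<eta>"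
  using ip_cong_AE[OF ext_d_unique[OF assms(1-4)] AE_I2[of "lebesgue_on U" "\<lambda>x. \<eta> x = \<eta> x"]
    ext_d_spec(1)[OF assms(2), unfolded L2_forms_eq] assms(3)[unfolded L2_forms_eq] assms(5) assms(5)] by simp

lemma ip_codiff_eq:
  assumes "open U" "v \<in> H_delta U j" "w \<in> L2_forms U (j - 1)" "has_weak_codiff U j v w" "\<eta> \<in> L2 (lebesgue_on U) R"
  shows "ip (lebesgue_on U) \<eta> (codiff U j v) = ip (lebesgue_on U) \<eta> w"
  using ip_cong_AE[OF AE_I2[of "lebesgue_on U" "\<lambda>x. \<eta> x = \<eta> x"] codiff_unique[OF assms(1-4)]
     assms(5) assms(5) codiff_spec(1)[OF assms(2), unfolded L2_forms_eq] assms(3)[unfolded L2_forms_eq]] by simp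

lemma test_forms_has_weak_d:
  assumes "open U" "\<phi> \<in> test_forms U j"
  shows "has_weak_d U j \<phi> (smooth_d \<phi>)"
  unfolding has_weak_d_def using wedge_integral_by_parts[OF assms] by blast

lemma inner_smooth_d:
  assumes "open U" "\<phi> \<in> test_forms U j" "\<psi> \<in> test_forms U (j + 1)"
  shows "L2_inner U (smooth_d \<phi>) \<psi> = L2_inner U \<phi> (smooth_codiff (j + 1) \<psi>)"
  using test_forms_has_weak_d[OF assms(1,2)] assms(3) by (simp add: has_weak_d_iff)

section \<open>Restriction to open subsets\<close>

lemma L2_inner_test_form_subset:
  assumes "open U" "open V" "U \<subseteq> V" "\<phi> \<in> test_forms U j"
  shows "L2_inner U w \<phi> = L2_inner V w \<phi>"
proof -
  have "closure {x. \<phi> x \<noteq> 0} \<subseteq> U" using assms(4) by (simp add: test_forms_def)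
  then have s: "\<phi> x \<noteq> 0 \<Longrightarrow> x \<in> U" for x using closure_subset[of "{x. \<phi> x \<noteq> 0}"] by auto
  have \<phi>0: "\<phi> x = 0" if "U \<subseteq> W" "x \<notin> W" for x W using s[of x] that by blast
  have "L2_inner W w \<phi> = (LINT x|lebesgue. w x \<bullet> \<phi> x)" if "open W" "U \<subseteq> W" for W
    unfolding L2_inner_eq ip_def using that \<phi>0
    by (subst integral_restrict_space) (auto intro!: Bochner_Integration.integral_cong simp: indicator_def)
  from this[OF assms(1)] this[OF assms(2,3)] show ?thesis by simp
qed

lemma L2_forms_subset:
  assumes "v \<in> L2_forms V j" "open U" "open V" "U \<subseteq> V"
  shows "v \<in> L2_forms U j"
proof -
  have v: "v \<in> borel_measurable (lebesgue_on V)" "integrable (lebesgue_on V) (\<lambda>x. (norm (v x))\<^sup>2)"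
    "AE x in lebesgue_on V. v x \<in> alt_deg j"
    using assms(1) by (auto simp: L2_forms_def)
  have "lebesgue_on U = restrict_space (lebesgue_on V) U"
    using assms by (simp add: restrict_restrict_space Int_absorb1)
  then have "v \<in> borel_measurable (lebesgue_on U)" using measurable_restrict_space1[OF v(1)] by simp
  moreover have "integrable (lebesgue_on U) (\<lambda>x. (norm (v x))\<^sup>2)"
  proof -
    have "set_integrable lebesgue V (\<lambda>x. (norm (v x))\<^sup>2)"
      using v(2) assms(3) by (simp add: integrable_restrict_space set_integrable_def)
    then have "set_integrable lebesgue U (\<lambda>x. (norm (v x))\<^sup>2)"
      by (rule set_integrable_subset) (use assms in auto)
    then show ?thesis using assms(2) by (simp add: integrable_restrict_space set_integrable_def)
  qed
  moreover have "AE x in lebesgue_on U. v x \<in> alt_deg j"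
    using v(3) assms by (auto simp: AE_restrict_space_iff elim!: eventually_mono)
  ultimately show ?thesis by (simp add: L2_forms_def)
qed

lemma AE_lebesgue_on_subset:
  assumes "AE x in lebesgue_on V. P x" "open U" "open V" "U \<subseteq> V"
  shows "AE x in lebesgue_on U. P x"
  using assms by (auto simp: AE_restrict_space_iff elim!: eventually_mono)

lemma has_weak_d_subset:
  fixes v w :: "'n::{finite,linorder} form"
  assumes "has_weak_d V j v w" "open U" "open V" "U \<subseteq> V"
  shows "has_weak_d U j v w"
  unfolding has_weak_d_iff
proof
  fix \<psi> :: "'n form" assume \<psi>: "\<psi> \<in> test_forms U (j + 1)"
  have 1: "L2_inner U w \<psi> = L2_inner V w \<psi>"
    by (rule L2_inner_test_form_subset[OF assms(2-4) \<psi>])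
  have 2: "L2_inner U v (smooth_codiff (j + 1) \<psi>) = L2_inner V v (smooth_codiff (j + 1) \<psi>)"
    by (rule L2_inner_test_form_subset[OF assms(2-4) smooth_codiff_test_forms[OF \<psi>]])
  have "\<psi> \<in> test_forms V (j + 1)" using \<psi> test_forms_mono[OF assms(4)] by blast
  then show "L2_inner U w \<psi> = L2_inner U v (smooth_codiff (j + 1) \<psi>)"
    unfolding 1 2 using assms(1) by (simp add: has_weak_d_iff)
qed

lemma H_d_subset:
  assumes "v \<in> H_d V j" "open U" "open V" "U \<subseteq> V"
  shows "v \<in> H_d U j" "AE x in lebesgue_on U. ext_d U j v x = ext_d V j v x"
proof -
  note d = ext_d_spec[OF assms(1)]
  have w: "ext_d V j v \<in> L2_forms U (j + 1)" "has_weak_d U j v (ext_d V j v)"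
    using L2_forms_subset[OF d(1) assms(2-4)] has_weak_d_subset[OF d(2) assms(2-4)] by auto
  show v: "v \<in> H_d U j" using H_d_I[OF L2_forms_subset[OF H_d_L2[OF assms(1)] assms(2-4)] w] .
  show "AE x in lebesgue_on U. ext_d U j v x = ext_d V j v x" by (rule ext_d_unique[OF assms(2) v w])
qed

section \<open>Linearity and the kernels of the pairing on an open set\<close>

context
  fixes U :: "'n::{finite,linorder} region"
  assumes U: "open U"
begin

lemma has_weak_d_add_scaleR:
  assumes "v \<in> L2_forms U j" "v' \<in> L2_forms U j" "w \<in> L2_forms U (j + 1)" "w' \<in> L2_forms U (j + 1)"
    and "has_weak_d U j v w" "has_weak_d U j v' w'"
  shows "has_weak_d U j (\<lambda>x. v x + c *\<^sub>R v' x) (\<lambda>x. w x + c *\<^sub>R w' x)"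
  unfolding has_weak_d_iff
proof
  fix \<psi> :: "'n form" assume \<psi>: "\<psi> \<in> test_forms U (j + 1)"
  note L = assms(1-4)[unfolded L2_forms_eq]
  note t = test_forms_L2[OF \<psi> U] test_forms_L2[OF smooth_codiff_test_forms[OF \<psi>] U]
  show "L2_inner U (\<lambda>x. w x + c *\<^sub>R w' x) \<psi> = L2_inner U (\<lambda>x. v x + c *\<^sub>R v' x) (smooth_codiff (j + 1) \<psi>)"
    using assms(5,6) \<psi> unfolding has_weak_d_iff L2_inner_eq
      ip_add_left[OF L(3) L2_scaleR[OF subspace_alt_deg L(4)] t(1)]
      ip_add_left[OF L(1) L2_scaleR[OF subspace_alt_deg L(2)] t(2)] ip_scale_left by simp
qed

lemma has_weak_codiff_add_scaleR:
  assumes "v \<in> L2_forms U j" "v' \<in> L2_forms U j" "w \<in> L2_forms U (j - 1)" "w' \<in> L2_forms U (j - 1)"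
    and "has_weak_codiff U j v w" "has_weak_codiff U j v' w'"
  shows "has_weak_codiff U j (\<lambda>x. v x + c *\<^sub>R v' x) (\<lambda>x. w x + c *\<^sub>R w' x)"
  unfolding has_weak_codiff_def
proof
  fix \<psi> :: "'n form" assume \<psi>: "\<psi> \<in> test_forms U (j - 1)"
  note L = assms(1-4)[unfolded L2_forms_eq]
  note t = test_forms_L2[OF \<psi> U] test_forms_L2[OF smooth_d_test_forms[OF \<psi>] U]
  show "L2_inner U (\<lambda>x. w x + c *\<^sub>R w' x) \<psi> = L2_inner U (\<lambda>x. v x + c *\<^sub>R v' x) (smooth_d \<psi>)"
    using assms(5,6) \<psi> unfolding has_weak_codiff_def L2_inner_eq
      ip_add_left[OF L(3) L2_scaleR[OF subspace_alt_deg L(4)] t(1)]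
      ip_add_left[OF L(1) L2_scaleR[OF subspace_alt_deg L(2)] t(2)] ip_scale_left by simp
qed

lemma L2_forms_add_scaleR:
  "v \<in> L2_forms U j \<Longrightarrow> w \<in> L2_forms U j \<Longrightarrow> (\<lambda>x. v x + c *\<^sub>R w x) \<in> L2_forms U j"
  unfolding L2_forms_eq by (intro L2_add L2_scaleR subspace_alt_deg)

lemma H_d_add_scaleR:
  assumes "v \<in> H_d U j" "w \<in> H_d U j"
  shows "(\<lambda>x. v x + c *\<^sub>R w x) \<in> H_d U j"
    "AE x in lebesgue_on U. ext_d U j (\<lambda>x. v x + c *\<^sub>R w x) x = ext_d U j v x + c *\<^sub>R ext_d U j w x"
proof -
  note d = ext_d_spec[OF assms(1)] ext_d_spec[OF assms(2)]
  note L = H_d_L2[OF assms(1)] H_d_L2[OF assms(2)]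
  have h: "(\<lambda>x. ext_d U j v x + c *\<^sub>R ext_d U j w x) \<in> L2_forms U (j + 1)"
    "has_weak_d U j (\<lambda>x. v x + c *\<^sub>R w x) (\<lambda>x. ext_d U j v x + c *\<^sub>R ext_d U j w x)"
    by (rule L2_forms_add_scaleR[OF d(1,3)], rule has_weak_d_add_scaleR[OF L d(1,3) d(2,4)])
  show H: "(\<lambda>x. v x + c *\<^sub>R w x) \<in> H_d U j" by (rule H_d_I[OF L2_forms_add_scaleR[OF L] h])
  show "AE x in lebesgue_on U. ext_d U j (\<lambda>x. v x + c *\<^sub>R w x) x = ext_d U j v x + c *\<^sub>R ext_d U j w x"
    by (rule ext_d_unique[OF U H h])
qed

lemma H_delta_add_scaleR:
  assumes "v \<in> H_delta U j" "w \<in> H_delta U j"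
  shows "(\<lambda>x. v x + c *\<^sub>R w x) \<in> H_delta U j"
    "AE x in lebesgue_on U. codiff U j (\<lambda>x. v x + c *\<^sub>R w x) x = codiff U j v x + c *\<^sub>R codiff U j w x"
proof -
  note d = codiff_spec[OF assms(1)] codiff_spec[OF assms(2)]
  note L = H_delta_L2[OF assms(1)] H_delta_L2[OF assms(2)]
  have h: "(\<lambda>x. codiff U j v x + c *\<^sub>R codiff U j w x) \<in> L2_forms U (j - 1)"
    "has_weak_codiff U j (\<lambda>x. v x + c *\<^sub>R w x) (\<lambda>x. codiff U j v x + c *\<^sub>R codiff U j w x)"
    by (rule L2_forms_add_scaleR[OF d(1,3)], rule has_weak_codiff_add_scaleR[OF L d(1,3) d(2,4)])
  show H: "(\<lambda>x. v x + c *\<^sub>R w x) \<in> H_delta U j" by (rule H_delta_I[OF L2_forms_add_scaleR[OF L] h])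
  show "AE x in lebesgue_on U. codiff U j (\<lambda>x. v x + c *\<^sub>R w x) x = codiff U j v x + c *\<^sub>R codiff U j w x"
    by (rule codiff_unique[OF U H h])
qed

lemma H_d_diff:
  assumes "v \<in> H_d U j" "w \<in> H_d U j"
  shows "(\<lambda>x. v x - w x) \<in> H_d U j"
    "AE x in lebesgue_on U. ext_d U j (\<lambda>x. v x - w x) x = ext_d U j v x - ext_d U j w x"
  using H_d_add_scaleR[OF assms, of "-1"] by simp_all

lemma H_delta_diff:
  assumes "v \<in> H_delta U j" "w \<in> H_delta U j"
  shows "(\<lambda>x. v x - w x) \<in> H_delta U j"
    "AE x in lebesgue_on U. codiff U j (\<lambda>x. v x - w x) x = codiff U j v x - codiff U j w x"
  using H_delta_add_scaleR[OF assms, of "-1"] by simp_all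

lemma test_forms_H_d:
  assumes "\<phi> \<in> test_forms U j"
  shows "\<phi> \<in> H_d U j" "AE x in lebesgue_on U. ext_d U j \<phi> x = smooth_d \<phi> x"
proof -
  have d: "smooth_d \<phi> \<in> L2_forms U (j + 1)" "\<phi> \<in> L2_forms U j"
    using test_forms_L2[OF smooth_d_test_forms[OF assms] U] test_forms_L2[OF assms U] by (simp_all add: L2_forms_eq)
  show "\<phi> \<in> H_d U j" by (rule H_d_I[OF d(2,1) test_forms_has_weak_d[OF U assms]])
  then show "AE x in lebesgue_on U. ext_d U j \<phi> x = smooth_d \<phi> x"
    by (rule ext_d_unique[OF U _ d(1) test_forms_has_weak_d[OF U assms]])
qed

text \<open>The larger set \<open>V\<close> is for test forms on the whole domain, which need not be
  compactly supported in a single element \<open>U\<close> and may have a nonzero normal trace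
  there.\<close>

lemma test_forms_has_weak_codiff:
  assumes "\<psi> \<in> test_forms V j" "U \<subseteq> V" "open V"
  shows "has_weak_codiff U j \<psi> (smooth_codiff j \<psi>)"
  unfolding has_weak_codiff_def
proof
  fix \<phi> :: "'n form" assume \<phi>: "\<phi> \<in> test_forms U (j - 1)"
  then have \<phi>V: "\<phi> \<in> test_forms V (j - 1)" using test_forms_mono[OF assms(2)] by blast
  have "L2_inner V (smooth_d \<phi>) \<psi> = L2_inner V \<phi> (smooth_codiff j \<psi>)"
    using inner_smooth_d[OF assms(3) \<phi>V] assms(1) by simp
  then have "L2_inner V \<psi> (smooth_d \<phi>) = L2_inner V (smooth_codiff j \<psi>) \<phi>"
    unfolding L2_inner_eq by (simp add: ip_commute)
  moreover have "L2_inner U \<psi> (smooth_d \<phi>) = L2_inner V \<psi> (smooth_d \<phi>)"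
    by (rule L2_inner_test_form_subset[OF U assms(3,2) smooth_d_test_forms[OF \<phi>]])
  ultimately show "L2_inner U (smooth_codiff j \<psi>) \<phi> = L2_inner U \<psi> (smooth_d \<phi>)"
    using L2_inner_test_form_subset[OF U assms(3,2) \<phi>] by simp
qed

lemma test_forms_H_delta:
  assumes "\<psi> \<in> test_forms V j" "U \<subseteq> V" "open V"
  shows "\<psi> \<in> H_delta U j" "AE x in lebesgue_on U. codiff U j \<psi> x = smooth_codiff j \<psi> x"
proof -
  have d: "smooth_codiff j \<psi> \<in> L2_forms U (j - 1)" "\<psi> \<in> L2_forms U j"
    using test_forms_L2[OF smooth_codiff_test_forms[OF assms(1)] U] test_forms_L2[OF assms(1) U]
    by (simp_all add: L2_forms_eq)
  show "\<psi> \<in> H_delta U j" by (rule H_delta_I[OF d(2,1) test_forms_has_weak_codiff[OF assms]])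
  then show "AE x in lebesgue_on U. codiff U j \<psi> x = smooth_codiff j \<psi> x"
    by (rule codiff_unique[OF U _ d(1) test_forms_has_weak_codiff[OF assms]])
qed

lemma L2_norm_cong_AE:
  assumes "AE x in lebesgue_on U. v x = w x" "v \<in> L2_forms U j" "w \<in> L2_forms U i"
  shows "L2_inner U v v = L2_inner U w w"
  using assms unfolding L2_inner_eq L2_forms_eq by (intro ip_cong_AE)

text \<open>The graph norm refers to a choice of derivative for the difference; replacing it by the
  difference of derivatives gives the form required by
  \<open>graph_approximation_iff\<close>.\<close>

lemma norm_d_diff_test_form:
  assumes "v \<in> H_d U j" "\<phi> \<in> test_forms U j"
  shows "norm_d U j (\<lambda>x. v x - \<phi> x) = sqrt (L2_inner U (\<lambda>x. v x - \<phi> x) (\<lambda>x. v x - \<phi> x)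
    + L2_inner U (\<lambda>x. ext_d U j v x - smooth_d \<phi> x) (\<lambda>x. ext_d U j v x - smooth_d \<phi> x))"
proof -
  note H = H_d_diff[OF assms(1) test_forms_H_d(1)[OF assms(2)]]
  have "AE x in lebesgue_on U. ext_d U j (\<lambda>x. v x - \<phi> x) x = ext_d U j v x - smooth_d \<phi> x"
    using H(2) test_forms_H_d(2)[OF assms(2)] by eventually_elim simp
  moreover have "(\<lambda>x. ext_d U j v x - smooth_d \<phi> x) \<in> L2_forms U (j + 1)"
    using ext_d_spec(1)[OF assms(1)] test_forms_L2[OF smooth_d_test_forms[OF assms(2)] U]
    unfolding L2_forms_eq by (rule L2_diff[OF subspace_alt_deg])
  ultimately show ?thesis
    unfolding norm_d_def using L2_norm_cong_AE[OF _ ext_d_spec(1)[OF H(1)]] by simp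
qed

lemma norm_delta_diff_test_form:
  assumes "v \<in> H_delta U j" "\<phi> \<in> test_forms U j"
  shows "norm_delta U j (\<lambda>x. v x - \<phi> x) = sqrt (L2_inner U (\<lambda>x. v x - \<phi> x) (\<lambda>x. v x - \<phi> x)
    + L2_inner U (\<lambda>x. codiff U j v x - smooth_codiff j \<phi> x) (\<lambda>x. codiff U j v x - smooth_codiff j \<phi> x))"
proof -
  note t = test_forms_H_delta[OF assms(2) order_refl U]
  note H = H_delta_diff[OF assms(1) t(1)]
  have "AE x in lebesgue_on U. codiff U j (\<lambda>x. v x - \<phi> x) x = codiff U j v x - smooth_codiff j \<phi> x"
    using H(2) t(2) by eventually_elim simp
  moreover have "(\<lambda>x. codiff U j v x - smooth_codiff j \<phi> x) \<in> L2_forms U (j - 1)"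
    using codiff_spec(1)[OF assms(1)] test_forms_L2[OF smooth_codiff_test_forms[OF assms(2)] U]
    unfolding L2_forms_eq by (rule L2_diff[OF subspace_alt_deg])
  ultimately show ?thesis
    unfolding norm_delta_def using L2_norm_cong_AE[OF _ codiff_spec(1)[OF H(1)]] by simp
qed

lemma H_d0_iff:
  assumes v: "v \<in> H_d U j"
  shows "v \<in> H_d0 U j \<longleftrightarrow> (\<forall>\<eta>\<in>H_delta U (j + 1). L2_inner U (ext_d U j v) \<eta> = L2_inner U v (codiff U (j + 1) \<eta>))"
proof -
  let ?M = "lebesgue_on U"
  note vL = H_d_L2[OF v, unfolded L2_forms_eq] and dL = ext_d_spec(1)[OF v, unfolded L2_forms_eq]
  have "v \<in> H_d0 U j \<longleftrightarrow> (\<forall>e>0. \<exists>\<phi>\<in>test_forms U j.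
      sqrt (sqn ?M (\<lambda>x. v x - \<phi> x) + sqn ?M (\<lambda>x. ext_d U j v x - smooth_d \<phi> x)) < e)"
    using v norm_d_diff_test_form[OF v] by (simp add: H_d0_def L2_inner_eq cong: bex_cong)
  also have "\<dots> \<longleftrightarrow> (\<forall>c\<in>L2 ?M (alt_deg j). \<forall>\<eta>\<in>L2 ?M (alt_deg (j + 1)).
      (\<forall>\<phi>\<in>test_forms U j. ip ?M c \<phi> = ip ?M \<eta> (smooth_d \<phi>)) \<longrightarrow> ip ?M c v = ip ?M \<eta> (ext_d U j v))"
    by (rule graph_approximation_iff[OF subspace_alt_deg subspace_alt_deg _ _ _ _ _ _ _ vL dL])
      (auto simp: test_forms_zero test_forms_add test_forms_scaleR smooth_d_add smooth_d_scaleR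
        intro: test_forms_L2[OF _ U] smooth_d_test_forms)
  also have "\<dots> \<longleftrightarrow> (\<forall>\<eta>\<in>H_delta U (j + 1). L2_inner U (ext_d U j v) \<eta> = L2_inner U v (codiff U (j + 1) \<eta>))"
  proof (intro iffI ballI impI)
    fix \<eta> assume h: "\<forall>c\<in>L2 ?M (alt_deg j). \<forall>\<eta>\<in>L2 ?M (alt_deg (j + 1)).
      (\<forall>\<phi>\<in>test_forms U j. ip ?M c \<phi> = ip ?M \<eta> (smooth_d \<phi>)) \<longrightarrow> ip ?M c v = ip ?M \<eta> (ext_d U j v)"
      and \<eta>: "\<eta> \<in> H_delta U (j + 1)"
    have "ip ?M (codiff U (j + 1) \<eta>) v = ip ?M \<eta> (ext_d U j v)"
      using h codiff_spec[OF \<eta>] H_delta_L2[OF \<eta>] by (simp add: has_weak_codiff_def L2_forms_eq L2_inner_eq)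
    then show "L2_inner U (ext_d U j v) \<eta> = L2_inner U v (codiff U (j + 1) \<eta>)"
      by (simp add: L2_inner_eq ip_commute)
  next
    fix c \<eta> assume h: "\<forall>\<eta>\<in>H_delta U (j + 1). L2_inner U (ext_d U j v) \<eta> = L2_inner U v (codiff U (j + 1) \<eta>)"
      and c: "c \<in> L2 ?M (alt_deg j)" and \<eta>: "\<eta> \<in> L2 ?M (alt_deg (j + 1))"
      and w: "\<forall>\<phi>\<in>test_forms U j. ip ?M c \<phi> = ip ?M \<eta> (smooth_d \<phi>)"
    have w': "has_weak_codiff U (j + 1) \<eta> c" using w by (simp add: has_weak_codiff_def L2_inner_eq)
    have H: "\<eta> \<in> H_delta U (j + 1)" using H_delta_I[OF _ _ w'] \<eta> c by (simp add: L2_forms_eq)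
    show "ip ?M c v = ip ?M \<eta> (ext_d U j v)"
      using bspec[OF h H] ip_codiff_eq[OF U H _ w' vL] c by (simp add: L2_inner_eq L2_forms_eq ip_commute)
  qed
  finally show ?thesis .
qed

lemma H_delta0_iff:
  assumes v: "v \<in> H_delta U (j + 1)"
  shows "v \<in> H_delta0 U (j + 1) \<longleftrightarrow> (\<forall>w\<in>H_d U j. L2_inner U (ext_d U j w) v = L2_inner U w (codiff U (j + 1) v))"
proof -
  let ?M = "lebesgue_on U"
  have vL: "v \<in> L2 ?M (alt_deg (j + 1))" and dL: "codiff U (j + 1) v \<in> L2 ?M (alt_deg j)"
    using H_delta_L2[OF v] codiff_spec(1)[OF v] by (simp_all add: L2_forms_eq)
  have "v \<in> H_delta0 U (j + 1) \<longleftrightarrow> (\<forall>e>0. \<exists>\<phi>\<in>test_forms U (j + 1).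
      sqrt (sqn ?M (\<lambda>x. v x - \<phi> x) + sqn ?M (\<lambda>x. codiff U (j + 1) v x - smooth_codiff (j + 1) \<phi> x)) < e)"
    using v norm_delta_diff_test_form[OF v] by (simp add: H_delta0_def L2_inner_eq cong: bex_cong)
  also have "\<dots> \<longleftrightarrow> (\<forall>c\<in>L2 ?M (alt_deg (j + 1)). \<forall>w\<in>L2 ?M (alt_deg j).
      (\<forall>\<phi>\<in>test_forms U (j + 1). ip ?M c \<phi> = ip ?M w (smooth_codiff (j + 1) \<phi>)) \<longrightarrow> ip ?M c v = ip ?M w (codiff U (j + 1) v))"
    by (rule graph_approximation_iff[OF subspace_alt_deg subspace_alt_deg _ _ _ _ _ _ _ vL dL])
      (use smooth_codiff_test_forms[of _ U "j + 1"] in \<open>auto simp: test_forms_zero test_forms_add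
        test_forms_scaleR smooth_codiff_add smooth_codiff_scaleR intro: test_forms_L2[OF _ U]\<close>)
  also have "\<dots> \<longleftrightarrow> (\<forall>w\<in>H_d U j. L2_inner U (ext_d U j w) v = L2_inner U w (codiff U (j + 1) v))"
  proof (intro iffI ballI impI)
    fix w assume h: "\<forall>c\<in>L2 ?M (alt_deg (j + 1)). \<forall>w\<in>L2 ?M (alt_deg j).
      (\<forall>\<phi>\<in>test_forms U (j + 1). ip ?M c \<phi> = ip ?M w (smooth_codiff (j + 1) \<phi>)) \<longrightarrow> ip ?M c v = ip ?M w (codiff U (j + 1) v)"
      and w: "w \<in> H_d U j"
    show "L2_inner U (ext_d U j w) v = L2_inner U w (codiff U (j + 1) v)"
      using h ext_d_spec[OF w] H_d_L2[OF w] by (simp add: has_weak_d_iff L2_forms_eq L2_inner_eq)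
  next
    fix c w assume h: "\<forall>w\<in>H_d U j. L2_inner U (ext_d U j w) v = L2_inner U w (codiff U (j + 1) v)"
      and c: "c \<in> L2 ?M (alt_deg (j + 1))" and w: "w \<in> L2 ?M (alt_deg j)"
      and d: "\<forall>\<phi>\<in>test_forms U (j + 1). ip ?M c \<phi> = ip ?M w (smooth_codiff (j + 1) \<phi>)"
    have d': "has_weak_d U j w c" using d by (simp add: has_weak_d_iff L2_inner_eq)
    have cL: "c \<in> L2_forms U (j + 1)" using c by (simp add: L2_forms_eq)
    have H: "w \<in> H_d U j" using H_d_I[OF _ cL d'] w by (simp add: L2_forms_eq)
    show "ip ?M c v = ip ?M w (codiff U (j + 1) v)"
      using bspec[OF h H] ip_ext_d_eq[OF U H cL d' vL] by (simp add: L2_inner_eq)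
  qed
  finally show ?thesis .
qed

end

section \<open>Traces\<close>

text \<open>The boundary pairing on representatives, free of the choice made in
  \<open>trace_pair\<close>.\<close>

definition trace_form :: "'n region \<Rightarrow> int \<Rightarrow> 'n::{finite,linorder} form \<Rightarrow> 'n form \<Rightarrow> real" where
  "trace_form U j v \<eta> = L2_inner U (ext_d U j v) \<eta> - L2_inner U v (codiff U (j + 1) \<eta>)"

context
  fixes U :: "'n::{finite,linorder} region"
  assumes U: "open U"
begin

lemma trace_form_diff_left:
  assumes "v \<in> H_d U j" "w \<in> H_d U j" "\<eta> \<in> H_delta U (j + 1)"
  shows "trace_form U j (\<lambda>x. v x - w x) \<eta> = trace_form U j v \<eta> - trace_form U j w \<eta>"
proof -
  have L: "v \<in> L2 (lebesgue_on U) (alt_deg j)" "w \<in> L2 (lebesgue_on U) (alt_deg j)"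
    "\<eta> \<in> L2 (lebesgue_on U) (alt_deg (j + 1))" "codiff U (j + 1) \<eta> \<in> L2 (lebesgue_on U) (alt_deg j)"
    "ext_d U j v \<in> L2 (lebesgue_on U) (alt_deg (j + 1))" "ext_d U j w \<in> L2 (lebesgue_on U) (alt_deg (j + 1))"
    using H_d_L2[OF assms(1)] H_d_L2[OF assms(2)] H_delta_L2[OF assms(3)] codiff_spec(1)[OF assms(3)]
      ext_d_spec(1)[OF assms(1)] ext_d_spec(1)[OF assms(2)] by (simp_all add: L2_forms_eq)
  note H = H_d_diff[OF U assms(1,2)]
  have "ip (lebesgue_on U) (ext_d U j (\<lambda>x. v x - w x)) \<eta> = ip (lebesgue_on U) (\<lambda>x. ext_d U j v x - ext_d U j w x) \<eta>"
    using ip_cong_AE[OF H(2) AE_I2[of "lebesgue_on U" "\<lambda>x. \<eta> x = \<eta> x"]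
        ext_d_spec(1)[OF H(1), unfolded L2_forms_eq] L2_diff[OF subspace_alt_deg L(5,6)] L(3) L(3)] by simp
  then show ?thesis
    unfolding trace_form_def L2_inner_eq ip_diff_left[OF L(1,2,4)] ip_diff_left[OF L(5,6,3)] by simp
qed

lemma trace_form_diff_right:
  assumes "v \<in> H_d U j" "\<eta> \<in> H_delta U (j + 1)" "\<zeta> \<in> H_delta U (j + 1)"
  shows "trace_form U j v (\<lambda>x. \<eta> x - \<zeta> x) = trace_form U j v \<eta> - trace_form U j v \<zeta>"
proof -
  have L: "v \<in> L2 (lebesgue_on U) (alt_deg j)" "ext_d U j v \<in> L2 (lebesgue_on U) (alt_deg (j + 1))"
    "\<eta> \<in> L2 (lebesgue_on U) (alt_deg (j + 1))" "\<zeta> \<in> L2 (lebesgue_on U) (alt_deg (j + 1))"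
    "codiff U (j + 1) \<eta> \<in> L2 (lebesgue_on U) (alt_deg j)" "codiff U (j + 1) \<zeta> \<in> L2 (lebesgue_on U) (alt_deg j)"
    using H_d_L2[OF assms(1)] H_delta_L2[OF assms(2)] H_delta_L2[OF assms(3)] codiff_spec(1)[OF assms(2)]
      codiff_spec(1)[OF assms(3)] ext_d_spec(1)[OF assms(1)] by (simp_all add: L2_forms_eq)
  note H = H_delta_diff[OF U assms(2,3)]
  have cL: "codiff U (j + 1) (\<lambda>x. \<eta> x - \<zeta> x) \<in> L2 (lebesgue_on U) (alt_deg j)"
    using codiff_spec(1)[OF H(1)] by (simp add: L2_forms_eq)
  have "ip (lebesgue_on U) v (codiff U (j + 1) (\<lambda>x. \<eta> x - \<zeta> x)) = ip (lebesgue_on U) v (\<lambda>x. codiff U (j + 1) \<eta> x - codiff U (j + 1) \<zeta> x)"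
    using ip_cong_AE[OF AE_I2[of "lebesgue_on U" "\<lambda>x. v x = v x"] H(2) L(1) L(1) cL
        L2_diff[OF subspace_alt_deg L(5,6)]] by simp
  then show ?thesis
    unfolding trace_form_def L2_inner_eq ip_diff_right[OF L(3,4,2)] ip_diff_right[OF L(5,6,1)] by simp
qed

text \<open>By bilinearity and \<open>H_d0_iff\<close>, a coset is determined by the functional it
  induces on \<open>H_delta\<close>; questions about traces become identities for
  \<open>trace_form\<close>.\<close>

lemma tan_trace_eq:
  assumes "v \<in> H_d U j"
  shows "tan_trace U j v = {w \<in> H_d U j. \<forall>\<eta>\<in>H_delta U (j + 1). trace_form U j w \<eta> = trace_form U j v \<eta>}"
proof -
  have "(\<lambda>x. w x - v x) \<in> H_d0 U j \<longleftrightarrow> (\<forall>\<eta>\<in>H_delta U (j + 1). trace_form U j w \<eta> = trace_form U j v \<eta>)"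
    if w: "w \<in> H_d U j" for w
    unfolding H_d0_iff[OF U H_d_diff(1)[OF U w assms]]
    using trace_form_diff_left[OF w assms] by (auto simp: trace_form_def)
  then show ?thesis unfolding tan_trace_def by blast
qed

lemma nor_trace_eq:
  assumes "\<eta> \<in> H_delta U (j + 1)"
  shows "nor_trace U (j + 1) \<eta> = {\<zeta> \<in> H_delta U (j + 1). \<forall>v\<in>H_d U j. trace_form U j v \<zeta> = trace_form U j v \<eta>}"
proof -
  have "(\<lambda>x. \<zeta> x - \<eta> x) \<in> H_delta0 U (j + 1) \<longleftrightarrow> (\<forall>v\<in>H_d U j. trace_form U j v \<zeta> = trace_form U j v \<eta>)"
    if \<zeta>: "\<zeta> \<in> H_delta U (j + 1)" for \<zeta>
    unfolding H_delta0_iff[OF U H_delta_diff(1)[OF U \<zeta> assms]]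
    using trace_form_diff_right[OF _ \<zeta> assms] by (auto simp: trace_form_def)
  then show ?thesis unfolding nor_trace_def by blast
qed

lemma tan_trace_eq_iff:
  assumes "v \<in> H_d U j" "w \<in> H_d U j"
  shows "tan_trace U j v = tan_trace U j w \<longleftrightarrow> (\<forall>\<eta>\<in>H_delta U (j + 1). trace_form U j v \<eta> = trace_form U j w \<eta>)"
proof
  assume "tan_trace U j v = tan_trace U j w"
  moreover have "v \<in> tan_trace U j v" using assms by (simp add: tan_trace_eq)
  ultimately show "\<forall>\<eta>\<in>H_delta U (j + 1). trace_form U j v \<eta> = trace_form U j w \<eta>"
    using assms by (simp add: tan_trace_eq)
qed (use assms in \<open>simp add: tan_trace_eq\<close>)

lemma nor_trace_eq_iff:
  assumes "\<eta> \<in> H_delta U (j + 1)" "\<zeta> \<in> H_delta U (j + 1)"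
  shows "nor_trace U (j + 1) \<eta> = nor_trace U (j + 1) \<zeta> \<longleftrightarrow> (\<forall>v\<in>H_d U j. trace_form U j v \<eta> = trace_form U j v \<zeta>)"
proof
  assume "nor_trace U (j + 1) \<eta> = nor_trace U (j + 1) \<zeta>"
  moreover have "\<eta> \<in> nor_trace U (j + 1) \<eta>" using assms by (simp add: nor_trace_eq)
  ultimately show "\<forall>v\<in>H_d U j. trace_form U j v \<eta> = trace_form U j v \<zeta>"
    using assms by (simp add: nor_trace_eq)
qed (use assms in \<open>simp add: nor_trace_eq\<close>)

text \<open>The representatives picked by choice lie in the two cosets, and membership there fixes
  every value of \<open>trace_form\<close>; they are exchanged one at a time.\<close>

lemma trace_pair_eq_trace_form:
  assumes "v \<in> H_d U j" "\<eta> \<in> H_delta U (j + 1)"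
  shows "trace_pair U j (tan_trace U j v) (nor_trace U (j + 1) \<eta>) = trace_form U j v \<eta>"
proof -
  define v' where "v' = (SOME w. w \<in> tan_trace U j v)"
  define \<eta>' where "\<eta>' = (SOME \<zeta>. \<zeta> \<in> nor_trace U (j + 1) \<eta>)"
  have "v \<in> tan_trace U j v" using assms by (simp add: tan_trace_eq)
  then have "v' \<in> tan_trace U j v" unfolding v'_def by (rule someI[where P="\<lambda>w. w \<in> tan_trace U j v"])
  then have v': "v' \<in> H_d U j" "\<And>\<zeta>. \<zeta> \<in> H_delta U (j + 1) \<Longrightarrow> trace_form U j v' \<zeta> = trace_form U j v \<zeta>"
    using assms by (auto simp: tan_trace_eq)
  have "\<eta> \<in> nor_trace U (j + 1) \<eta>" using assms by (simp add: nor_trace_eq)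
  then have "\<eta>' \<in> nor_trace U (j + 1) \<eta>" unfolding \<eta>'_def by (rule someI[where P="\<lambda>\<zeta>. \<zeta> \<in> nor_trace U (j + 1) \<eta>"])
  then have \<eta>': "\<eta>' \<in> H_delta U (j + 1)" "\<And>w. w \<in> H_d U j \<Longrightarrow> trace_form U j w \<eta>' = trace_form U j w \<eta>"
    using assms by (auto simp: nor_trace_eq)
  have "trace_pair U j (tan_trace U j v) (nor_trace U (j + 1) \<eta>) = trace_form U j v' \<eta>'"
    unfolding trace_pair_def Let_def v'_def[symmetric] \<eta>'_def[symmetric] trace_form_def ..
  then show ?thesis using v' \<eta>' assms by simp
qed

text \<open>Gives meaning to the trace differences in (d) and (e). For the inclusion from right to
  left, \<open>z\<close> is split as \<open>(z + w) - w\<close>.\<close>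

lemma tan_trace_diff:
  assumes "v \<in> H_d U j" "w \<in> H_d U j"
  shows "{(\<lambda>x. a x - b x) | a b. a \<in> tan_trace U j v \<and> b \<in> tan_trace U j w} = tan_trace U j (\<lambda>x. v x - w x)"
proof (intro equalityI subsetI)
  fix z assume "z \<in> {(\<lambda>x. a x - b x) | a b. a \<in> tan_trace U j v \<and> b \<in> tan_trace U j w}"
  then obtain a b where ab: "a \<in> tan_trace U j v" "b \<in> tan_trace U j w" and z: "z = (\<lambda>x. a x - b x)" by blast
  then have H: "a \<in> H_d U j" "b \<in> H_d U j" using assms by (auto simp: tan_trace_eq)
  show "z \<in> tan_trace U j (\<lambda>x. v x - w x)"
    using ab assms H H_d_diff(1)[OF U H] unfolding z tan_trace_eq[OF H_d_diff(1)[OF U assms]]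
    by (simp add: trace_form_diff_left tan_trace_eq)
next
  fix z assume z: "z \<in> tan_trace U j (\<lambda>x. v x - w x)"
  have zH: "z \<in> H_d U j" using z by (simp add: tan_trace_eq[OF H_d_diff(1)[OF U assms]])
  have H: "(\<lambda>x. z x + w x) \<in> H_d U j" using H_d_add_scaleR(1)[OF U zH assms(2), of 1] by simp
  have "(\<lambda>x. (z x + w x) - w x) = z" by simp
  then have "trace_form U j z \<eta> = trace_form U j (\<lambda>x. z x + w x) \<eta> - trace_form U j w \<eta>" if "\<eta> \<in> H_delta U (j + 1)" for \<eta>
    using trace_form_diff_left[OF H assms(2) that] by simp
  then have "(\<lambda>x. z x + w x) \<in> tan_trace U j v"
    using z H assms unfolding tan_trace_eq[OF H_d_diff(1)[OF U assms]]
    by (auto simp: trace_form_diff_left tan_trace_eq)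
  moreover have "w \<in> tan_trace U j w" using assms by (simp add: tan_trace_eq)
  moreover have "z = (\<lambda>x. (z x + w x) - w x)" by simp
  ultimately show "z \<in> {(\<lambda>x. a x - b x) | a b. a \<in> tan_trace U j v \<and> b \<in> tan_trace U j w}"
    by (intro CollectI exI[of _ "\<lambda>x. z x + w x"] exI[of _ w]) simp
qed

text \<open>Removes the boundary term when an equation is tested with a form supported inside an
  element.\<close>

lemma trace_form_test_form:
  assumes "\<phi> \<in> test_forms U j" "\<eta> \<in> H_delta U (j + 1)"
  shows "trace_form U j \<phi> \<eta> = 0"
proof -
  note c = codiff_spec[OF assms(2)]
  have s: "smooth_d \<phi> \<in> L2_forms U (j + 1)"
    using test_forms_L2[OF smooth_d_test_forms[OF assms(1)] U] by (simp add: L2_forms_eq)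
  have "ip (lebesgue_on U) (ext_d U j \<phi>) \<eta> = ip (lebesgue_on U) (smooth_d \<phi>) \<eta>"
    by (rule ip_ext_d_eq[OF U test_forms_H_d(1)[OF U assms(1)] s test_forms_has_weak_d[OF U assms(1)]
        H_delta_L2[OF assms(2), unfolded L2_forms_eq]])
  then show ?thesis
    using c(2) assms(1) unfolding trace_form_def has_weak_codiff_def L2_inner_eq by (simp add: ip_commute)
qed

lemma trace_form_codiff:
  assumes "v \<in> H_d U j" "\<eta> \<in> H_delta U (j + 1)" "c \<in> L2_forms U j" "has_weak_codiff U (j + 1) \<eta> c"
  shows "trace_form U j v \<eta> = L2_inner U (ext_d U j v) \<eta> - L2_inner U v c"
  using ip_codiff_eq[OF U assms(2) _ assms(4) H_d_L2[OF assms(1), unfolded L2_forms_eq]] assms(3)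
  by (simp add: trace_form_def L2_inner_eq)

text \<open>Testing with compactly supported forms identifies the codifferential of \<open>z\<close>, and testing with all
  forms then identifies the normal trace.\<close>

lemma codiff_and_nor_trace_iff:
  assumes s: "s \<in> L2_forms U j" and z: "z \<in> L2_forms U (j + 1)" and \<eta>: "\<eta> \<in> H_delta U (j + 1)"
  shows "(\<forall>v\<in>H_d U j. L2_inner U s v - L2_inner U z (ext_d U j v) + trace_form U j v \<eta> = 0) \<longleftrightarrow>
    has_weak_codiff U (j + 1) z s \<and> nor_trace U (j + 1) \<eta> = nor_trace U (j + 1) z"
proof
  assume h: "\<forall>v\<in>H_d U j. L2_inner U s v - L2_inner U z (ext_d U j v) + trace_form U j v \<eta> = 0"
  have w: "has_weak_codiff U (j + 1) z s"
    unfolding has_weak_codiff_def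
  proof
    fix \<phi> :: "'n form" assume "\<phi> \<in> test_forms U (j + 1 - 1)"
    then have \<phi>: "\<phi> \<in> test_forms U j" by simp
    have sd: "smooth_d \<phi> \<in> L2_forms U (j + 1)"
      using test_forms_L2[OF smooth_d_test_forms[OF \<phi>] U] by (simp add: L2_forms_eq)
    have "ip (lebesgue_on U) (ext_d U j \<phi>) z = ip (lebesgue_on U) (smooth_d \<phi>) z"
      by (rule ip_ext_d_eq[OF U test_forms_H_d(1)[OF U \<phi>] sd test_forms_has_weak_d[OF U \<phi>] z[unfolded L2_forms_eq]])
    then show "L2_inner U s \<phi> = L2_inner U z (smooth_d \<phi>)"
      using bspec[OF h test_forms_H_d(1)[OF U \<phi>]] trace_form_test_form[OF \<phi> \<eta>]
      unfolding L2_inner_eq by (simp add: ip_commute)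
  qed
  have zH: "z \<in> H_delta U (j + 1)" using H_delta_I[OF z _ w] s by simp
  have "nor_trace U (j + 1) \<eta> = nor_trace U (j + 1) z"
    unfolding nor_trace_eq_iff[OF \<eta> zH]
    using h trace_form_codiff[OF _ zH s w] unfolding L2_inner_eq by (fastforce simp: ip_commute)
  with w show "has_weak_codiff U (j + 1) z s \<and> nor_trace U (j + 1) \<eta> = nor_trace U (j + 1) z" by simp
next
  assume h: "has_weak_codiff U (j + 1) z s \<and> nor_trace U (j + 1) \<eta> = nor_trace U (j + 1) z"
  then have w: "has_weak_codiff U (j + 1) z s" by simp
  have zH: "z \<in> H_delta U (j + 1)" using H_delta_I[OF z _ w] s by simp
  have "\<forall>v\<in>H_d U j. trace_form U j v \<eta> = trace_form U j v z" using h nor_trace_eq_iff[OF \<eta> zH] by blast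
  then show "\<forall>v\<in>H_d U j. L2_inner U s v - L2_inner U z (ext_d U j v) + trace_form U j v \<eta> = 0"
    using trace_form_codiff[OF _ zH s w] unfolding L2_inner_eq by (simp add: ip_commute)
qed

section \<open>Changes on null sets\<close>

lemma L2_forms_AE_cong:
  assumes "v \<in> L2_forms U j" "AE x in lebesgue_on U. v x = w x"
  shows "w \<in> L2_forms U j"
proof -
  have v: "v \<in> borel_measurable (lebesgue_on U)" "integrable (lebesgue_on U) (\<lambda>x. (norm (v x))\<^sup>2)"
    "AE x in lebesgue_on U. v x \<in> alt_deg j"
    using assms(1) by (auto simp: L2_forms_def)
  have "AE x in lebesgue. (if x \<in> U then v x else 0) = (if x \<in> U then w x else 0)"
    using assms(2) U by (auto simp: AE_restrict_space_iff elim!: eventually_mono)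
  moreover have "(\<lambda>x. if x \<in> U then v x else 0) \<in> borel_measurable lebesgue"
    using v(1) U by (intro borel_measurable_if_I) auto
  \<comment> \<open>Measurability of \<open>w\<close> is not assumed; it follows from the
    completeness of Lebesgue measure.\<close>
  ultimately have "(\<lambda>x. if x \<in> U then w x else 0) \<in> borel_measurable lebesgue"
    by (rule borel_measurable_AE[rotated])
  then have [measurable]: "w \<in> borel_measurable (lebesgue_on U)" by (rule borel_measurable_if_D)
  have "AE x in lebesgue_on U. (norm (v x))\<^sup>2 = (norm (w x))\<^sup>2" using assms(2) by eventually_elim simp
  then have "integrable (lebesgue_on U) (\<lambda>x. (norm (w x))\<^sup>2)"
    using v(2) by (subst integrable_cong_AE[of _ _ "\<lambda>x. (norm (v x))\<^sup>2"]) auto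
  moreover have "AE x in lebesgue_on U. w x \<in> alt_deg j" using v(3) assms(2) by eventually_elim simp
  ultimately show ?thesis by (simp add: L2_forms_def)
qed

lemma L2_inner_AE_cong:
  assumes "v \<in> L2_forms U j" "w \<in> L2_forms U l" "AE x in lebesgue_on U. v x = v' x"
  shows "L2_inner U v w = L2_inner U v' w" "L2_inner U w v = L2_inner U w v'"
proof -
  show "L2_inner U v w = L2_inner U v' w" unfolding L2_inner_eq
    using ip_cong_AE[OF assms(3) AE_I2[of "lebesgue_on U" "\<lambda>x. w x = w x"]
        assms(1)[unfolded L2_forms_eq] L2_forms_AE_cong[OF assms(1,3), unfolded L2_forms_eq] assms(2,2)[unfolded L2_forms_eq]]
    by simp
  then show "L2_inner U w v = L2_inner U w v'" unfolding L2_inner_eq by (simp add: ip_commute)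
qed

lemma has_weak_d_zero: "has_weak_d U j (\<lambda>x. 0) (\<lambda>x. 0)"
  by (simp add: has_weak_d_iff L2_inner_eq ip_def)

lemma L2_forms_zero: "(\<lambda>x. 0) \<in> L2_forms U j"
  by (simp add: L2_forms_eq L2_zero subspace_alt_deg)

lemma has_weak_d_AE_cong:
  assumes "v \<in> L2_forms U j" "w \<in> L2_forms U (j + 1)" "has_weak_d U j v w"
    and "AE x in lebesgue_on U. v x = v' x" "AE x in lebesgue_on U. w x = w' x"
  shows "has_weak_d U j v' w'"
  unfolding has_weak_d_iff
proof
  fix \<psi> :: "'n form" assume \<psi>: "\<psi> \<in> test_forms U (j + 1)"
  have L: "\<psi> \<in> L2_forms U (j + 1)" "smooth_codiff (j + 1) \<psi> \<in> L2_forms U j"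
    using test_forms_L2[OF \<psi> U] test_forms_L2[OF smooth_codiff_test_forms[OF \<psi>] U] by (simp_all add: L2_forms_eq)
  show "L2_inner U w' \<psi> = L2_inner U v' (smooth_codiff (j + 1) \<psi>)"
    using assms(3) \<psi> L2_inner_AE_cong(1)[OF assms(2) L(1) assms(5)] L2_inner_AE_cong(1)[OF assms(1) L(2) assms(4)]
    by (simp add: has_weak_d_iff)
qed

text \<open>The theorem asserts \<open>pbar = 0\<close> up to null sets, so the converse direction
  has to show that every null function represents an element of the harmonic space.\<close>

lemma AE_zero_imp_harmonic0:
  assumes z: "AE x in lebesgue_on U. z x = 0"
  shows "z \<in> harmonic0 U k"
proof -
  have z': "AE x in lebesgue_on U. 0 = z x" using z by eventually_elim simp
  have L: "z \<in> L2_forms U k" by (rule L2_forms_AE_cong[OF L2_forms_zero z'])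
  have w: "has_weak_d U k z (\<lambda>x. 0)"
    by (rule has_weak_d_AE_cong[OF L2_forms_zero L2_forms_zero has_weak_d_zero z']) simp
  have H: "z \<in> H_d U k" by (rule H_d_I[OF L L2_forms_zero w])
  have d: "AE x in lebesgue_on U. ext_d U k z x = 0" by (rule ext_d_unique[OF U H L2_forms_zero w])
  have 0: "L2_inner U z w = 0" if "w \<in> L2_forms U l" for w l
    using L2_inner_AE_cong(1)[OF L that z] by (simp add: L2_inner_eq ip_def)
  have "z \<in> H_d0 U k"
    unfolding H_d0_iff[OF U H]
  proof
    fix \<eta> assume \<eta>: "\<eta> \<in> H_delta U (k + 1)"
    have "L2_inner U (ext_d U k z) \<eta> = 0"
      using L2_inner_AE_cong(1)[OF ext_d_spec(1)[OF H] H_delta_L2[OF \<eta>] d] by (simp add: L2_inner_eq ip_def)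
    then show "L2_inner U (ext_d U k z) \<eta> = L2_inner U z (codiff U (k + 1) \<eta>)"
      using 0[OF codiff_spec(1)[OF \<eta>]] by simp
  qed
  then show ?thesis unfolding harmonic0_def using d 0[OF ext_d_spec(1)] by (auto simp: H_d0_def)
qed

end

section \<open>Dependence on the values inside a region\<close>

lemma L2_inner_cong_on:
  assumes "\<And>x. x \<in> U \<Longrightarrow> v x = v' x" "\<And>x. x \<in> U \<Longrightarrow> w x = w' x"
  shows "L2_inner U v w = L2_inner U v' w'"
  unfolding L2_inner_eq ip_def
  by (rule Bochner_Integration.integral_cong) (use assms in auto)

lemma L2_forms_cong_on:
  assumes "\<And>x. x \<in> U \<Longrightarrow> v x = v' x"
  shows "v \<in> L2_forms U j \<longleftrightarrow> v' \<in> L2_forms U j"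
proof -
  have "v \<in> borel_measurable (lebesgue_on U) \<longleftrightarrow> v' \<in> borel_measurable (lebesgue_on U)"
    by (rule measurable_cong) (use assms in auto)
  moreover have "integrable (lebesgue_on U) (\<lambda>x. (norm (v x))\<^sup>2) \<longleftrightarrow> integrable (lebesgue_on U) (\<lambda>x. (norm (v' x))\<^sup>2)"
    by (rule Bochner_Integration.integrable_cong) (use assms in auto)
  moreover have "(AE x in lebesgue_on U. v x \<in> alt_deg j) \<longleftrightarrow> (AE x in lebesgue_on U. v' x \<in> alt_deg j)"
    by (rule AE_cong) (use assms in auto)
  ultimately show ?thesis by (simp add: L2_forms_def)
qed

lemma has_weak_d_cong_on:
  assumes "\<And>x. x \<in> U \<Longrightarrow> v x = v' x"
  shows "has_weak_d U j v = has_weak_d U j v'"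
proof -
  have "L2_inner U v \<psi> = L2_inner U v' \<psi>" for \<psi> by (rule L2_inner_cong_on) (use assms in auto)
  then show ?thesis by (simp add: has_weak_d_iff fun_eq_iff)
qed

text \<open>Forms agreeing on \<open>U\<close> satisfy the same predicate under the choice operator,
  so the chosen derivatives are equal as functions, not just almost everywhere. Extension by zero
  from one element relies on this.\<close>

lemma H_d_cong_on:
  assumes "\<And>x. x \<in> U \<Longrightarrow> v x = v' x"
  shows "v \<in> H_d U j \<longleftrightarrow> v' \<in> H_d U j" "ext_d U j v = ext_d U j v'"
  using has_weak_d_cong_on[OF assms] L2_forms_cong_on[of U v v'] assms by (simp_all add: H_d_def ext_d_def)

lemma H_delta_cong_on:
  assumes "\<And>x. x \<in> U \<Longrightarrow> v x = v' x"
  shows "v \<in> H_delta U j \<longleftrightarrow> v' \<in> H_delta U j" "codiff U j v = codiff U j v'"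
  using H_d_cong_on[of U "\<lambda>x. hodge (v x)" "\<lambda>x. hodge (v' x)"] L2_forms_cong_on[of U v v'] assms
  by (simp_all add: H_delta_def codiff_def)

lemma trace_form_cong_on:
  assumes "\<And>x. x \<in> U \<Longrightarrow> v x = v' x" "\<And>x. x \<in> U \<Longrightarrow> w x = w' x"
  shows "trace_form U j v w = trace_form U j v' w'"
proof -
  have "L2_inner U c w = L2_inner U c w'" "L2_inner U v c = L2_inner U v' c" for c
    by (rule L2_inner_cong_on; use assms in auto)+
  then show ?thesis
    by (simp add: trace_form_def H_d_cong_on(2)[OF assms(1)] H_delta_cong_on(2)[OF assms(2)])
qed

text \<open>Near each of its points the frontier is contained in the graph of \<open>g\<close>, the
  image of a hyperplane under a Lipschitz map into the same space, and such images of null sets are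
  null.\<close>

lemma negligible_frontier_lipschitz_domain:
  fixes U :: "'n::finite region"
  assumes "lipschitz_domain U"
  shows "negligible (frontier U)"
proof (subst locally_negligible_alt, intro ballI)
  fix p assume p: "p \<in> frontier U"
  have "open U" using assms by (simp add: lipschitz_domain_def)
  from assms have "\<forall>p\<in>frontier U. \<exists>N e L g. open N \<and> p \<in> N \<and> norm e = 1 \<and>
        L-lipschitz_on {y. y \<bullet> e = 0} (g :: real ^ 'n \<Rightarrow> real) \<and>
        U \<inter> N = {x \<in> N. g (x - (x \<bullet> e) *\<^sub>R e) < x \<bullet> e}"
    unfolding lipschitz_domain_def by (elim conjE)
  from bspec[OF this p] obtain N e L g where N: "open N" "p \<in> N" and e: "norm e = 1"
    and g: "L-lipschitz_on {y. y \<bullet> e = 0} (g :: real ^ 'n \<Rightarrow> real)"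
    and UN: "U \<inter> N = {x \<in> N. g (x - (x \<bullet> e) *\<^sub>R e) < x \<bullet> e}"
    by (elim exE conjE) rule
  have ee: "e \<bullet> e = 1" using e by (simp add: dot_square_norm)
  have "negligible ((\<lambda>y. y + g y *\<^sub>R e) ` {y. y \<bullet> e = 0})"
  proof (rule negligible_locally_Lipschitz_image)
    have "{y. y \<bullet> e = 0} = {y. e \<bullet> y = 0}" by (simp add: inner_commute)
    moreover have "e \<noteq> 0" using e by auto
    ultimately show "negligible {y. y \<bullet> e = 0}" using negligible_hyperplane[of e 0] by simp
    fix x assume x: "x \<in> {y. y \<bullet> e = 0}"
    \<comment> \<open>The identity contributes the constant 1 and the unit vector times
      \<open>g\<close> contributes \<open>L\<close>.\<close>
    have "norm (y + g y *\<^sub>R e - (x + g x *\<^sub>R e)) \<le> (1 + L) * norm (y - x)" if y: "y \<bullet> e = 0" for y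
    proof -
      have "norm (y + g y *\<^sub>R e - (x + g x *\<^sub>R e)) = norm ((y - x) + (g y - g x) *\<^sub>R e)"
        by (simp add: algebra_simps)
      also have "\<dots> \<le> norm (y - x) + \<bar>g y - g x\<bar>"
        using norm_triangle_ineq[of "y - x" "(g y - g x) *\<^sub>R e"] e by simp
      also have "\<bar>g y - g x\<bar> \<le> L * norm (y - x)"
        using lipschitz_onD[OF g, of y x] x y by (simp add: dist_norm)
      finally show ?thesis by (simp add: algebra_simps)
    qed
    then show "\<exists>T B. open T \<and> x \<in> T \<and> (\<forall>y\<in>{y. y \<bullet> e = 0} \<inter> T. norm (y + g y *\<^sub>R e - (x + g x *\<^sub>R e)) \<le> B * norm (y - x))"
      by (intro exI[of _ UNIV] exI[of _ "1 + L"]) auto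
  qed simp
  moreover have "frontier U \<inter> N \<subseteq> (\<lambda>y. y + g y *\<^sub>R e) ` {y. y \<bullet> e = 0}"
  proof
    fix x assume x: "x \<in> frontier U \<inter> N"
    define P where "P x = x - (x \<bullet> e) *\<^sub>R e" for x
    have P: "P x \<bullet> e = 0" for x by (simp add: P_def inner_diff_left ee)
    have "continuous_on {y. y \<bullet> e = 0} g" using g lipschitz_on_continuous_on by blast
    moreover have "continuous_on UNIV P" unfolding P_def by (intro continuous_intros)
    ultimately have "continuous_on UNIV (\<lambda>x. g (P x))"
      by (rule continuous_on_compose2) (use P in auto)
    then have "open {x. x \<bullet> e < g (P x)}" by (intro open_Collect_less continuous_intros)
    then have o: "open ({x. x \<bullet> e < g (P x)} \<inter> N)" using N by blast
    \<comment> \<open>A frontier point is not above the graph, as it would belong to the open set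
      \<open>U\<close>, and not below, as the region below is open and misses \<open>U\<close>
      within \<open>N\<close>.\<close>
    have "x \<notin> U" using x \<open>open U\<close> by (simp add: frontier_def interior_open)
    then have "\<not> g (P x) < x \<bullet> e" using x UN unfolding P_def by blast
    moreover have "\<not> x \<bullet> e < g (P x)"
    proof
      assume "x \<bullet> e < g (P x)"
      then have "x \<in> {x. x \<bullet> e < g (P x)} \<inter> N" using x by simp
      moreover have "x \<in> closure U" using x by (simp add: frontier_def)
      ultimately have "U \<inter> ({x. x \<bullet> e < g (P x)} \<inter> N) \<noteq> {}"
        using open_Int_closure_eq_empty[OF o, of U] by blast
      then obtain y where y: "y \<in> U" "y \<in> N" "y \<bullet> e < g (P y)" by blast
      then have "y \<in> {x \<in> N. g (x - (x \<bullet> e) *\<^sub>R e) < x \<bullet> e}" unfolding UN[symmetric] by simp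
      then show False using y(3) by (simp add: P_def)
    qed
    ultimately have "g (P x) = x \<bullet> e" by simp
    then have "x = P x + g (P x) *\<^sub>R e" by (simp add: P_def)
    then show "x \<in> (\<lambda>y. y + g y *\<^sub>R e) ` {y. y \<bullet> e = 0}" using P by blast
  qed
  ultimately have "negligible (frontier U \<inter> N)" using negligible_subset by blast
  then show "\<exists>V. openin (top_of_set (frontier U)) V \<and> p \<in> V \<and> negligible V"
    using N p by (intro exI[of _ "frontier U \<inter> N"]) (auto simp: openin_open_Int)
qed

section \<open>Forms on a decomposed domain\<close>

lemma has_weak_codiff_subset:
  fixes v w :: "'n::{finite,linorder} form"
  assumes "has_weak_codiff V j v w" "open U" "open V" "U \<subseteq> V"
  shows "has_weak_codiff U j v w"
  unfolding has_weak_codiff_def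
proof
  fix \<phi> :: "'n form" assume \<phi>: "\<phi> \<in> test_forms U (j - 1)"
  have 1: "L2_inner U w \<phi> = L2_inner V w \<phi>"
    by (rule L2_inner_test_form_subset[OF assms(2-4) \<phi>])
  have 2: "L2_inner U v (smooth_d \<phi>) = L2_inner V v (smooth_d \<phi>)"
    by (rule L2_inner_test_form_subset[OF assms(2-4) smooth_d_test_forms[OF \<phi>]])
  have "\<phi> \<in> test_forms V (j - 1)" using \<phi> test_forms_mono[OF assms(4)] by blast
  then show "L2_inner U w \<phi> = L2_inner U v (smooth_d \<phi>)"
    unfolding 1 2 using assms(1) by (simp add: has_weak_codiff_def)
qed

lemma L2_forms_diff: "v \<in> L2_forms U j \<Longrightarrow> w \<in> L2_forms U j \<Longrightarrow> (\<lambda>x. v x - w x) \<in> L2_forms U j"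
  unfolding L2_forms_eq by (rule L2_diff[OF subspace_alt_deg])

lemma L2_forms_add: "v \<in> L2_forms U j \<Longrightarrow> w \<in> L2_forms U j \<Longrightarrow> (\<lambda>x. v x + w x) \<in> L2_forms U j"
  unfolding L2_forms_eq by (rule L2_add[OF subspace_alt_deg])

lemma broken_inner_diff_left:
  assumes "\<And>K. K \<in> T \<Longrightarrow> v \<in> L2_forms K j" "\<And>K. K \<in> T \<Longrightarrow> w \<in> L2_forms K j" "\<And>K. K \<in> T \<Longrightarrow> z \<in> L2_forms K l"
  shows "broken_inner T (\<lambda>x. v x - w x) z = broken_inner T v z - broken_inner T w z"
  unfolding broken_inner_def sum_subtractf[symmetric] L2_inner_eq
  by (rule sum.cong[OF refl], rule ip_diff_left) (use assms in \<open>auto simp: L2_forms_eq\<close>)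

lemma harmonic_L2: "v \<in> harmonic U k \<Longrightarrow> v \<in> L2_forms U k"
  by (simp add: harmonic_def H_d_def)

lemma harmonic0_L2: "v \<in> harmonic0 U k \<Longrightarrow> v \<in> L2_forms U k"
  by (simp add: harmonic0_def H_d0_def H_d_def)

section \<open>Gluing over elements that cover the domain up to a null set\<close>

context
  fixes \<Omega> :: "'n::{finite,linorder} region" and T :: "'n region set"
  assumes \<Omega>: "open \<Omega>" and fin: "finite T" and opn: "\<And>K. K \<in> T \<Longrightarrow> open K"
    and sub: "\<And>K. K \<in> T \<Longrightarrow> K \<subseteq> \<Omega>" and disj: "pairwise disjnt T"
    and null: "negligible (\<Omega> - \<Union>T)"
begin

lemma cell_unique: "K \<in> T \<Longrightarrow> K' \<in> T \<Longrightarrow> x \<in> K \<Longrightarrow> x \<in> K' \<Longrightarrow> K = K'"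
  using disj unfolding pairwise_def disjnt_def by blast

lemma sum_cells:
  assumes "K \<in> T" "x \<in> K"
  shows "(\<Sum>K\<in>T. if x \<in> K then F K else 0) = F K"
proof -
  have "(\<Sum>K'\<in>T. if x \<in> K' then F K' else 0) = (\<Sum>K'\<in>T. if K' = K then F K' else 0)"
    by (rule sum.cong[OF refl]) (use cell_unique assms in auto)
  then show ?thesis using fin assms(1) by (simp add: sum.delta)
qed

lemma AE_in_cells: "AE x in lebesgue. x \<in> \<Omega> \<longrightarrow> (\<exists>K\<in>T. x \<in> K)"
  using AE_not_in[OF null[unfolded negligible_iff_null_sets]] by eventually_elim auto

text \<open>Almost every point of the domain lies in exactly one element. Measurability,
  integrability and integrals pass from the elements to the domain through this sum of
  truncations.\<close>

lemma AE_sum_cells: "AE x in lebesgue. (\<Sum>K\<in>T. if x \<in> K then f x else 0) = (if x \<in> \<Omega> then f x else 0)"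
  using AE_in_cells
proof eventually_elim
  case (elim x)
  show ?case
  proof (cases "x \<in> \<Omega>")
    case True
    then obtain K where "K \<in> T" "x \<in> K" using elim by blast
    then show ?thesis using sum_cells[of K x "\<lambda>K. f x"] True by simp
  next
    case False
    then show ?thesis by (auto intro!: sum.neutral dest: subsetD[OF sub])
  qed
qed

lemma AE_cells:
  assumes "\<And>K. K \<in> T \<Longrightarrow> AE x in lebesgue_on K. P x"
  shows "AE x in lebesgue_on \<Omega>. P x"
proof -
  have "AE x in lebesgue. \<forall>K\<in>T. x \<in> K \<longrightarrow> P x"
    using assms opn by (intro AE_finite_allI fin) (auto simp: AE_restrict_space_iff)
  then have "AE x in lebesgue. x \<in> \<Omega> \<longrightarrow> P x" using AE_in_cells by eventually_elim blast
  then show ?thesis using \<Omega> by (simp add: AE_restrict_space_iff)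
qed

lemma L2_forms_cells:
  assumes "\<And>K. K \<in> T \<Longrightarrow> v \<in> L2_forms K j"
  shows "v \<in> L2_forms \<Omega> j"
proof -
  have v: "v \<in> borel_measurable (lebesgue_on K)" "integrable (lebesgue_on K) (\<lambda>x. (norm (v x))\<^sup>2)"
    "AE x in lebesgue_on K. v x \<in> alt_deg j" if "K \<in> T" for K
    using assms[OF that] by (auto simp: L2_forms_def)
  have "(\<lambda>x. \<Sum>K\<in>T. if x \<in> K then v x else 0) \<in> borel_measurable lebesgue"
    by (intro borel_measurable_sum borel_measurable_if_I v(1)) (use opn in auto)
  from borel_measurable_AE[OF this AE_sum_cells]
  have [measurable]: "v \<in> borel_measurable (lebesgue_on \<Omega>)" by (rule borel_measurable_if_D)
  have "integrable lebesgue (\<lambda>x. \<Sum>K\<in>T. if x \<in> K then (norm (v x))\<^sup>2 else 0)"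
    using v(2) opn by (intro Bochner_Integration.integrable_sum) (simp add: Lebesgue_Measure.integrable_restrict_UNIV)
  moreover have "(\<lambda>x. if x \<in> \<Omega> then (norm (v x))\<^sup>2 else 0) \<in> borel_measurable lebesgue"
    using \<Omega> by (intro borel_measurable_if_I) auto
  ultimately have "integrable lebesgue (\<lambda>x. if x \<in> \<Omega> then (norm (v x))\<^sup>2 else 0)"
    by (rule integrable_cong_AE_imp) (rule AE_sum_cells)
  then have "integrable (lebesgue_on \<Omega>) (\<lambda>x. (norm (v x))\<^sup>2)"
    using \<Omega> by (simp add: Lebesgue_Measure.integrable_restrict_UNIV)
  moreover have "AE x in lebesgue_on \<Omega>. v x \<in> alt_deg j" by (rule AE_cells[OF v(3)])
  ultimately show ?thesis by (simp add: L2_forms_def)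
qed

lemma L2_forms_cell: "v \<in> L2_forms \<Omega> j \<Longrightarrow> K \<in> T \<Longrightarrow> v \<in> L2_forms K j"
  by (rule L2_forms_subset[OF _ opn \<Omega> sub])

lemma H_d_cell: "v \<in> H_d \<Omega> j \<Longrightarrow> K \<in> T \<Longrightarrow> v \<in> H_d K j"
  by (rule H_d_subset(1)[OF _ opn \<Omega> sub])

lemma H_d_broken: "v \<in> H_d \<Omega> j \<Longrightarrow> v \<in> broken_H_d T j"
  by (simp add: broken_H_d_def H_d_cell)

text \<open>The part of the domain between the elements is a null set and contributes nothing to the
  integral.\<close>

lemma L2_inner_cells:
  assumes "v \<in> L2_forms \<Omega> j" "w \<in> L2_forms \<Omega> l"
  shows "broken_inner T v w = L2_inner \<Omega> v w"
proof -
  have i: "integrable (lebesgue_on K) (\<lambda>x. v x \<bullet> w x)" if "K \<in> T" for K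
    using integrable_inner_L2 L2_forms_cell[OF assms(1) that] L2_forms_cell[OF assms(2) that]
    unfolding L2_forms_eq by blast
  have i\<Omega>: "integrable (lebesgue_on \<Omega>) (\<lambda>x. v x \<bullet> w x)"
    using integrable_inner_L2 assms unfolding L2_forms_eq by blast
  have iK: "integrable lebesgue (\<lambda>x. if x \<in> K then v x \<bullet> w x else 0)" if "K \<in> T" for K
    using i[OF that] opn[OF that] by (simp add: Lebesgue_Measure.integrable_restrict_UNIV)
  have "L2_inner \<Omega> v w = (LINT x|lebesgue. (if x \<in> \<Omega> then v x \<bullet> w x else 0))"
    unfolding L2_inner_eq ip_def using \<Omega> by (intro Lebesgue_Measure.integral_restrict_UNIV[symmetric]) auto
  also have "\<dots> = (LINT x|lebesgue. (\<Sum>K\<in>T. if x \<in> K then v x \<bullet> w x else 0))"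
  proof (rule Bochner_Integration.integral_cong_AE)
    show "(\<lambda>x. if x \<in> \<Omega> then v x \<bullet> w x else 0) \<in> borel_measurable lebesgue"
      using i\<Omega> \<Omega> by (intro borel_measurable_if_I) auto
    show "(\<lambda>x. \<Sum>K\<in>T. if x \<in> K then v x \<bullet> w x else 0) \<in> borel_measurable lebesgue"
      using iK by (intro borel_measurable_sum) auto
  qed (rule AE_symmetric[OF AE_sum_cells])
  also have "\<dots> = (\<Sum>K\<in>T. LINT x|lebesgue. (if x \<in> K then v x \<bullet> w x else 0))"
    by (rule Bochner_Integration.integral_sum) (rule iK)
  also have "\<dots> = broken_inner T v w"
    unfolding broken_inner_def L2_inner_eq ip_def using opn
    by (intro sum.cong refl Lebesgue_Measure.integral_restrict_UNIV) auto
  finally show ?thesis by simp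
qed

lemma broken_d_cell: "K \<in> T \<Longrightarrow> x \<in> K \<Longrightarrow> broken_d T j v x = ext_d K j v x"
proof -
  assume K: "K \<in> T" "x \<in> K"
  have "broken_d T j v x = (\<Sum>K\<in>T. if x \<in> K then ext_d K j v x else 0)"
    unfolding broken_d_def by (rule sum.cong) (auto simp: indicator_def)
  then show ?thesis using sum_cells[OF K, of "\<lambda>K. ext_d K j v x"] by simp
qed

lemma broken_d_L2:
  assumes "v \<in> broken_H_d T j" "K \<in> T"
  shows "broken_d T j v \<in> L2_forms K (j + 1)"
  using L2_forms_cong_on[of K "broken_d T j v" "ext_d K j v"] broken_d_cell[OF assms(2)] assms
    ext_d_spec(1)[of v K j] by (simp add: broken_H_d_def)

lemma AE_broken_d:
  assumes "v \<in> H_d \<Omega> j" "K \<in> T"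
  shows "AE x in lebesgue_on K. broken_d T j v x = ext_d \<Omega> j v x"
proof -
  have "AE x in lebesgue_on K. broken_d T j v x = ext_d K j v x"
    by (rule AE_I2) (use broken_d_cell[OF assms(2)] in auto)
  then show ?thesis using H_d_subset(2)[OF assms(1) opn[OF assms(2)] \<Omega> sub[OF assms(2)]]
    by eventually_elim simp
qed

lemma broken_inner_broken_d:
  assumes "v \<in> H_d \<Omega> j" "\<And>K. K \<in> T \<Longrightarrow> w \<in> L2_forms K l"
  shows "broken_inner T (broken_d T j v) w = broken_inner T (ext_d \<Omega> j v) w"
  unfolding broken_inner_def
  by (rule sum.cong[OF refl], rule L2_inner_AE_cong(1)[OF opn broken_d_L2[OF H_d_broken[OF assms(1)]] assms(2) AE_broken_d[OF assms(1)]])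

section \<open>Broken traces and localization to one element\<close>

lemma broken_pair_eq:
  assumes "v \<in> broken_H_d T j" "\<eta> \<in> broken_H_delta T (j + 1)"
  shows "broken_pair T j (broken_tan T j v) (broken_nor T (j + 1) \<eta>) = (\<Sum>K\<in>T. trace_form K j v \<eta>)"
  unfolding broken_pair_def
  by (rule sum.cong[OF refl])
    (use assms in \<open>simp add: broken_tan_def broken_nor_def broken_H_d_def broken_H_delta_def trace_pair_eq_trace_form[OF opn]\<close>)

lemma trace_diff_broken_tan:
  assumes "v \<in> broken_H_d T j" "w \<in> broken_H_d T j"
  shows "trace_diff T (broken_tan T j v) (broken_tan T j w) = broken_tan T j (\<lambda>x. v x - w x)"
proof -
  have "{(\<lambda>x. a x - b x) | a b. a \<in> tan_trace K j v \<and> b \<in> tan_trace K j w} = tan_trace K j (\<lambda>x. v x - w x)" if "K \<in> T" for K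
    using assms that by (intro tan_trace_diff opn) (auto simp: broken_H_d_def)
  then show ?thesis unfolding trace_diff_def broken_tan_def by (auto simp: restrict_def fun_eq_iff)
qed

text \<open>Broken spaces impose no matching across interfaces, so a form on one element may be
  extended by zero and used as a test, which isolates one summand. \<open>F\<close> and
  \<open>X\<close> are abstract because the test ranges over \<open>H_delta\<close> in (d) and (e)
  and over \<open>H_d\<close> in (a) and (b).\<close>

lemma broken_localize:
  fixes F :: "'n region \<Rightarrow> 'n form \<Rightarrow> real"
  assumes tot: "\<And>v. (\<And>K. K \<in> T \<Longrightarrow> v \<in> X K) \<Longrightarrow> (\<Sum>K\<in>T. F K v) = 0"
    and cong: "\<And>K v w. K \<in> T \<Longrightarrow> (\<And>x. x \<in> K \<Longrightarrow> v x = w x) \<Longrightarrow> F K v = F K w \<and> (v \<in> X K \<longleftrightarrow> w \<in> X K)"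
    and zero: "\<And>K. K \<in> T \<Longrightarrow> (\<lambda>x. 0) \<in> X K \<and> F K (\<lambda>x. 0) = 0"
    and K: "K \<in> T" and v: "v \<in> X K"
  shows "F K v = 0"
proof -
  define w where "w x = (if x \<in> K then v x else 0)" for x
  have 1: "F K' w = 0 \<and> w \<in> X K'" if "K' \<in> T" "K' \<noteq> K" for K'
  proof -
    have "w x = 0" if "x \<in> K'" for x using cell_unique[OF K \<open>K' \<in> T\<close>] that \<open>K' \<noteq> K\<close> by (auto simp: w_def)
    from cong[OF that(1), of w "\<lambda>x. 0", OF this] zero[OF that(1)] show ?thesis by simp
  qed
  have 2: "F K w = F K v \<and> w \<in> X K" using cong[OF K, of w v] v by (simp add: w_def)
  have "0 = (\<Sum>K\<in>T. F K w)" by (rule tot[symmetric]) (use 1 2 in blast)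
  also have "\<dots> = F K w + (\<Sum>K'\<in>T - {K}. F K' w)" by (rule sum.remove[OF fin K])
  also have "(\<Sum>K'\<in>T - {K}. F K' w) = 0" by (rule sum.neutral) (use 1 in auto)
  finally show ?thesis using 2 by simp
qed

lemma zero_H_d: "open U \<Longrightarrow> (\<lambda>x. 0) \<in> H_d U j"
  by (rule test_forms_H_d(1)[OF _ test_forms_zero])

lemma zero_H_delta: "open U \<Longrightarrow> (\<lambda>x. 0) \<in> H_delta U j"
  by (rule test_forms_H_delta(1)[OF _ test_forms_zero order_refl])

lemma trace_form_zero_right:
  assumes "open U" "v \<in> H_d U j"
  shows "trace_form U j v (\<lambda>x. 0) = 0"
  using trace_form_diff_right[OF assms(1,2) zero_H_delta[OF assms(1)] zero_H_delta[OF assms(1)]] by simp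

lemma trace_form_zero_left:
  assumes "open U" "\<eta> \<in> H_delta U (j + 1)"
  shows "trace_form U j (\<lambda>x. 0) \<eta> = 0"
  using trace_form_diff_left[OF assms(1) zero_H_d[OF assms(1)] zero_H_d[OF assms(1)] assms(2)] by simp

text \<open>Since normal traces on different elements are independent, the vanishing of the sum
  localizes, and on a single element the pairing separates tangential traces.\<close>

lemma broken_tan_eq_iff:
  assumes v: "v \<in> broken_H_d T j" and w: "w \<in> broken_H_d T j"
  shows "broken_tan T j v = broken_tan T j w \<longleftrightarrow>
    (\<forall>\<eta>_nor\<in>W_nor T j. broken_pair T j (trace_diff T (broken_tan T j v) (broken_tan T j w)) \<eta>_nor = 0)"
proof -
  have vw: "v \<in> H_d K j" "w \<in> H_d K j" if "K \<in> T" for K using v w that by (auto simp: broken_H_d_def)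
  have d: "(\<lambda>x. v x - w x) \<in> broken_H_d T j"
    using H_d_diff(1)[OF opn vw] by (simp add: broken_H_d_def)
  have eq: "broken_pair T j (trace_diff T (broken_tan T j v) (broken_tan T j w)) (broken_nor T (j + 1) \<eta>) =
      (\<Sum>K\<in>T. trace_form K j v \<eta> - trace_form K j w \<eta>)" if \<eta>: "\<eta> \<in> broken_H_delta T (j + 1)" for \<eta>
    unfolding trace_diff_broken_tan[OF v w] broken_pair_eq[OF d \<eta>]
    by (rule sum.cong[OF refl], rule trace_form_diff_left[OF opn vw]) (use \<eta> in \<open>auto simp: broken_H_delta_def\<close>)
  show ?thesis
  proof
    assume e: "broken_tan T j v = broken_tan T j w"
    have "trace_form K j v \<eta> = trace_form K j w \<eta>" if "K \<in> T" "\<eta> \<in> H_delta K (j + 1)" for K \<eta>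
      using fun_cong[OF e, of K] that tan_trace_eq_iff[OF opn vw] by (simp add: broken_tan_def)
    then show "\<forall>\<eta>_nor\<in>W_nor T j. broken_pair T j (trace_diff T (broken_tan T j v) (broken_tan T j w)) \<eta>_nor = 0"
      unfolding W_nor_def by (auto simp: eq broken_H_delta_def intro!: sum.neutral)
  next
    assume h: "\<forall>\<eta>_nor\<in>W_nor T j. broken_pair T j (trace_diff T (broken_tan T j v) (broken_tan T j w)) \<eta>_nor = 0"
    have "trace_form K j v \<eta> - trace_form K j w \<eta> = 0" if K: "K \<in> T" and \<eta>: "\<eta> \<in> H_delta K (j + 1)" for K \<eta>
    proof (rule broken_localize[where F="\<lambda>K \<eta>. trace_form K j v \<eta> - trace_form K j w \<eta>" and X="\<lambda>K. H_delta K (j + 1)" and K=K and v=\<eta>])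
      fix \<eta> :: "'n form" assume "\<And>K. K \<in> T \<Longrightarrow> \<eta> \<in> H_delta K (j + 1)"
      then have \<eta>: "\<eta> \<in> broken_H_delta T (j + 1)" by (simp add: broken_H_delta_def)
      then show "(\<Sum>K\<in>T. trace_form K j v \<eta> - trace_form K j w \<eta>) = 0"
        using h eq[OF \<eta>] by (simp add: W_nor_def)
    next
      fix K \<eta> and \<zeta> :: "'n form" assume "K \<in> T" "\<And>x. x \<in> K \<Longrightarrow> \<eta> x = \<zeta> x"
      then show "trace_form K j v \<eta> - trace_form K j w \<eta> = trace_form K j v \<zeta> - trace_form K j w \<zeta> \<and>
          (\<eta> \<in> H_delta K (j + 1) \<longleftrightarrow> \<zeta> \<in> H_delta K (j + 1))"
        using trace_form_cong_on[of K v v \<eta> \<zeta> j] trace_form_cong_on[of K w w \<eta> \<zeta> j] H_delta_cong_on(1)[of K \<eta> \<zeta>] by simp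
    next
      fix K assume "K \<in> T"
      then show "(\<lambda>x. 0) \<in> H_delta K (j + 1) \<and> trace_form K j v (\<lambda>x. 0) - trace_form K j w (\<lambda>x. 0) = 0"
        using trace_form_zero_right[OF opn vw(1)] trace_form_zero_right[OF opn vw(2)] zero_H_delta[OF opn] by simp
    qed (use K \<eta> in auto)
    then show "broken_tan T j v = broken_tan T j w"
      using tan_trace_eq_iff[OF opn vw] by (auto simp: broken_tan_def restrict_def fun_eq_iff)
  qed
qed

text \<open>Against a test form on \<open>\<Omega>\<close>, the traces of \<open>z\<close> contribute the same as those of \<open>s\<close>, whose
  contributions cancel.\<close>

lemma H_d_of_broken_tan_eq:
  assumes z: "z \<in> broken_H_d T j" and s: "s \<in> H_d \<Omega> j" and e: "broken_tan T j z = broken_tan T j s"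
  shows "z \<in> H_d \<Omega> j"
proof (rule H_d_I)
  have zK: "z \<in> H_d K j" if "K \<in> T" for K using z that by (simp add: broken_H_d_def)
  show zL: "z \<in> L2_forms \<Omega> j" by (rule L2_forms_cells) (rule H_d_L2[OF zK])
  show dL: "broken_d T j z \<in> L2_forms \<Omega> (j + 1)" by (rule L2_forms_cells[OF broken_d_L2[OF z]])
  show "has_weak_d \<Omega> j z (broken_d T j z)"
    unfolding has_weak_d_iff
  proof
    fix \<psi> :: "'n form" assume \<psi>: "\<psi> \<in> test_forms \<Omega> (j + 1)"
    have \<psi>L: "\<psi> \<in> L2_forms \<Omega> (j + 1)" and cL: "smooth_codiff (j + 1) \<psi> \<in> L2_forms \<Omega> j"
      using test_forms_L2[OF \<psi> \<Omega>] test_forms_L2[OF smooth_codiff_test_forms[OF \<psi>] \<Omega>] by (simp_all add: L2_forms_eq)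
    \<comment> \<open>On a single element \<open>\<psi>\<close> is merely a form in
      \<open>H_delta\<close>, possibly with nonzero normal trace, but its codifferential is still
      the classical one.\<close>
    have tf: "trace_form K j v \<psi> = L2_inner K (ext_d K j v) \<psi> - L2_inner K v (smooth_codiff (j + 1) \<psi>)"
      if K: "K \<in> T" and v: "v \<in> H_d K j" for K v
      using trace_form_codiff[OF opn[OF K] v test_forms_H_delta(1)[OF opn[OF K] \<psi> sub[OF K] \<Omega>] L2_forms_cell[OF cL K]
          test_forms_has_weak_codiff[OF opn[OF K] \<psi> sub[OF K] \<Omega>]] .
    have sum: "(\<Sum>K\<in>T. trace_form K j v \<psi>) =
        broken_inner T (broken_d T j v) \<psi> - broken_inner T v (smooth_codiff (j + 1) \<psi>)"
      if v: "\<And>K. K \<in> T \<Longrightarrow> v \<in> H_d K j" for v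
    proof -
      have "L2_inner K (broken_d T j v) \<psi> = L2_inner K (ext_d K j v) \<psi>" if "K \<in> T" for K
        by (rule L2_inner_cong_on) (use broken_d_cell[OF that] in auto)
      then show ?thesis using tf v by (simp add: broken_inner_def sum_subtractf)
    qed
    have "(\<Sum>K\<in>T. trace_form K j s \<psi>) = 0"
    proof -
      have "broken_inner T (broken_d T j s) \<psi> = L2_inner \<Omega> (ext_d \<Omega> j s) \<psi>"
        using broken_inner_broken_d[OF s L2_forms_cell[OF \<psi>L]] L2_inner_cells[OF ext_d_spec(1)[OF s] \<psi>L] by simp
      moreover have "broken_inner T s (smooth_codiff (j + 1) \<psi>) = L2_inner \<Omega> s (smooth_codiff (j + 1) \<psi>)"
        by (rule L2_inner_cells[OF H_d_L2[OF s] cL])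
      ultimately show ?thesis
        using sum[OF H_d_cell[OF s]] ext_d_spec(2)[OF s] \<psi> by (simp add: has_weak_d_iff)
    qed
    moreover have "trace_form K j z \<psi> = trace_form K j s \<psi>" if K: "K \<in> T" for K
      using fun_cong[OF e, of K] K tan_trace_eq_iff[OF opn[OF K] zK[OF K] H_d_cell[OF s K]]
        test_forms_H_delta(1)[OF opn[OF K] \<psi> sub[OF K] \<Omega>] by (simp add: broken_tan_def)
    ultimately have "broken_inner T (broken_d T j z) \<psi> = broken_inner T z (smooth_codiff (j + 1) \<psi>)"
      using sum[OF zK] by simp
    then show "L2_inner \<Omega> (broken_d T j z) \<psi> = L2_inner \<Omega> z (smooth_codiff (j + 1) \<psi>)"
      unfolding L2_inner_cells[OF dL \<psi>L] L2_inner_cells[OF zL cL] .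
  qed
qed

text \<open>The equation is a sum of independent equations, one per element, and
  \<open>codiff_and_nor_trace_iff\<close> solves each of them.\<close>

lemma broken_codiff_and_nor_iff:
  assumes s: "\<And>K. K \<in> T \<Longrightarrow> s \<in> L2_forms K j" and z: "\<And>K. K \<in> T \<Longrightarrow> z \<in> L2_forms K (j + 1)"
    and \<eta>: "\<eta> \<in> broken_H_delta T (j + 1)"
  shows "(\<forall>v\<in>broken_H_d T j. broken_inner T s v - broken_inner T z (broken_d T j v)
      + broken_pair T j (broken_tan T j v) (broken_nor T (j + 1) \<eta>) = 0) \<longleftrightarrow>
    (\<forall>K\<in>T. has_weak_codiff K (j + 1) z s) \<and> broken_nor T (j + 1) \<eta> = broken_nor T (j + 1) z"
proof -
  define F where "F K v = L2_inner K s v - L2_inner K z (ext_d K j v) + trace_form K j v \<eta>" for K v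
  have \<eta>K: "\<eta> \<in> H_delta K (j + 1)" if "K \<in> T" for K using \<eta> that by (simp add: broken_H_delta_def)
  have "L2_inner K z (broken_d T j v) = L2_inner K z (ext_d K j v)" if "K \<in> T" for K v
    by (rule L2_inner_cong_on) (use broken_d_cell[OF that] in auto)
  then have eq: "broken_inner T s v - broken_inner T z (broken_d T j v)
      + broken_pair T j (broken_tan T j v) (broken_nor T (j + 1) \<eta>) = (\<Sum>K\<in>T. F K v)" if "v \<in> broken_H_d T j" for v
    using broken_pair_eq[OF that \<eta>] by (simp add: broken_inner_def F_def sum.distrib sum_subtractf)
  have "(\<forall>v\<in>broken_H_d T j. (\<Sum>K\<in>T. F K v) = 0) \<longleftrightarrow> (\<forall>K\<in>T. \<forall>v\<in>H_d K j. F K v = 0)"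
  proof (intro iffI ballI)
    fix K v assume h: "\<forall>v\<in>broken_H_d T j. (\<Sum>K\<in>T. F K v) = 0" and K: "K \<in> T" and v: "v \<in> H_d K j"
    show "F K v = 0"
    proof (rule broken_localize[where F=F and X="\<lambda>K. H_d K j" and K=K and v=v])
      show "(\<Sum>K\<in>T. F K v) = 0" if "\<And>K. K \<in> T \<Longrightarrow> v \<in> H_d K j" for v
        using h that by (simp add: broken_H_d_def)
      show "F K v = F K w \<and> (v \<in> H_d K j \<longleftrightarrow> w \<in> H_d K j)" if "\<And>x. x \<in> K \<Longrightarrow> v x = w x" for K v w
        using L2_inner_cong_on[of K s s v w] H_d_cong_on[of K v w] trace_form_cong_on[of K v w \<eta> \<eta> j] that
        by (simp add: F_def)
      show "(\<lambda>x. 0) \<in> H_d K j \<and> F K (\<lambda>x. 0) = 0" if K: "K \<in> T" for K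
      proof -
        have "AE x in lebesgue_on K. ext_d K j (\<lambda>x. 0) x = 0"
          by (rule ext_d_unique[OF opn[OF K] zero_H_d[OF opn[OF K]] L2_forms_zero[OF opn[OF K]] has_weak_d_zero[OF opn[OF K]]])
        from L2_inner_AE_cong(2)[OF opn[OF K] ext_d_spec(1)[OF zero_H_d[OF opn[OF K]]] z[OF K] this]
        have "L2_inner K z (ext_d K j (\<lambda>x. 0)) = 0" by (simp add: L2_inner_eq ip_def)
        then show ?thesis using zero_H_d[OF opn[OF K]] trace_form_zero_left[OF opn[OF K] \<eta>K[OF K]]
          by (simp add: F_def) (simp add: L2_inner_eq ip_def)
      qed
    qed (use K v in auto)
  next
    fix v assume "\<forall>K\<in>T. \<forall>v\<in>H_d K j. F K v = 0" "v \<in> broken_H_d T j"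
    then show "(\<Sum>K\<in>T. F K v) = 0" by (intro sum.neutral) (auto simp: broken_H_d_def)
  qed
  also have "\<dots> \<longleftrightarrow> (\<forall>K\<in>T. has_weak_codiff K (j + 1) z s \<and> nor_trace K (j + 1) \<eta> = nor_trace K (j + 1) z)"
    unfolding F_def using codiff_and_nor_trace_iff[OF opn s z \<eta>K] by blast
  also have "\<dots> \<longleftrightarrow> (\<forall>K\<in>T. has_weak_codiff K (j + 1) z s) \<and> broken_nor T (j + 1) \<eta> = broken_nor T (j + 1) z"
    by (auto simp: broken_nor_def restrict_def fun_eq_iff)
  finally show ?thesis using eq by simp
qed

text \<open>For conforming \<open>v\<close> the elementwise derivatives recombine to the derivative
  on the domain. As \<open>z\<close> has its codifferential \<open>s\<close> elementwise, the
  right-hand side measures the jumps of its normal trace across interfaces together with its value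
  on the outer boundary.\<close>

lemma broken_pair_conforming:
  assumes v: "v \<in> H_d \<Omega> j" and z: "z \<in> L2_forms \<Omega> (j + 1)" and s: "\<And>K. K \<in> T \<Longrightarrow> s \<in> L2_forms K j"
    and w: "\<And>K. K \<in> T \<Longrightarrow> has_weak_codiff K (j + 1) z s"
  shows "broken_pair T j (broken_tan T j v) (broken_nor T (j + 1) z) = L2_inner \<Omega> (ext_d \<Omega> j v) z - L2_inner \<Omega> v s"
proof -
  have zH: "z \<in> H_delta K (j + 1)" if "K \<in> T" for K
    using H_delta_I[OF L2_forms_cell[OF z that] _ w[OF that]] s[OF that] by simp
  then have zB: "z \<in> broken_H_delta T (j + 1)" by (simp add: broken_H_delta_def)
  have "trace_form K j v z = L2_inner K (broken_d T j v) z - L2_inner K v s" if K: "K \<in> T" for K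
  proof -
    have "L2_inner K (broken_d T j v) z = L2_inner K (ext_d K j v) z"
      by (rule L2_inner_cong_on) (use broken_d_cell[OF K] in auto)
    then show ?thesis using trace_form_codiff[OF opn[OF K] H_d_cell[OF v K] zH[OF K] s[OF K] w[OF K]] by simp
  qed
  then have "broken_pair T j (broken_tan T j v) (broken_nor T (j + 1) z) = broken_inner T (broken_d T j v) z - broken_inner T v s"
    unfolding broken_pair_eq[OF H_d_broken[OF v] zB] by (simp add: broken_inner_def sum_subtractf)
  also have "\<dots> = L2_inner \<Omega> (ext_d \<Omega> j v) z - L2_inner \<Omega> v s"
    using broken_inner_broken_d[OF v L2_forms_cell[OF z]]
      L2_inner_cells[OF ext_d_spec(1)[OF v] z] L2_inner_cells[OF H_d_L2[OF v] L2_forms_cells[OF s]] by simp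
  finally show ?thesis .
qed

text \<open>Moving everything but the du-term into the residual \<open>s\<close> brings (b) into the
  shape of (a), with \<open>s\<close> in place of \<sigma> and du in place of \<open>u\<close>;
  \<open>r\<close> stands for the boundary term.\<close>

lemma second_equation_residual:
  assumes f: "f \<in> L2_forms \<Omega> k" and \<sigma>: "\<sigma> \<in> broken_H_d T (k - 1)" and u: "u \<in> H_d \<Omega> k"
    and pbar: "pbar \<in> broken_harmonic0 T k" and p: "p \<in> harmonic \<Omega> k" and v: "v \<in> broken_H_d T k"
  defines "s \<equiv> \<lambda>x. f x - broken_d T (k - 1) \<sigma> x - (pbar x + p x)"
  shows "\<And>K. K \<in> T \<Longrightarrow> s \<in> L2_forms K k"
    and "broken_inner T (broken_d T (k - 1) \<sigma>) v + broken_inner T (broken_d T k u) (broken_d T k v)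
        + broken_inner T (\<lambda>x. pbar x + p x) v - r = broken_inner T f v \<longleftrightarrow>
      broken_inner T s v - broken_inner T (ext_d \<Omega> k u) (broken_d T k v) + r = 0"
proof -
  have L: "f \<in> L2_forms K k" "broken_d T (k - 1) \<sigma> \<in> L2_forms K k" "(\<lambda>x. pbar x + p x) \<in> L2_forms K k"
    "v \<in> L2_forms K k" "broken_d T k v \<in> L2_forms K (k + 1)" if K: "K \<in> T" for K
  proof -
    show "f \<in> L2_forms K k" using L2_forms_cell[OF f K] .
    show "broken_d T (k - 1) \<sigma> \<in> L2_forms K k" using broken_d_L2[OF \<sigma> K] by simp
    show "v \<in> L2_forms K k" using v K by (simp add: broken_H_d_def H_d_L2)
    show "broken_d T k v \<in> L2_forms K (k + 1)" using broken_d_L2[OF v K] .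
    have "pbar \<in> L2_forms K k" using pbar K by (simp add: broken_harmonic0_def harmonic0_L2)
    then show "(\<lambda>x. pbar x + p x) \<in> L2_forms K k"
      using L2_forms_cell[OF harmonic_L2[OF p] K] by (rule L2_forms_add)
  qed
  show "s \<in> L2_forms K k" if "K \<in> T" for K
    unfolding s_def using L[OF that] by (intro L2_forms_diff)
  have "broken_inner T s v = broken_inner T (\<lambda>x. f x - broken_d T (k - 1) \<sigma> x) v - broken_inner T (\<lambda>x. pbar x + p x) v"
    unfolding s_def using L by (intro broken_inner_diff_left L2_forms_diff)
  also have "broken_inner T (\<lambda>x. f x - broken_d T (k - 1) \<sigma> x) v = broken_inner T f v - broken_inner T (broken_d T (k - 1) \<sigma>) v"
    using L by (intro broken_inner_diff_left)
  finally have "broken_inner T s v = broken_inner T f v - broken_inner T (broken_d T (k - 1) \<sigma>) v - broken_inner T (\<lambda>x. pbar x + p x) v" .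
  moreover have "broken_inner T (broken_d T k u) (broken_d T k v) = broken_inner T (ext_d \<Omega> k u) (broken_d T k v)"
    by (rule broken_inner_broken_d[OF u L(5)])
  ultimately show "broken_inner T (broken_d T (k - 1) \<sigma>) v + broken_inner T (broken_d T k u) (broken_d T k v)
        + broken_inner T (\<lambda>x. pbar x + p x) v - r = broken_inner T f v \<longleftrightarrow>
      broken_inner T s v - broken_inner T (ext_d \<Omega> k u) (broken_d T k v) + r = 0"
    by linarith
qed

text \<open>Testing with broken forms identifies the codifferential of \<open>z\<close> on each element and then the normal
  trace; testing with conforming forms removes the boundary terms.\<close>

lemma normal_trace_equations_iff:
  assumes z: "z \<in> L2_forms \<Omega> (j + 1)" and s: "\<And>K. K \<in> T \<Longrightarrow> s \<in> L2_forms K j"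
  shows "E \<in> W_nor T j \<and> (\<forall>v\<in>broken_H_d T j. broken_inner T s v - broken_inner T z (broken_d T j v)
        + broken_pair T j (broken_tan T j v) E = 0) \<and> (\<forall>V\<in>V_tan \<Omega> T j. broken_pair T j V E = 0) \<longleftrightarrow>
    (\<forall>v\<in>H_d \<Omega> j. L2_inner \<Omega> s v - L2_inner \<Omega> z (ext_d \<Omega> j v) = 0) \<and> E = broken_nor T (j + 1) z"
  (is "?W \<and> ?a \<and> ?h \<longleftrightarrow> ?m \<and> ?E")
proof
  assume l: "?W \<and> ?a \<and> ?h"
  then obtain \<eta> where \<eta>: "\<eta> \<in> broken_H_delta T (j + 1)" and E: "E = broken_nor T (j + 1) \<eta>"
    by (auto simp: W_nor_def)
  have A: "(\<forall>K\<in>T. has_weak_codiff K (j + 1) z s) \<and> E = broken_nor T (j + 1) z"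
    using broken_codiff_and_nor_iff[OF s L2_forms_cell[OF z] \<eta>] l E by simp
  \<comment> \<open>The boundary term for a conforming \<open>v\<close> is the negative of the
    left-hand side here, and (h) or (i) makes it vanish.\<close>
  have "L2_inner \<Omega> s v - L2_inner \<Omega> z (ext_d \<Omega> j v) = 0" if v: "v \<in> H_d \<Omega> j" for v
    using broken_pair_conforming[OF v z s] A l v by (simp add: V_tan_def L2_inner_eq ip_commute)
  then show "?m \<and> ?E" using A by blast
next
  assume r: "?m \<and> ?E"
  have "has_weak_codiff \<Omega> (j + 1) z s"
    unfolding has_weak_codiff_def
  proof
    fix \<phi> :: "'n form" assume "\<phi> \<in> test_forms \<Omega> (j + 1 - 1)"
    then have \<phi>: "\<phi> \<in> test_forms \<Omega> j" by simp
    have "smooth_d \<phi> \<in> L2_forms \<Omega> (j + 1)"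
      using test_forms_L2[OF smooth_d_test_forms[OF \<phi>] \<Omega>] by (simp add: L2_forms_eq)
    from ip_ext_d_eq[OF \<Omega> test_forms_H_d(1)[OF \<Omega> \<phi>] this test_forms_has_weak_d[OF \<Omega> \<phi>] z[unfolded L2_forms_eq]]
    show "L2_inner \<Omega> s \<phi> = L2_inner \<Omega> z (smooth_d \<phi>)"
      using r test_forms_H_d(1)[OF \<Omega> \<phi>] by (simp add: L2_inner_eq ip_commute[of _ z])
  qed
  then have w: "has_weak_codiff K (j + 1) z s" if "K \<in> T" for K
    using has_weak_codiff_subset[OF _ opn \<Omega> sub] that by blast
  have zD: "z \<in> broken_H_delta T (j + 1)"
    using H_delta_I[OF L2_forms_cell[OF z] _ w] s by (simp add: broken_H_delta_def)
  have "broken_pair T j (broken_tan T j v) (broken_nor T (j + 1) z) = 0" if v: "v \<in> H_d \<Omega> j" for v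
    using broken_pair_conforming[OF v z s w] r v ip_commute[of "lebesgue_on \<Omega>" v s]
      ip_commute[of "lebesgue_on \<Omega>" z "ext_d \<Omega> j v"] by (simp add: L2_inner_eq)
  then have ?h using r by (auto simp: V_tan_def)
  moreover have ?W using r zD by (simp add: W_nor_def)
  moreover have ?a using broken_codiff_and_nor_iff[OF s L2_forms_cell[OF z] zD] w r by simp
  ultimately show "?W \<and> ?a \<and> ?h" by blast
qed

text \<open>Membership and equation are kept together, because conformity of \<open>v\<close> comes
  from the existence of a conforming form with the same traces. Used for \<sigma> in degree k - 1
  and for u in degree k.\<close>

lemma tangential_trace_equation_iff:
  "v \<in> broken_H_d T j \<and> V \<in> V_tan \<Omega> T j \<and>
    (\<forall>E\<in>W_nor T j. broken_pair T j (trace_diff T V (broken_tan T j v)) E = 0) \<longleftrightarrow>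
    v \<in> H_d \<Omega> j \<and> V = broken_tan T j v" (is "?l \<longleftrightarrow> ?r")
proof
  assume l: ?l
  then obtain w where w: "w \<in> H_d \<Omega> j" and V: "V = broken_tan T j w" by (auto simp: V_tan_def)
  have "V = broken_tan T j v" using broken_tan_eq_iff[OF H_d_broken[OF w]] l V by simp
  then show ?r using H_d_of_broken_tan_eq[OF _ w] l V by simp
next
  assume r: ?r
  then show ?l using broken_tan_eq_iff[OF H_d_broken H_d_broken] H_d_broken by (auto simp: V_tan_def)
qed

text \<open>With \<open>pbar\<close> as its own test form, a sum of nonnegative squared norms is
  zero. The almost everywhere condition is independent of the representative.\<close>

lemma broken_harmonic0_self_orthogonal_iff:
  "pbar \<in> broken_harmonic0 T k \<and> (\<forall>v\<in>broken_harmonic0 T k. broken_inner T pbar v = 0) \<longleftrightarrow>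
    (AE x in lebesgue_on \<Omega>. pbar x = 0)" (is "?l \<longleftrightarrow> ?r")
proof
  assume l: ?l
  show ?r
  proof (rule AE_cells)
    fix K assume K: "K \<in> T"
    have "(\<Sum>K\<in>T. L2_inner K pbar pbar) = 0" using l by (simp add: broken_inner_def)
    then have "L2_inner K pbar pbar = 0"
      using K fin by (simp add: sum_nonneg_eq_0_iff L2_inner_eq ip_nonneg)
    moreover have "pbar \<in> L2_forms K k" using l K by (simp add: broken_harmonic0_def harmonic0_L2)
    ultimately show "AE x in lebesgue_on K. pbar x = 0"
      using ip_self_eq_0 unfolding L2_inner_eq L2_forms_eq by blast
  qed
next
  assume r: ?r
  have z: "AE x in lebesgue_on K. pbar x = 0" if "K \<in> T" for K
    by (rule AE_lebesgue_on_subset[OF r opn[OF that] \<Omega> sub[OF that]])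
  then have pbar: "pbar \<in> broken_harmonic0 T k"
    using AE_zero_imp_harmonic0[OF opn] by (simp add: broken_harmonic0_def)
  have "L2_inner K pbar v = 0" if "K \<in> T" "v \<in> broken_harmonic0 T k" for K v
    using L2_inner_AE_cong(1)[OF opn[OF that(1)] _ _ z[OF that(1)], of k v k] that pbar
    by (simp add: broken_harmonic0_def harmonic0_L2) (simp add: L2_inner_eq ip_def)
  then show ?l using pbar by (simp add: broken_inner_def)
qed

text \<open>Once \<sigma> and u are conforming and \<open>pbar\<close> is null, the remaining
  unknowns decouple: each can be grouped with its own equations and rewritten by an
  equivalence.\<close>

lemma hybrid_solution_iff:
  assumes f: "f \<in> L2_forms \<Omega> k"
  shows "hybrid_solution \<Omega> T k f \<sigma> u pbar u_nor \<rho>_nor p ubar \<sigma>_tan u_tan \<longleftrightarrow>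
    mixed_solution \<Omega> k f \<sigma> u p \<and> (AE x in lebesgue_on \<Omega>. pbar x = 0) \<and>
    u_nor = broken_nor T k u \<and> \<rho>_nor = broken_nor T (k + 1) (ext_d \<Omega> k u) \<and>
    is_broken_harmonic0_proj T k u ubar \<and> \<sigma>_tan = broken_tan T (k - 1) \<sigma> \<and> u_tan = broken_tan T k u"
    (is "?hyb \<longleftrightarrow> ?mix")
proof (cases "\<sigma> \<in> H_d \<Omega> (k - 1) \<and> u \<in> H_d \<Omega> k \<and> (AE x in lebesgue_on \<Omega>. pbar x = 0) \<and> p \<in> harmonic \<Omega> k")
  case False
  \<comment> \<open>Both sides entail the four conditions of the case distinction; here the hybrid
    side does so through (d), (e) and (g).\<close>
  then have "\<not> ?hyb"
    unfolding hybrid_solution_def broken_harmonic0_self_orthogonal_iff[of pbar k, symmetric]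
    using tangential_trace_equation_iff[of \<sigma> "k - 1" \<sigma>_tan] tangential_trace_equation_iff[of u k u_tan] by blast
  moreover have "\<not> ?mix" using False by (auto simp: mixed_solution_def)
  ultimately show ?thesis by blast
next
  case True
  then have \<sigma>: "\<sigma> \<in> H_d \<Omega> (k - 1)" and u: "u \<in> H_d \<Omega> k" and z: "AE x in lebesgue_on \<Omega>. pbar x = 0"
    and p: "p \<in> harmonic \<Omega> k" by blast+
  note B = H_d_broken[OF \<sigma>] H_d_broken[OF u]
  have pbar: "pbar \<in> broken_harmonic0 T k" using z broken_harmonic0_self_orthogonal_iff by blast
  define r where "r = (\<lambda>x. f x - broken_d T (k - 1) \<sigma> x - (pbar x + p x))"
  note res = second_equation_residual[OF f B(1) u pbar p, folded r_def]
  have rL: "r \<in> L2_forms K k" if "K \<in> T" for K by (rule res(1)[OF B(2) that])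
  have duL: "ext_d \<Omega> k u \<in> L2_forms \<Omega> (k + 1)" by (rule ext_d_spec(1)[OF u])
  have dL: "ext_d \<Omega> (k - 1) \<sigma> \<in> L2_forms \<Omega> k" using ext_d_spec(1)[OF \<sigma>] by simp
  have "AE x in lebesgue_on \<Omega>. broken_d T (k - 1) \<sigma> x = ext_d \<Omega> (k - 1) \<sigma> x"
    by (rule AE_cells[OF AE_broken_d[OF \<sigma>]])
  \<comment> \<open>Conformity of \<sigma> and nullity of \<open>pbar\<close> turn the broken
    residual into the one of the mixed problem.\<close>
  then have rAE: "AE x in lebesgue_on \<Omega>. r x = f x - ext_d \<Omega> (k - 1) \<sigma> x - p x"
    using z by eventually_elim (simp add: r_def)
  have rv: "L2_inner \<Omega> r v = L2_inner \<Omega> f v - L2_inner \<Omega> (ext_d \<Omega> (k - 1) \<sigma>) v - L2_inner \<Omega> p v"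
    if v: "v \<in> H_d \<Omega> k" for v
  proof -
    note L = f[unfolded L2_forms_eq] dL[unfolded L2_forms_eq] harmonic_L2[OF p, unfolded L2_forms_eq]
    have "L2_inner \<Omega> r v = L2_inner \<Omega> (\<lambda>x. f x - ext_d \<Omega> (k - 1) \<sigma> x - p x) v"
      by (rule L2_inner_AE_cong(1)[OF \<Omega> L2_forms_cells[OF rL] H_d_L2[OF v] rAE])
    then show ?thesis
      unfolding L2_inner_eq
        ip_diff_left[OF L2_diff[OF subspace_alt_deg L(1,2)] L(3) H_d_L2[OF v, unfolded L2_forms_eq]]
        ip_diff_left[OF L(1,2) H_d_L2[OF v, unfolded L2_forms_eq]] .
  qed
  have uL: "u \<in> L2_forms K k" if "K \<in> T" for K by (rule L2_forms_cell[OF H_d_L2[OF u] that])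
  \<comment> \<open>\<open>normal_trace_equations_iff\<close> takes \<open>z\<close> in degree
    \<open>j + 1\<close>; the instance with \<open>z = u\<close> has
    \<open>j = k - 1\<close>.\<close>
  have "k - 1 + 1 = k" by simp
  note u_nor = normal_trace_equations_iff[of u "k - 1" \<sigma> u_nor, unfolded this,
      OF H_d_L2[OF u] L2_forms_cell[OF H_d_L2[OF \<sigma>]]]
  have "(\<forall>v\<in>H_d \<Omega> k. L2_inner \<Omega> r v - L2_inner \<Omega> (ext_d \<Omega> k u) (ext_d \<Omega> k v) = 0) \<longleftrightarrow>
      (\<forall>v\<in>H_d \<Omega> k. L2_inner \<Omega> (ext_d \<Omega> (k - 1) \<sigma>) v + L2_inner \<Omega> (ext_d \<Omega> k u) (ext_d \<Omega> k v)
        + L2_inner \<Omega> p v = L2_inner \<Omega> f v)"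
    by (rule ball_cong[OF refl]) (use rv in auto)
  note \<rho>_nor = normal_trace_equations_iff[OF duL rL, of \<rho>_nor, unfolded this]
  \<comment> \<open>(c) and the definition of the projection use differences of opposite
    sign.\<close>
  have "broken_inner T (\<lambda>x. ubar x - u x) q = - broken_inner T (\<lambda>x. u x - ubar x) q"
    if "ubar \<in> broken_harmonic0 T k" "q \<in> broken_harmonic0 T k" for q
  proof -
    have L: "ubar \<in> L2_forms K k" "q \<in> L2_forms K k" if "K \<in> T" for K
      using \<open>ubar \<in> _\<close> \<open>q \<in> _\<close> that by (auto simp: broken_harmonic0_def harmonic0_L2)
    show ?thesis
      using broken_inner_diff_left[of T, OF uL L] broken_inner_diff_left[of T, OF L(1) uL L(2)] by simp
  qed
  then have ubar: "ubar \<in> broken_harmonic0 T k \<and> (\<forall>q\<in>broken_harmonic0 T k. broken_inner T (\<lambda>x. ubar x - u x) q = 0)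
      \<longleftrightarrow> is_broken_harmonic0_proj T k u ubar"
    unfolding is_broken_harmonic0_proj_def by auto
  have q: "broken_inner T u q = L2_inner \<Omega> u q" if "q \<in> harmonic \<Omega> k" for q
    by (rule L2_inner_cells[OF H_d_L2[OF u] harmonic_L2[OF that]])
  \<comment> \<open>A rearrangement that places each membership next to the equations determining
    that unknown, matching the left-hand sides of the equivalences above.\<close>
  have "?hyb \<longleftrightarrow> p \<in> harmonic \<Omega> k \<and>
     (\<sigma> \<in> broken_H_d T (k - 1) \<and> \<sigma>_tan \<in> V_tan \<Omega> T (k - 1) \<and>
       (\<forall>E\<in>W_nor T (k - 1). broken_pair T (k - 1) (trace_diff T \<sigma>_tan (broken_tan T (k - 1) \<sigma>)) E = 0)) \<and>
     (u \<in> broken_H_d T k \<and> u_tan \<in> V_tan \<Omega> T k \<and>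
       (\<forall>E\<in>W_nor T k. broken_pair T k (trace_diff T u_tan (broken_tan T k u)) E = 0)) \<and>
     (pbar \<in> broken_harmonic0 T k \<and> (\<forall>v\<in>broken_harmonic0 T k. broken_inner T pbar v = 0)) \<and>
     (u_nor \<in> W_nor T (k - 1) \<and> (\<forall>\<tau>\<in>broken_H_d T (k - 1). broken_inner T \<sigma> \<tau>
        - broken_inner T u (broken_d T (k - 1) \<tau>) + broken_pair T (k - 1) (broken_tan T (k - 1) \<tau>) u_nor = 0) \<and>
       (\<forall>V\<in>V_tan \<Omega> T (k - 1). broken_pair T (k - 1) V u_nor = 0)) \<and>
     (\<rho>_nor \<in> W_nor T k \<and> (\<forall>v\<in>broken_H_d T k. broken_inner T (broken_d T (k - 1) \<sigma>) v
        + broken_inner T (broken_d T k u) (broken_d T k v) + broken_inner T (\<lambda>x. pbar x + p x) v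
        - broken_pair T k (broken_tan T k v) \<rho>_nor = broken_inner T f v) \<and>
       (\<forall>V\<in>V_tan \<Omega> T k. broken_pair T k V \<rho>_nor = 0)) \<and>
     (ubar \<in> broken_harmonic0 T k \<and> (\<forall>q\<in>broken_harmonic0 T k. broken_inner T (\<lambda>x. ubar x - u x) q = 0)) \<and>
     (\<forall>q\<in>harmonic \<Omega> k. broken_inner T u q = 0)"
    unfolding hybrid_solution_def by (rule iffI) (elim conjE, intro conjI, assumption+)+
  also have "\<dots> \<longleftrightarrow> p \<in> harmonic \<Omega> k \<and> (\<sigma> \<in> H_d \<Omega> (k - 1) \<and> \<sigma>_tan = broken_tan T (k - 1) \<sigma>) \<and>
     (u \<in> H_d \<Omega> k \<and> u_tan = broken_tan T k u) \<and> (AE x in lebesgue_on \<Omega>. pbar x = 0) \<and>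
     ((\<forall>\<tau>\<in>H_d \<Omega> (k - 1). L2_inner \<Omega> \<sigma> \<tau> - L2_inner \<Omega> u (ext_d \<Omega> (k - 1) \<tau>) = 0) \<and> u_nor = broken_nor T k u) \<and>
     ((\<forall>v\<in>H_d \<Omega> k. L2_inner \<Omega> (ext_d \<Omega> (k - 1) \<sigma>) v + L2_inner \<Omega> (ext_d \<Omega> k u) (ext_d \<Omega> k v)
        + L2_inner \<Omega> p v = L2_inner \<Omega> f v) \<and> \<rho>_nor = broken_nor T (k + 1) (ext_d \<Omega> k u)) \<and>
     is_broken_harmonic0_proj T k u ubar \<and> (\<forall>q\<in>harmonic \<Omega> k. L2_inner \<Omega> u q = 0)"
    by (simp only: tangential_trace_equation_iff broken_harmonic0_self_orthogonal_iff u_nor res(2) \<rho>_nor ubar q cong: ball_cong)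
  also have "\<dots> \<longleftrightarrow> ?mix"
    unfolding mixed_solution_def by (rule iffI) (elim conjE, intro conjI, assumption+)+
  finally show ?thesis .
qed

end

theorem theorem3p2:
  fixes \<Omega> :: "'n::{finite,linorder} region" and T :: "'n region set" and k :: int
    and f \<sigma> u pbar p ubar :: "'n form"
    and u_nor \<rho>_nor \<sigma>_tan u_tan :: "'n broken_trace"
  assumes "lipschitz_domain \<Omega>" and "bounded \<Omega>"
    and "lipschitz_decomposition \<Omega> T"
    and "0 \<le> k" and "k \<le> int CARD('n)"
    and "f \<in> L2_forms \<Omega> k"
  shows "hybrid_solution \<Omega> T k f \<sigma> u pbar u_nor \<rho>_nor p ubar \<sigma>_tan u_tan \<longleftrightarrow>
    mixed_solution \<Omega> k f \<sigma> u p \<and>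
    (AE x in lebesgue_on \<Omega>. pbar x = 0) \<and>
    u_nor = broken_nor T k u \<and>
    \<rho>_nor = broken_nor T (k + 1) (ext_d \<Omega> k u) \<and>
    is_broken_harmonic0_proj T k u ubar \<and>
    \<sigma>_tan = broken_tan T (k - 1) \<sigma> \<and>
    u_tan = broken_tan T k u"
proof -
  have \<Omega>: "open \<Omega>" using assms(1) by (simp add: lipschitz_domain_def)
  have T: "finite T" "pairwise disjnt T" "closure \<Omega> = (\<Union>K\<in>T. closure K)"
    and K: "\<And>K. K \<in> T \<Longrightarrow> lipschitz_domain K" "\<And>K. K \<in> T \<Longrightarrow> K \<subseteq> \<Omega>"
    using assms(3) by (auto simp: lipschitz_decomposition_def)
  have opn: "open K" if "K \<in> T" for K using K(1)[OF that] by (simp add: lipschitz_domain_def)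
  \<comment> \<open>The closed elements cover the domain, and a point in a closed element but in no
    open one lies on a frontier.\<close>
  have "\<Omega> - \<Union>T \<subseteq> (\<Union>K\<in>T. frontier K)"
  proof
    fix x assume x: "x \<in> \<Omega> - \<Union>T"
    then have "x \<in> closure \<Omega>" using closure_subset by blast
    then obtain K where "K \<in> T" "x \<in> closure K" using T(3) by blast
    then show "x \<in> (\<Union>K\<in>T. frontier K)" using x opn by (auto simp: frontier_def interior_open)
  qed
  moreover have "negligible (\<Union>K\<in>T. frontier K)"
    using T(1) K(1) by (intro negligible_Union) (auto intro: negligible_frontier_lipschitz_domain)
  ultimately have null: "negligible (\<Omega> - \<Union>T)" using negligible_subset by blast
  show ?thesis by (rule hybrid_solution_iff[OF \<Omega> T(1) opn K(2) T(2) null assms(6)])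
qed

end
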